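(* Let $s_1,s_2,\sigma_1,\sigma_2>0$, let $f_j\in (\mathcal S_{s_j}^{\sigma_j})'(\mathbf R^{d_j})$ for $j=1,2$, let $\varphi\in \mathcal S_{s_1,s_2}^{\sigma_1,\sigma_2}(\mathbf R^{d_1+d_2})$, and let $$\psi_1(x_1)=\langle f_2,\varphi(x_1,\cdot)\rangle\ (x_1\in\mathbf R^{d_1}),\qquad \psi_2(x_2)=\langle f_1,\varphi(\cdot,x_2)\rangle\ (x_2\in\mathbf R^{d_2}).$$ Then $\psi_j\in \mathcal S_{s_j}^{\sigma_j}(\mathbf R^{d_j})$, $j=1,2$, and there is a unique $f\in (\mathcal S_{s_1,s_2}^{\sigma_1,\sigma_2})'(\mathbf R^{d_1+d_2})$ such that for every $\varphi_1\in \mathcal S_{s_1}^{\sigma_1}(\mathbf R^{d_1})$ and $\varphi_2\in \mathcal S_{s_2}^{\sigma_2}(\mathbf R^{d_2})$, $$\langle f,\varphi_1\otimes\varphi_2\rangle=\langle f_1,\varphi_1\rangle\,\langle f_2,\varphi_2\rangle\qquad\text{and}\qquad \langle f,\varphi\rangle=\langle f_1,\psi_1\rangle=\langle f_2,\psi_2\rangle$$ hold. The same holds true with $\Sigma_{s_j}^{\sigma_j}$, $(\Sigma_{s_j}^{\sigma_j})'$, $\Sigma_{s_1,s_2}^{\sigma_1,\sigma_2}$ and $(\Sigma_{s_1,s_2}^{\sigma_1,\sigma_2})'$ in place of $\mathcal S_{s_j}^{\sigma_j}$, $(\mathcal S_{s_j}^{\sigma_j})'$, $\mathcal S_{s_1,s_2}^{\sigma_1,\sigma_2}$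 and $(\mathcal S_{s_1,s_2}^{\sigma_1,\sigma_2})'$, respectively, at each occurrence.
   Context: Gelfand-Shilov spaces. Let $n\ge1$, let $d_1,\dots,d_n\ge 0$ be integers, $d=d_1+\cdots+d_n$, and $\boldsymbol s=(s_1,\dots,s_n)$, $\boldsymbol\sigma=(\sigma_1,\dots,\sigma_n)\in\mathbf R_+^n$ (positive entries). Write multi-indices $\alpha\in\mathbf N^d$ as $\alpha=(\alpha_1,\dots,\alpha_n)$ with $\alpha_j\in\mathbf N^{d_j}$, and set $\alpha!^{\boldsymbol s}=\alpha_1!^{s_1}\cdots\alpha_n!^{s_n}$. For $h>0$ and $f\in C^\infty(\mathbf R^d)$ (complex-valued) let $$\|f\|_{\mathcal S_{\boldsymbol s;h}^{\boldsymbol\sigma}}=\sup_{\alpha,\beta\in\mathbf N^d}\frac{\|x^\alpha\partial_x^\beta f\|_{L^\infty(\mathbf R^d)}}{h^{|\alpha|+|\beta|}\,\alpha!^{\boldsymbol s}\,\beta!^{\boldsymbol\sigma}},$$ and let $\mathcal S_{\boldsymbol s;h}^{\boldsymbol\sigma}(\mathbf R^d)$ be the Banach space of all $f\in C^\infty(\mathbf R^d)$ for which this is finite. Then $\mathcal S_{\boldsymbol s}^{\boldsymbol\sigma}(\mathbf R^d)=\bigcup_{h>0}\mathcal S_{\boldsymbol s;h}^{\boldsymbol\sigma}(\mathbf R^d)$ with the inductive limit topology and $\Sigma_{\boldsymbol s}^{\boldsymbol\sigma}(\mathbf R^d)=\bigcap_{h>0}\mathcal S_{\boldsymbol s;h}^{\boldsymbol\sigma}(\mathbf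 R^d)$ with the projective limit topology. For $n=1$ and $n=2$ these are written $\mathcal S_{s}^{\sigma}$, $\Sigma_s^\sigma$ and $\mathcal S_{s_1,s_2}^{\sigma_1,\sigma_2}$, $\Sigma_{s_1,s_2}^{\sigma_1,\sigma_2}$ (the splitting being $\mathbf R^{d_1+d_2}=\mathbf R^{d_1}\times\mathbf R^{d_2}$). The distribution spaces $(\mathcal S_{\boldsymbol s}^{\boldsymbol\sigma})'(\mathbf R^d)$ and $(\Sigma_{\boldsymbol s}^{\boldsymbol\sigma})'(\mathbf R^d)$ are the topological duals of $\mathcal S_{\boldsymbol s}^{\boldsymbol\sigma}(\mathbf R^d)$ and $\Sigma_{\boldsymbol s}^{\boldsymbol\sigma}(\mathbf R^d)$. $\langle\cdot,\cdot\rangle$ is the bilinear duality pairing, and $(\varphi_1\otimes\varphi_2)(x_1,x_2)=\varphi_1(x_1)\varphi_2(x_2)$. *)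

theory Defs
  imports "HOL-Analysis.Analysis" "HOL-Probability.Essential_Supremum"
begin

section \<open>Points, multi-indices, smooth functions\<close>

text \<open>
  Since dimension 0 is allowed, \<open>\<real>\<^sup>d\<close> is not a type: it is the set of extensional functions on
  \<open>{..<d}\<close>, which is also the space of the measure \<open>PiM {..<d} (\<lambda>_. lborel)\<close> (Lebesgue measure).
  The product topology of \<^typ>\<open>nat \<Rightarrow> real\<close> restricts to the Euclidean topology on it.
  A function on \<open>\<real>\<^sup>d\<close> is represented by its extension by zero to the whole type, so that
  the representative is unique and sums and multiples can be formed pointwise.
\<close>

definition Rd :: "nat \<Rightarrow> (nat \<Rightarrow> real) set"
  where "Rd d = {..<d} \<rightarrow>\<^sub>E UNIV"

definition Nd :: "nat \<Rightarrow> (nat \<Rightarrow> nat) set"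
  where "Nd d = {..<d} \<rightarrow>\<^sub>E UNIV"

definition on_Rd :: "nat \<Rightarrow> ((nat \<Rightarrow> real) \<Rightarrow> complex) \<Rightarrow> (nat \<Rightarrow> real) \<Rightarrow> complex"
  where "on_Rd d f = (\<lambda>x. if x \<in> Rd d then f x else 0)"

definition partial_deriv :: "nat \<Rightarrow> ((nat \<Rightarrow> real) \<Rightarrow> complex) \<Rightarrow> (nat \<Rightarrow> real) \<Rightarrow> complex"
  where "partial_deriv i f = (\<lambda>x. vector_derivative (\<lambda>t. f (x(i := t))) (at (x i)))"

primrec Ck :: "nat \<Rightarrow> nat \<Rightarrow> ((nat \<Rightarrow> real) \<Rightarrow> complex) \<Rightarrow> bool"
  where
    "Ck d 0 f \<longleftrightarrow> continuous_on (Rd d) f"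
  | "Ck d (Suc k) f \<longleftrightarrow> continuous_on (Rd d) f \<and>
       (\<forall>i<d. (\<forall>x\<in>Rd d. (\<lambda>t. f (x(i := t))) differentiable (at (x i))) \<and>
              Ck d k (partial_deriv i f))"

definition Cinf :: "nat \<Rightarrow> ((nat \<Rightarrow> real) \<Rightarrow> complex) set"
  where "Cinf d = {f. (\<forall>k. Ck d k f) \<and> (\<forall>x. x \<notin> Rd d \<longrightarrow> f x = 0)}"

definition multi_deriv ::
    "nat \<Rightarrow> (nat \<Rightarrow> nat) \<Rightarrow> ((nat \<Rightarrow> real) \<Rightarrow> complex) \<Rightarrow> (nat \<Rightarrow> real) \<Rightarrow> complex"
  where "multi_deriv d \<beta> f = foldr (\<lambda>i g. (partial_deriv i ^^ \<beta> i) g) [0..<d] f"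

definition monomial :: "nat \<Rightarrow> (nat \<Rightarrow> nat) \<Rightarrow> (nat \<Rightarrow> real) \<Rightarrow> real"
  where "monomial d \<alpha> x = (\<Prod>i<d. x i ^ \<alpha> i)"

definition Linf_norm :: "nat \<Rightarrow> ((nat \<Rightarrow> real) \<Rightarrow> complex) \<Rightarrow> ereal"
  where "Linf_norm d g = esssup (PiM {..<d} (\<lambda>_. lborel)) (\<lambda>x. ereal (cmod (g x)))"


section \<open>The spaces and their topologies\<close>

text \<open>
  The lists \<open>ds\<close>, \<open>ss\<close>, \<open>\<sigma>s\<close> hold the block dimensions \<open>d\<^sub>1,\<dots>,d\<^sub>n\<close> and the exponents;
  coordinates of \<open>\<real>\<^sup>d\<close>, \<open>d = sum_list ds\<close>, are numbered consecutively through the blocks.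
\<close>

definition block :: "nat list \<Rightarrow> nat \<Rightarrow> nat set"
  where "block ds j = {sum_list (take j ds) ..< sum_list (take (Suc j) ds)}"

definition fact_powr :: "nat list \<Rightarrow> real list \<Rightarrow> (nat \<Rightarrow> nat) \<Rightarrow> real"
  where "fact_powr ds ss \<alpha> = (\<Prod>j<length ds. (\<Prod>i\<in>block ds j. fact (\<alpha> i)) powr (ss ! j))"

definition GS_norm ::
    "nat list \<Rightarrow> real list \<Rightarrow> real list \<Rightarrow> real \<Rightarrow> ((nat \<Rightarrow> real) \<Rightarrow> complex) \<Rightarrow> ereal"
  where "GS_norm ds ss \<sigma>s h f =
    (let d = sum_list ds in
      SUP (\<alpha>, \<beta>) \<in> Nd d \<times> Nd d.
        Linf_norm d (\<lambda>x. complex_of_real (monomial d \<alpha> x) * multi_deriv d \<beta> f x) /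
        ereal (h ^ ((\<Sum>i<d. \<alpha> i) + (\<Sum>i<d. \<beta> i)) * fact_powr ds ss \<alpha> * fact_powr ds \<sigma>s \<beta>))"

definition GS_h ::
    "nat list \<Rightarrow> real list \<Rightarrow> real list \<Rightarrow> real \<Rightarrow> ((nat \<Rightarrow> real) \<Rightarrow> complex) set"
  where "GS_h ds ss \<sigma>s h = {f \<in> Cinf (sum_list ds). GS_norm ds ss \<sigma>s h f < \<infinity>}"

definition norm_topology ::
    "('a \<Rightarrow> complex) set \<Rightarrow> (('a \<Rightarrow> complex) \<Rightarrow> ereal) \<Rightarrow> ('a \<Rightarrow> complex) topology"
  where "norm_topology V N = topology (\<lambda>U. U \<subseteq> V \<and>
    (\<forall>f\<in>U. \<exists>\<epsilon>>0. \<forall>g\<in>V. N (\<lambda>x. g x - f x) < ereal \<epsilon> \<longrightarrow> g \<in> U))"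

lemma openin_norm_topology:
  "openin (norm_topology V N) U \<longleftrightarrow> U \<subseteq> V \<and>
    (\<forall>f\<in>U. \<exists>\<epsilon>>0. \<forall>g\<in>V. N (\<lambda>x. g x - f x) < ereal \<epsilon> \<longrightarrow> g \<in> U)"
proof -
  let ?P = "\<lambda>U. U \<subseteq> V \<and>
    (\<forall>f\<in>U. \<exists>\<epsilon>>0. \<forall>g\<in>V. N (\<lambda>x. g x - f x) < ereal \<epsilon> \<longrightarrow> g \<in> U)"
  have "istopology ?P"
    unfolding istopology_def
  proof (intro conjI allI impI)
    fix S T assume S: "?P S" and T: "?P T"
    show "S \<inter> T \<subseteq> V" using S by blast
    show "\<forall>f\<in>S \<inter> T. \<exists>\<epsilon>>0. \<forall>g\<in>V. N (\<lambda>x. g x - f x) < ereal \<epsilon> \<longrightarrow> g \<in> S \<inter> T"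
    proof
      fix f assume f: "f \<in> S \<inter> T"
      obtain a where a: "a > 0" "\<forall>g\<in>V. N (\<lambda>x. g x - f x) < ereal a \<longrightarrow> g \<in> S"
        using S f by blast
      obtain b where b: "b > 0" "\<forall>g\<in>V. N (\<lambda>x. g x - f x) < ereal b \<longrightarrow> g \<in> T"
        using T f by blast
      have "\<forall>g\<in>V. N (\<lambda>x. g x - f x) < ereal (min a b) \<longrightarrow> g \<in> S \<inter> T"
        using a(2) b(2)
        by (metis IntI ereal_less_eq(3) min.cobounded1 min.cobounded2 order_less_le_trans)
      then show "\<exists>\<epsilon>>0. \<forall>g\<in>V. N (\<lambda>x. g x - f x) < ereal \<epsilon> \<longrightarrow> g \<in> S \<inter> T"
        using a(1) b(1) by (intro exI[of _ "min a b"]) auto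
    qed
  next
    fix K assume K: "\<forall>U\<in>K. ?P U"
    then show "\<Union>K \<subseteq> V" by blast
    show "\<forall>f\<in>\<Union>K. \<exists>\<epsilon>>0. \<forall>g\<in>V. N (\<lambda>x. g x - f x) < ereal \<epsilon> \<longrightarrow> g \<in> \<Union>K"
      using K by (meson UnionE UnionI)
  qed
  then show ?thesis
    by (simp add: norm_topology_def)
qed

definition GS_h_top ::
    "nat list \<Rightarrow> real list \<Rightarrow> real list \<Rightarrow> real \<Rightarrow> ((nat \<Rightarrow> real) \<Rightarrow> complex) topology"
  where "GS_h_top ds ss \<sigma>s h = norm_topology (GS_h ds ss \<sigma>s h) (GS_norm ds ss \<sigma>s h)"

definition locally_convex_topology :: "('a \<Rightarrow> complex) topology \<Rightarrow> bool"
  where "locally_convex_topology T \<longleftrightarrow>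
    continuous_map (prod_topology T T) T (\<lambda>(f, g). \<lambda>x. f x + g x) \<and>
    continuous_map (prod_topology euclidean T) T (\<lambda>(c::complex, f). \<lambda>x. c * f x) \<and>
    (\<forall>U. openin T U \<and> (\<lambda>_. 0) \<in> U \<longrightarrow>
      (\<exists>W. openin T W \<and> (\<lambda>_. 0) \<in> W \<and> W \<subseteq> U \<and>
        (\<forall>f\<in>W. \<forall>g\<in>W. \<forall>t\<in>{0..1::real}.
          (\<lambda>x. of_real t * f x + of_real (1 - t) * g x) \<in> W)))"

text \<open>
  The inductive limit is taken in the category of locally convex spaces: the finest locally
  convex topology on the union that makes all inclusions continuous, obtained here as the
  supremum of all such topologies. The projective limit is the coarsest topology on the
  intersection that makes all inclusions continuous.
\<close>

definition inductive_limit_topology ::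
    "'i set \<Rightarrow> ('i \<Rightarrow> ('a \<Rightarrow> complex) topology) \<Rightarrow> ('a \<Rightarrow> complex) topology"
  where "inductive_limit_topology I X = topology_generated_by
    {U. \<exists>T. topspace T = (\<Union>i\<in>I. topspace (X i)) \<and> locally_convex_topology T \<and>
            (\<forall>i\<in>I. continuous_map (X i) T (\<lambda>f. f)) \<and> openin T U}"

definition projective_limit_topology ::
    "'i set \<Rightarrow> ('i \<Rightarrow> ('a \<Rightarrow> complex) topology) \<Rightarrow> ('a \<Rightarrow> complex) topology"
  where "projective_limit_topology I X = topology_generated_by
    {(\<Inter>j\<in>I. topspace (X j)) \<inter> U |i U. i \<in> I \<and> openin (X i) U}"

definition GS_S :: "nat list \<Rightarrow> real list \<Rightarrow> real list \<Rightarrow> ((nat \<Rightarrow> real) \<Rightarrow> complex) set"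
  where "GS_S ds ss \<sigma>s = (\<Union>h\<in>{0<..}. GS_h ds ss \<sigma>s h)"

definition GS_Sigma :: "nat list \<Rightarrow> real list \<Rightarrow> real list \<Rightarrow> ((nat \<Rightarrow> real) \<Rightarrow> complex) set"
  where "GS_Sigma ds ss \<sigma>s = (\<Inter>h\<in>{0<..}. GS_h ds ss \<sigma>s h)"

definition GS_S_top ::
    "nat list \<Rightarrow> real list \<Rightarrow> real list \<Rightarrow> ((nat \<Rightarrow> real) \<Rightarrow> complex) topology"
  where "GS_S_top ds ss \<sigma>s = inductive_limit_topology {0<..} (GS_h_top ds ss \<sigma>s)"

definition GS_Sigma_top ::
    "nat list \<Rightarrow> real list \<Rightarrow> real list \<Rightarrow> ((nat \<Rightarrow> real) \<Rightarrow> complex) topology"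
  where "GS_Sigma_top ds ss \<sigma>s = projective_limit_topology {0<..} (GS_h_top ds ss \<sigma>s)"

text \<open>
  Functionals are extensional on the space, so that equality of functionals is equality on the
  space. The bilinear pairing \<open>\<langle>u, f\<rangle>\<close> is the application \<open>u f\<close>.
\<close>

definition topological_dual ::
    "('a \<Rightarrow> complex) set \<Rightarrow> ('a \<Rightarrow> complex) topology \<Rightarrow> (('a \<Rightarrow> complex) \<Rightarrow> complex) set"
  where "topological_dual V T = {u \<in> V \<rightarrow>\<^sub>E UNIV.
    (\<forall>f\<in>V. \<forall>g\<in>V. u (\<lambda>x. f x + g x) = u f + u g) \<and>
    (\<forall>c. \<forall>f\<in>V. u (\<lambda>x. c * f x) = c * u f) \<and>
    continuous_map T euclidean u}"

definition GS_S_dual ::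
    "nat list \<Rightarrow> real list \<Rightarrow> real list \<Rightarrow> (((nat \<Rightarrow> real) \<Rightarrow> complex) \<Rightarrow> complex) set"
  where "GS_S_dual ds ss \<sigma>s = topological_dual (GS_S ds ss \<sigma>s) (GS_S_top ds ss \<sigma>s)"

definition GS_Sigma_dual ::
    "nat list \<Rightarrow> real list \<Rightarrow> real list \<Rightarrow> (((nat \<Rightarrow> real) \<Rightarrow> complex) \<Rightarrow> complex) set"
  where "GS_Sigma_dual ds ss \<sigma>s =
    topological_dual (GS_Sigma ds ss \<sigma>s) (GS_Sigma_top ds ss \<sigma>s)"


section \<open>The splitting of \<open>\<real>\<^sup>d\<close>, \<open>d = d1 + d2\<close>\<close>

definition pair_pt :: "nat \<Rightarrow> nat \<Rightarrow> (nat \<Rightarrow> real) \<Rightarrow> (nat \<Rightarrow> real) \<Rightarrow> nat \<Rightarrow> real"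
  where "pair_pt d1 d2 x1 x2 = (\<lambda>i\<in>{..<d1 + d2}. if i < d1 then x1 i else x2 (i - d1))"

definition fst_pt :: "nat \<Rightarrow> nat \<Rightarrow> (nat \<Rightarrow> real) \<Rightarrow> nat \<Rightarrow> real"
  where "fst_pt d1 d2 x = (\<lambda>i\<in>{..<d1}. x i)"

definition snd_pt :: "nat \<Rightarrow> nat \<Rightarrow> (nat \<Rightarrow> real) \<Rightarrow> nat \<Rightarrow> real"
  where "snd_pt d1 d2 x = (\<lambda>i\<in>{..<d2}. x (d1 + i))"

definition tensor ::
    "nat \<Rightarrow> nat \<Rightarrow> ((nat \<Rightarrow> real) \<Rightarrow> complex) \<Rightarrow> ((nat \<Rightarrow> real) \<Rightarrow> complex) \<Rightarrow> (nat \<Rightarrow> real) \<Rightarrow> complex"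
  where "tensor d1 d2 \<phi>1 \<phi>2 =
    on_Rd (d1 + d2) (\<lambda>x. \<phi>1 (fst_pt d1 d2 x) * \<phi>2 (snd_pt d1 d2 x))"

text \<open>The functions \<open>\<phi>(x\<^sub>1, \<cdot>)\<close> and \<open>\<phi>(\<cdot>, x\<^sub>2)\<close>.\<close>

definition slice_snd ::
    "nat \<Rightarrow> nat \<Rightarrow> ((nat \<Rightarrow> real) \<Rightarrow> complex) \<Rightarrow> (nat \<Rightarrow> real) \<Rightarrow> (nat \<Rightarrow> real) \<Rightarrow> complex"
  where "slice_snd d1 d2 \<phi> x1 = on_Rd d2 (\<lambda>x2. \<phi> (pair_pt d1 d2 x1 x2))"

definition slice_fst ::
    "nat \<Rightarrow> nat \<Rightarrow> ((nat \<Rightarrow> real) \<Rightarrow> complex) \<Rightarrow> (nat \<Rightarrow> real) \<Rightarrow> (nat \<Rightarrow> real) \<Rightarrow> complex"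
  where "slice_fst d1 d2 \<phi> x2 = on_Rd d1 (\<lambda>x1. \<phi> (pair_pt d1 d2 x1 x2))"

end

theory Submission
  imports Defs
begin

text \<open>
  Existence rests on an estimate without loss. The weights in the Gelfand-Shilov norms are products over
  the coordinates. Hence, for a functional of norm \<open>K\<close> with respect to the norm with parameter \<open>h\<close>, applying
  it in one group of variables to \<open>\<phi>\<close> gives a function of the other variables whose norm, with the same
  \<open>h\<close>, is at most \<open>K\<close> times that of \<open>\<phi>\<close>. So \<open>\<psi>\<^sub>1\<close> and \<open>\<psi>\<^sub>2\<close> lie in the right spaces, and
  \<open>\<phi> \<mapsto> \<langle>f\<^sub>1, \<psi>\<^sub>1\<rangle>\<close> and \<open>\<phi> \<mapsto> \<langle>f\<^sub>2, \<psi>\<^sub>2\<rangle>\<close> are continuous functionals (lemma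
  \<open>GS_functional_iterated\<close>). Both take the required values on tensors \<open>\<phi>\<^sub>1 \<otimes> \<phi>\<^sub>2\<close>.

  That they coincide, and that they are the only such functional, both follow from one density statement: a
  continuous functional that vanishes on all tensors is zero (lemma
  \<open>functional_zero_if_zero_on_tensors\<close>). Density is proved by mollification, one coordinate of the first block
  at a time. In coordinate \<open>i\<close>, convolve \<open>\<phi>\<close> with a kernel \<open>g\<close> scaled by \<open>\<delta>\<close>. Read as an average of
  translates of \<open>\<phi>\<close> weighted by the kernel, this is close to a multiple of \<open>\<phi>\<close>; read as an average of
  translated kernels weighted by values of \<open>\<phi>\<close>, it is a superposition of functions in which the coordinate
  \<open>x\<^sub>i\<close> of \<open>\<phi>\<close> is frozen and a factor depending on \<open>x\<^sub>i\<close> alone is split off. After the last coordinate of the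
  first block, all functions are tensors. Two points make this work for all positive exponents. The kernel
  is \<open>\<bar>\<phi>\<bar>\<^sup>2\<close> restricted to a line on which \<open>\<phi>\<close> is not zero; it is nonnegative, not zero, and of
  the right class by the Leibniz formula. So a nontrivial space supplies its own mollifier, and for a trivial
  one there is nothing to show. Moreover, convergence need only be checked uniformly: on a ball of the
  norm with parameter \<open>h\<close>, uniform smallness implies smallness in the norm with parameter \<open>2 * h\<close> (lemma
  \<open>small_sup_small_norm\<close>). Since boundedness holds for finite Riemann sums as well, the convolutions are
  replaced throughout by such sums, for which differentiation is immediate, and the change of variables
  between the two readings becomes a comparison of two grids (lemma \<open>reflected_grid_sums_close\<close>).

  Every estimate changes \<open>h\<close> by a factor that does not depend on \<open>h\<close>. This permits one proof
  for the union and for the intersection over \<open>h\<close>: given a factor \<open>\<kappa>\<close>, there is always an \<open>h\<close> such that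
  \<open>\<phi>\<close> is bounded at \<open>h\<close> and the functional at \<open>\<kappa> * h\<close> (lemma \<open>common_parameter\<close>).
\<close>

section \<open>Smooth functions and their families of partial derivatives\<close>

lemma vector_mean_value_bound:
  fixes f :: "real \<Rightarrow> complex"
  assumes "convex S"
    and der: "\<And>t. t \<in> S \<Longrightarrow> (f has_vector_derivative f' t) (at t)"
    and bd: "\<And>t. t \<in> S \<Longrightarrow> norm (f' t - c) \<le> B"
    and "x \<in> S" "y \<in> S"
  shows "norm (f y - f x - (y - x) *\<^sub>R c) \<le> B * \<bar>y - x\<bar>"
proof -
  have "norm ((f y - y *\<^sub>R c) - (f x - x *\<^sub>R c)) \<le> B * norm (y - x)"
  proof (rule differentiable_bound[OF \<open>convex S\<close> _ _ \<open>y \<in> S\<close> \<open>x \<in> S\<close>])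
    fix t assume t: "t \<in> S"
    have "((\<lambda>t. f t - t *\<^sub>R c) has_vector_derivative (f' t - 1 *\<^sub>R c)) (at t)"
      using has_vector_derivative_scaleR[OF DERIV_ident has_vector_derivative_const[of c], of t]
      by (intro has_vector_derivative_diff der t) simp
    then show "((\<lambda>t. f t - t *\<^sub>R c) has_derivative (\<lambda>h. h *\<^sub>R (f' t - c))) (at t within S)"
      by (simp add: has_vector_derivative_def has_derivative_at_withinI)
    show "onorm (\<lambda>h. h *\<^sub>R (f' t - c)) \<le> B"
    proof (rule onorm_le)
      fix h :: real
      show "norm (h *\<^sub>R (f' t - c)) \<le> B * norm h"
        using mult_left_mono[OF bd[OF t], of "norm h"] by (simp add: mult.commute)
    qed
  qed
  then show ?thesis by (simp add: algebra_simps)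
qed

text \<open>
  The mean value estimate, applied first in \<open>t\<close> to the derivative in \<open>s\<close> and then in \<open>s\<close> to the
  increment in \<open>t\<close>, compares the second difference with a single value of the mixed derivative.
\<close>

lemma mixed_difference_bound:
  fixes F :: "real \<Rightarrow> real \<Rightarrow> complex"
  assumes ds: "\<And>s t. ((\<lambda>s. F s t) has_vector_derivative Fs s t) (at s)"
    and dt: "\<And>s t. ((\<lambda>t. Fs s t) has_vector_derivative G s t) (at t)"
    and "h > 0"
    and bd: "\<And>s t. s \<in> {a..a+h} \<Longrightarrow> t \<in> {b..b+h} \<Longrightarrow> norm (G s t - c) \<le> e"
  shows "norm (F (a+h) (b+h) - F (a+h) b - F a (b+h) + F a b - (h*h) *\<^sub>R c) \<le> h*h*e"
proof -
  have inner: "norm ((Fs s (b+h) - Fs s b) - h *\<^sub>R c) \<le> e * h" if "s \<in> {a..a+h}" for s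
    using vector_mean_value_bound[of "{b..b+h}" "Fs s" "G s" c e b "b+h"] dt bd[OF that] \<open>h > 0\<close>
    by (simp add: algebra_simps)
  have "norm ((F (a+h) (b+h) - F (a+h) b) - (F a (b+h) - F a b) - (a + h - a) *\<^sub>R (h *\<^sub>R c))
      \<le> (e * h) * \<bar>a + h - a\<bar>"
    by (rule vector_mean_value_bound[of "{a..a+h}" "\<lambda>s. F s (b+h) - F s b"
          "\<lambda>s. Fs s (b+h) - Fs s b"])
       (use \<open>h > 0\<close> inner in \<open>auto intro!: derivative_intros ds\<close>)
  then show ?thesis using \<open>h > 0\<close> by (simp add: algebra_simps)
qed

text \<open>
  Both mixed derivatives at \<open>(a, b)\<close> are limits of the same second difference quotient.
\<close>

lemma mixed_derivatives_commute:
  fixes F :: "real \<Rightarrow> real \<Rightarrow> complex"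
  assumes ds: "\<And>s t. ((\<lambda>s. F s t) has_vector_derivative Fs s t) (at s)"
    and dst: "\<And>s t. ((\<lambda>t. Fs s t) has_vector_derivative G s t) (at t)"
    and dt: "\<And>s t. ((\<lambda>t. F s t) has_vector_derivative Ft s t) (at t)"
    and dts: "\<And>s t. ((\<lambda>s. Ft s t) has_vector_derivative H s t) (at s)"
    and cG: "continuous_on UNIV (\<lambda>(s, t). G s t)"
    and cH: "continuous_on UNIV (\<lambda>(s, t). H s t)"
  shows "G a b = H a b"
proof -
  have "norm (G a b - H a b) \<le> e" if "e > 0" for e
  proof -
    have near: "\<exists>r>0. \<forall>s\<in>{a..a+r}. \<forall>t\<in>{b..b+r}. norm (K s t - K a b) \<le> e/2"
      if "continuous_on UNIV (\<lambda>(s, t). K s t)" for K :: "real \<Rightarrow> real \<Rightarrow> complex"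
    proof -
      note cont = that
      obtain r where r: "r > 0" "\<And>p. dist p (a, b) < r \<Longrightarrow> dist (case p of (s, t) \<Rightarrow> K s t) (K a b) < e/2"
        using cont[unfolded continuous_on_iff, rule_format, OF UNIV_I, of "e/2" "(a, b)"] \<open>e > 0\<close>
        by auto
      have "norm (K s t - K a b) \<le> e/2" if "s \<in> {a..a+r/4}" "t \<in> {b..b+r/4}" for s t
      proof -
        have "dist (s, t) (a, b) \<le> \<bar>s - a\<bar> + \<bar>t - b\<bar>"
          by (simp add: dist_Pair_Pair dist_real_def sqrt_sum_squares_le_sum_abs)
        also have "\<dots> < r" using that r(1) by auto
        finally show ?thesis using r(2)[of "(s, t)"] by (simp add: dist_norm)
      qed
      then show ?thesis using r(1) by (intro exI[of _ "r/4"]) auto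
    qed
    obtain r1 r2 where r: "r1 > 0" "\<forall>s\<in>{a..a+r1}. \<forall>t\<in>{b..b+r1}. norm (G s t - G a b) \<le> e/2"
      "r2 > 0" "\<forall>s\<in>{a..a+r2}. \<forall>t\<in>{b..b+r2}. norm (H s t - H a b) \<le> e/2"
      using near[OF cG] near[OF cH] by blast
    define h where "h = min r1 r2"
    have "h > 0" using r by (simp add: h_def)
    let ?D = "F (a+h) (b+h) - F (a+h) b - F a (b+h) + F a b"
    have 1: "norm (?D - (h*h) *\<^sub>R G a b) \<le> h*h*(e/2)"
      by (rule mixed_difference_bound[OF ds dst \<open>h > 0\<close>]) (use r(2) in \<open>auto simp: h_def\<close>)
    have 2: "norm (F (a+h) (b+h) - F a (b+h) - F (a+h) b + F a b - (h*h) *\<^sub>R H a b) \<le> h*h*(e/2)"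
      by (rule mixed_difference_bound[where F="\<lambda>t s. F s t" and G="\<lambda>t s. H s t", OF dt dts \<open>h > 0\<close>])
         (use r(4) in \<open>auto simp: h_def\<close>)
    have swap: "F (a+h) (b+h) - F a (b+h) - F (a+h) b + F a b = ?D" by simp
    have 3: "norm (?D - (h*h) *\<^sub>R H a b) \<le> h*h*(e/2)"
      using 2 by (simp only: swap)
    have split: "(h*h) *\<^sub>R (G a b - H a b) = (?D - (h*h) *\<^sub>R H a b) - (?D - (h*h) *\<^sub>R G a b)"
      by (simp add: algebra_simps)
    have "(h*h) * norm (G a b - H a b) = norm ((h*h) *\<^sub>R (G a b - H a b))"
      by simp
    also have "\<dots> = norm ((?D - (h*h) *\<^sub>R H a b) - (?D - (h*h) *\<^sub>R G a b))"
      by (simp only: split)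
    also have "\<dots> \<le> h*h*(e/2) + h*h*(e/2)"
      using 1 3 norm_triangle_ineq4[of "?D - (h*h) *\<^sub>R H a b" "?D - (h*h) *\<^sub>R G a b"]
      by linarith
    finally have "(h*h) * norm (G a b - H a b) \<le> (h*h) * e" by (simp add: mult.commute)
    then show ?thesis using \<open>h > 0\<close> by simp
  qed
  then have "norm (G a b - H a b) \<le> 0"
    using field_le_epsilon[of "norm (G a b - H a b)" 0] by (simp only: add_0)
  then show ?thesis by simp
qed

lemma Rd_upd [simp]: "i < d \<Longrightarrow> x(i := t) \<in> Rd d \<longleftrightarrow> x \<in> Rd d"
  by (auto simp: Rd_def PiE_iff extensional_def)

text \<open>
  A family \<open>D\<close> in which \<open>D (\<beta> + e\<^sub>i)\<close> is the partial derivative of \<open>D \<beta>\<close> in direction \<open>i\<close>. Giving all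
  derivatives at once turns smoothness and the computation of iterated derivatives of translates,
  slices, products and the like into one first-order verification.
\<close>

definition smooth_family ::
    "nat \<Rightarrow> ((nat \<Rightarrow> nat) \<Rightarrow> (nat \<Rightarrow> real) \<Rightarrow> complex) \<Rightarrow> bool"
  where "smooth_family d D \<longleftrightarrow>
    (\<forall>\<beta> i x. i < d \<longrightarrow> x \<in> Rd d \<longrightarrow>
      ((\<lambda>t. D \<beta> (x(i := t))) has_vector_derivative D (\<beta>(i := Suc (\<beta> i))) x) (at (x i))) \<and>
    (\<forall>\<beta> x. x \<notin> Rd d \<longrightarrow> D \<beta> x = 0)"

lemma smooth_familyD:
  assumes "smooth_family d D" "i < d" "x \<in> Rd d"
  shows "((\<lambda>t. D \<beta> (x(i := t))) has_vector_derivative D (\<beta>(i := Suc (\<beta> i))) (x(i := t))) (at t)"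
  using assms Rd_upd[OF assms(2), of x t] unfolding smooth_family_def
  by (metis (no_types, lifting) ext fun_upd_same fun_upd_upd)

lemma smooth_family_off: "smooth_family d D \<Longrightarrow> x \<notin> Rd d \<Longrightarrow> D \<beta> x = 0"
  by (simp add: smooth_family_def)

lemma smooth_family_increment:
  assumes D: "smooth_family d D" and "i < d" "x \<in> Rd d"
    and bd: "\<And>x. x \<in> Rd d \<Longrightarrow> cmod (D (\<beta>(i := Suc (\<beta> i))) x) \<le> B"
  shows "cmod (D \<beta> (x(i := t)) - D \<beta> (x(i := s))) \<le> B * \<bar>t - s\<bar>"
  using vector_mean_value_bound[of UNIV "\<lambda>t. D \<beta> (x(i := t))"
      "\<lambda>t. D (\<beta>(i := Suc (\<beta> i))) (x(i := t))" 0 B s t] assms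
  by (simp add: smooth_familyD)

definition bounded_family :: "nat \<Rightarrow> ((nat \<Rightarrow> nat) \<Rightarrow> (nat \<Rightarrow> real) \<Rightarrow> complex) \<Rightarrow> bool"
  where "bounded_family d D \<longleftrightarrow> (\<forall>\<beta>. \<exists>B. \<forall>x\<in>Rd d. cmod (D \<beta> x) \<le> B)"

text \<open>Changing one coordinate at a time, bounds on the first derivatives give a Lipschitz estimate.\<close>

lemma smooth_family_lipschitz:
  assumes D: "smooth_family d D"
    and bd: "\<And>i x. i < d \<Longrightarrow> x \<in> Rd d \<Longrightarrow> cmod (D (\<beta>(i := Suc (\<beta> i))) x) \<le> B"
    and x: "x \<in> Rd d" and y: "y \<in> Rd d"
  shows "cmod (D \<beta> x - D \<beta> y) \<le> B * (\<Sum>i<d. \<bar>x i - y i\<bar>)"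
proof -
  define z where "z k = (\<lambda>i. if i < k then x i else y i)" for k :: nat
  have "cmod (D \<beta> (z k) - D \<beta> y) \<le> B * (\<Sum>i<k. \<bar>x i - y i\<bar>)" if "k \<le> d" for k
    using that
  proof (induction k)
    case 0
    have "z 0 = y" by (simp add: z_def)
    then show ?case by simp
  next
    case (Suc k)
    have zk: "z k \<in> Rd d" using x y Suc.prems by (auto simp: z_def Rd_def PiE_iff extensional_def)
    have "z (Suc k) = (z k)(k := x k)" "z k = (z k)(k := y k)"
      by (auto simp: z_def less_Suc_eq)
    then have "cmod (D \<beta> (z (Suc k)) - D \<beta> (z k)) \<le> B * \<bar>x k - y k\<bar>"
      using smooth_family_increment[OF D _ zk, of k \<beta> B "x k" "y k"] bd Suc.prems by auto
    moreover have "cmod (D \<beta> (z (Suc k)) - D \<beta> y)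
        \<le> cmod (D \<beta> (z (Suc k)) - D \<beta> (z k)) + cmod (D \<beta> (z k) - D \<beta> y)"
      by (metis dist_norm dist_triangle)
    ultimately show ?case using Suc by (simp add: algebra_simps)
  qed
  from this[of d] have "cmod (D \<beta> (z d) - D \<beta> y) \<le> B * (\<Sum>i<d. \<bar>x i - y i\<bar>)" by simp
  moreover have "z d = x" using x y by (fastforce simp: z_def Rd_def PiE_iff extensional_def)
  ultimately show ?thesis by simp
qed

lemma smooth_family_continuous:
  assumes D: "smooth_family d D" and bd: "bounded_family d D"
  shows "continuous_on (Rd d) (D \<beta>)"
proof -
  have "\<forall>i. \<exists>B. \<forall>x\<in>Rd d. cmod (D (\<beta>(i := Suc (\<beta> i))) x) \<le> B"
    using bd by (simp add: bounded_family_def)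
  then obtain B where B: "\<And>i x. x \<in> Rd d \<Longrightarrow> cmod (D (\<beta>(i := Suc (\<beta> i))) x) \<le> B i"
    by metis
  define M where "M = (\<Sum>i<d. \<bar>B i\<bar>)"
  have M: "cmod (D (\<beta>(i := Suc (\<beta> i))) x) \<le> M" if "i < d" "x \<in> Rd d" for i x
  proof -
    have "B i \<le> \<bar>B i\<bar>" by simp
    also have "\<dots> \<le> M" unfolding M_def by (rule member_le_sum) (use that in auto)
    finally show ?thesis using B[OF that(2), of i] by simp
  qed
  show ?thesis
    unfolding continuous_on_def
  proof
    fix y assume y: "y \<in> Rd d"
    have coord: "((\<lambda>x. \<bar>x i - y i\<bar>) \<longlongrightarrow> 0) (at y within Rd d)" for i
    proof -
      have "continuous_on UNIV (\<lambda>x::nat \<Rightarrow> real. \<bar>x i - y i\<bar>)"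
        by (intro continuous_intros continuous_on_product_coordinates)
      then have "((\<lambda>x. \<bar>x i - y i\<bar>) \<longlongrightarrow> \<bar>y i - y i\<bar>) (at y)"
        unfolding continuous_on_def by blast
      then have "((\<lambda>x. \<bar>x i - y i\<bar>) \<longlongrightarrow> \<bar>y i - y i\<bar>) (at y within Rd d)"
        by (rule tendsto_within_subset) simp
      then show ?thesis by simp
    qed
    have "((\<lambda>x. M * (\<Sum>i<d. \<bar>x i - y i\<bar>)) \<longlongrightarrow> M * (\<Sum>i<d. 0)) (at y within Rd d)"
      by (intro tendsto_intros coord)
    then have lim: "((\<lambda>x. M * (\<Sum>i<d. \<bar>x i - y i\<bar>)) \<longlongrightarrow> 0) (at y within Rd d)"
      by simp
    have "((\<lambda>x. D \<beta> x - D \<beta> y) \<longlongrightarrow> 0) (at y within Rd d)"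
      by (rule Lim_null_comparison[OF _ lim])
         (auto simp: eventually_at_filter intro!: always_eventually smooth_family_lipschitz[OF D M _ y])
    then show "(D \<beta> \<longlongrightarrow> D \<beta> y) (at y within Rd d)"
      by (simp add: LIM_zero_iff)
  qed
qed

text \<open>
  Families may depend on entries of a multi-index beyond the dimension, \<open>multi_deriv\<close> does not.
\<close>

definition zero_beyond :: "nat \<Rightarrow> (nat \<Rightarrow> nat) \<Rightarrow> nat \<Rightarrow> nat"
  where "zero_beyond d \<beta> = (\<lambda>i. if i < d then \<beta> i else 0)"

lemma smooth_family_partial:
  assumes D: "smooth_family d D" and "i < d"
  shows "partial_deriv i (D \<beta>) = D (\<beta>(i := Suc (\<beta> i)))"
proof
  fix x
  show "partial_deriv i (D \<beta>) x = D (\<beta>(i := Suc (\<beta> i))) x"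
  proof (cases "x \<in> Rd d")
    case True
    then show ?thesis
      using smooth_familyD[OF D \<open>i < d\<close> True, of \<beta> "x i"]
      by (simp add: partial_deriv_def vector_derivative_at)
  next
    case False
    then have "(\<lambda>t. D \<beta> (x(i := t))) = (\<lambda>t. 0)"
      using \<open>i < d\<close> smooth_family_off[OF D] by auto
    then show ?thesis using False by (simp add: partial_deriv_def smooth_family_off[OF D])
  qed
qed

lemma smooth_family_multi_deriv:
  assumes D: "smooth_family d D"
  shows "multi_deriv d \<beta> (D (\<lambda>_. 0)) = D (zero_beyond d \<beta>)"
proof -
  have pow: "(partial_deriv i ^^ m) (D \<gamma>) = D (\<gamma>(i := \<gamma> i + m))" if "i < d" for i m \<gamma>
  proof (induction m)
    case (Suc m)
    have "(\<gamma>(i := \<gamma> i + m))(i := Suc ((\<gamma>(i := \<gamma> i + m)) i)) = \<gamma>(i := \<gamma> i + Suc m)"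
      by auto
    then show ?case
      using Suc smooth_family_partial[OF D that, of "\<gamma>(i := \<gamma> i + m)"] by (simp del: fun_upd_apply)
  qed simp
  have "foldr (\<lambda>i g. (partial_deriv i ^^ \<beta> i) g) js (D (\<lambda>_. 0))
      = D (\<lambda>i. if i \<in> set js then \<beta> i else 0)" if "distinct js" "set js \<subseteq> {..<d}" for js
    using that
  proof (induction js)
    case (Cons j js)
    have "(\<lambda>i. if i \<in> set js then \<beta> i else 0)(j := 0 + \<beta> j)
        = (\<lambda>i. if i \<in> set (j # js) then \<beta> i else 0)"
      by auto
    then show ?case using Cons pow[of j "\<beta> j" "\<lambda>i. if i \<in> set js then \<beta> i else 0"] by auto
  qed simp
  from this[of "[0..<d]"] show ?thesis
    by (simp add: multi_deriv_def zero_beyond_def atLeast0LessThan)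
qed

lemma smooth_family_Cinf:
  assumes D: "smooth_family d D" and bd: "bounded_family d D"
  shows "D \<beta> \<in> Cinf d"
proof -
  have "Ck d k (D \<beta>)" for k
  proof (induction k arbitrary: \<beta>)
    case 0
    show ?case by (simp add: smooth_family_continuous[OF D bd])
  next
    case (Suc k)
    have "(\<lambda>t. D \<beta> (x(i := t))) differentiable at (x i)" if "i < d" "x \<in> Rd d" for i x
      using smooth_familyD[OF D that] by (rule differentiableI_vector)
    with Suc show ?case
      by (auto simp: smooth_family_continuous[OF D bd] smooth_family_partial[OF D])
  qed
  then show ?thesis by (simp add: Cinf_def smooth_family_off[OF D])
qed

lemma Cinf_has_partial:
  assumes "f \<in> Cinf d" "i < d" "x \<in> Rd d"
  shows "((\<lambda>t. f (x(i := t))) has_vector_derivative partial_deriv i f (x(i := t))) (at t)"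
proof -
  have "x(i := t) \<in> Rd d" using assms by simp
  moreover have "Ck d (Suc 0) f" using assms unfolding Cinf_def by blast
  ultimately have "(\<lambda>s. f ((x(i := t))(i := s))) differentiable at ((x(i := t)) i)"
    using \<open>i < d\<close> by (metis Ck.simps(2))
  then show ?thesis
    unfolding partial_deriv_def by (simp add: vector_derivative_works)
qed

lemma Cinf_partial_deriv:
  assumes "f \<in> Cinf d" "i < d"
  shows "partial_deriv i f \<in> Cinf d"
proof -
  have "Ck d k (partial_deriv i f)" for k
    using assms by (metis (mono_tags, lifting) Cinf_def Ck.simps(2) mem_Collect_eq)
  moreover have "partial_deriv i f x = 0" if "x \<notin> Rd d" for x
  proof -
    have "(\<lambda>t. f (x(i := t))) = (\<lambda>t. 0)" using assms that by (auto simp: Cinf_def)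
    then show ?thesis by (simp add: partial_deriv_def)
  qed
  ultimately show ?thesis by (simp add: Cinf_def)
qed

lemma Cinf_continuous: "f \<in> Cinf d \<Longrightarrow> continuous_on (Rd d) f"
  unfolding Cinf_def by (metis (no_types, lifting) Ck.simps(1) mem_Collect_eq)

lemma Cinf_continuous_two_coordinates:
  assumes f: "f \<in> Cinf d" and "i < d" "j < d" and x: "x \<in> Rd d"
  shows "continuous_on UNIV (\<lambda>(s, t). f (x(i := s, j := t)))"
proof -
  have "continuous_on UNIV (\<lambda>p::real \<times> real. x(i := fst p, j := snd p))"
  proof (rule continuous_on_coordinatewise_then_product)
    fix k show "continuous_on UNIV (\<lambda>p::real \<times> real. (x(i := fst p, j := snd p)) k)"
      by (cases "k = j"; cases "k = i") (auto intro!: continuous_intros)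
  qed
  then have "continuous_on UNIV (\<lambda>p::real \<times> real. f (x(i := fst p, j := snd p)))"
    by (rule continuous_on_compose2[OF Cinf_continuous[OF f]]) (use assms in auto)
  then show ?thesis by (simp add: case_prod_unfold)
qed

lemma partial_deriv_commute:
  assumes f: "f \<in> Cinf d" and i: "i < d" and j: "j < d"
  shows "partial_deriv i (partial_deriv j f) = partial_deriv j (partial_deriv i f)"
proof (cases "i = j")
  case False
  have fi: "partial_deriv i f \<in> Cinf d" and fj: "partial_deriv j f \<in> Cinf d"
    using Cinf_partial_deriv f i j by auto
  have fij: "partial_deriv i (partial_deriv j f) \<in> Cinf d"
    and fji: "partial_deriv j (partial_deriv i f) \<in> Cinf d"
    using Cinf_partial_deriv fi fj i j by auto
  show ?thesis
  proof
    fix x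
    show "partial_deriv i (partial_deriv j f) x = partial_deriv j (partial_deriv i f) x"
    proof (cases "x \<in> Rd d")
      case True
      have di: "((\<lambda>s. g (x(i := s, j := t))) has_vector_derivative
           partial_deriv i g (x(i := s, j := t))) (at s)" if "g \<in> Cinf d" for g s t
        using Cinf_has_partial[OF that i, of "x(j := t)" s] True j False
        by (simp add: fun_upd_twist)
      have dj: "((\<lambda>t. g (x(i := s, j := t))) has_vector_derivative
           partial_deriv j g (x(i := s, j := t))) (at t)" if "g \<in> Cinf d" for g s t
        using Cinf_has_partial[OF that j, of "x(i := s)" t] True i by simp
      have "partial_deriv j (partial_deriv i f) (x(i := x i, j := x j))
          = partial_deriv i (partial_deriv j f) (x(i := x i, j := x j))"
        by (rule mixed_derivatives_commute[OF di[OF f] dj[OF fi] dj[OF f] di[OF fj]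
             Cinf_continuous_two_coordinates[OF fji i j True]
             Cinf_continuous_two_coordinates[OF fij i j True]])
      then show ?thesis by simp
    next
      case False
      then show ?thesis using fij fji by (simp add: Cinf_def)
    qed
  qed
qed simp

lemma Cinf_partial_funpow: "f \<in> Cinf d \<Longrightarrow> i < d \<Longrightarrow> (partial_deriv i ^^ m) f \<in> Cinf d"
  by (induction m) (auto intro: Cinf_partial_deriv)

lemma Cinf_foldr_partial:
  "f \<in> Cinf d \<Longrightarrow> set js \<subseteq> {..<d} \<Longrightarrow> foldr (\<lambda>i g. (partial_deriv i ^^ \<beta> i) g) js f \<in> Cinf d"
  by (induction js) (auto intro: Cinf_partial_funpow)

lemma multi_deriv_Cinf: "f \<in> Cinf d \<Longrightarrow> multi_deriv d \<beta> f \<in> Cinf d"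
  unfolding multi_deriv_def by (rule Cinf_foldr_partial) auto

lemma partial_deriv_funpow_commute:
  assumes "f \<in> Cinf d" "i < d" "j < d"
  shows "partial_deriv i ((partial_deriv j ^^ m) f) = (partial_deriv j ^^ m) (partial_deriv i f)"
  using assms
  by (induction m)
     (auto simp: partial_deriv_commute[OF Cinf_partial_funpow[OF assms(1) assms(3)] assms(2) assms(3)])

lemma partial_deriv_multi_deriv:
  assumes f: "f \<in> Cinf d" and i: "i < d"
  shows "partial_deriv i (multi_deriv d \<beta> f) = multi_deriv d (\<beta>(i := Suc (\<beta> i))) f"
proof -
  have "partial_deriv i (foldr (\<lambda>i g. (partial_deriv i ^^ \<beta> i) g) js f)
      = foldr (\<lambda>j g. (partial_deriv j ^^ (\<beta>(i := Suc (\<beta> i))) j) g) js f"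
    if "distinct js" "set js \<subseteq> {..<d}" "i \<in> set js" for js
    using that
  proof (induction js)
    case (Cons j js)
    let ?g = "foldr (\<lambda>i g. (partial_deriv i ^^ \<beta> i) g) js f"
    show ?case
    proof (cases "j = i")
      case True
      then have "foldr (\<lambda>j g. (partial_deriv j ^^ (\<beta>(i := Suc (\<beta> i))) j) g) js f = ?g"
        using Cons.prems by (intro foldr_cong) auto
      then show ?thesis using True by simp
    next
      case False
      have "?g \<in> Cinf d" using Cons.prems f by (intro Cinf_foldr_partial) auto
      then show ?thesis
        using False Cons i by (auto simp: partial_deriv_funpow_commute)
    qed
  qed simp
  from this[of "[0..<d]"] show ?thesis
    using i by (simp add: multi_deriv_def atLeast0LessThan)
qed

text \<open>
  This converse is where mixed partial derivatives must commute, since \<open>multi_deriv\<close> differentiates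
  in a fixed order of the coordinates.
\<close>

lemma Cinf_smooth_family:
  assumes f: "f \<in> Cinf d"
  shows "smooth_family d (\<lambda>\<beta>. multi_deriv d \<beta> f)"
  unfolding smooth_family_def
proof (intro conjI allI impI)
  fix \<beta> i x assume "i < d" "x \<in> Rd d"
  then show "((\<lambda>t. multi_deriv d \<beta> f (x(i := t))) has_vector_derivative
      multi_deriv d (\<beta>(i := Suc (\<beta> i))) f x) (at (x i))"
    using Cinf_has_partial[OF multi_deriv_Cinf[OF f], of i x \<beta> "x i"]
    by (simp add: partial_deriv_multi_deriv[OF f])
next
  fix \<beta> x assume "x \<notin> Rd d"
  then show "multi_deriv d \<beta> f x = 0"
    using multi_deriv_Cinf[OF f] by (simp add: Cinf_def)
qed

lemma multi_deriv_0 [simp]: "multi_deriv d (\<lambda>_. 0) f = f"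
proof -
  have "foldr (\<lambda>i g. (partial_deriv i ^^ 0) g) js f = f" for js
    by (induction js) auto
  then show ?thesis by (simp add: multi_deriv_def)
qed

section \<open>Gevrey weights\<close>

text \<open>
  One coordinate's share of the denominators in the Gelfand-Shilov norms.
\<close>

definition gevrey :: "real \<Rightarrow> real \<Rightarrow> nat \<Rightarrow> real"
  where "gevrey s h a = h ^ a * fact a powr s"

lemma gevrey_pos [simp]: "h > 0 \<Longrightarrow> gevrey s h a > 0"
  by (simp add: gevrey_def)

lemma gevrey_nonneg [simp]: "h \<ge> 0 \<Longrightarrow> gevrey s h a \<ge> 0"
  by (simp add: gevrey_def)

lemma gevrey_0 [simp]: "gevrey s h 0 = 1"
  by (simp add: gevrey_def)

lemma gevrey_mono: "0 \<le> h \<Longrightarrow> h \<le> h' \<Longrightarrow> gevrey s h a \<le> gevrey s h' a"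
  by (simp add: gevrey_def mult_right_mono power_mono)

lemma gevrey_scale: "gevrey s (c * h) a = c ^ a * gevrey s h a"
  by (simp add: gevrey_def power_mult_distrib)

lemma fact_powr_mult_le:
  assumes "s \<ge> 0" "k \<le> a"
  shows "(fact k :: real) powr s * fact (a - k) powr s \<le> fact a powr s"
proof -
  have "fact k * fact (a - k) dvd (fact a :: nat)"
    using assms(2) by (rule choose_dvd)
  then have "fact k * fact (a - k) \<le> (fact a :: nat)"
    by (rule dvd_imp_le) simp
  then have "real (fact k * fact (a - k)) \<le> real (fact a)" by (rule of_nat_mono)
  then have "(fact k :: real) * fact (a - k) \<le> fact a" by simp
  then have "((fact k :: real) * fact (a - k)) powr s \<le> fact a powr s"
    using assms(1) by (intro powr_mono2) auto
  then show ?thesis by (simp add: powr_mult)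
qed

text \<open>
  Behind every product and translation estimate: since \<open>fact k * fact (a - k)\<close> is at most \<open>fact a\<close>, the
  factorials do not accumulate and only the geometric bases add up.
\<close>

lemma sum_binomial_gevrey_le:
  assumes "s \<ge> 0" "p \<ge> 0" "q \<ge> 0"
  shows "(\<Sum>k\<le>a. real (a choose k) * (gevrey s p k * gevrey s q (a - k))) \<le> gevrey s (p + q) a"
proof -
  have "(\<Sum>k\<le>a. real (a choose k) * (gevrey s p k * gevrey s q (a - k)))
      \<le> (\<Sum>k\<le>a. real (a choose k) * p ^ k * q ^ (a - k) * fact a powr s)"
  proof (rule sum_mono)
    fix k assume "k \<in> {..a}"
    then have "(fact k :: real) powr s * fact (a - k) powr s \<le> fact a powr s"
      using assms(1) by (intro fact_powr_mult_le) auto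
    then have "(real (a choose k) * p ^ k * q ^ (a - k)) * (fact k powr s * fact (a - k) powr s)
        \<le> (real (a choose k) * p ^ k * q ^ (a - k)) * fact a powr s"
      using assms by (intro mult_left_mono) auto
    then show "real (a choose k) * (gevrey s p k * gevrey s q (a - k))
        \<le> real (a choose k) * p ^ k * q ^ (a - k) * fact a powr s"
      by (simp add: gevrey_def mult_ac)
  qed
  also have "\<dots> = gevrey s (p + q) a"
    by (simp add: gevrey_def binomial_ring sum_distrib_right)
  finally show ?thesis .
qed

text \<open>
  Moment bounds for two factors combine to a moment bound at the sum of the two points. This is how
  translations are absorbed.
\<close>

lemma gevrey_power_add_bound:
  assumes "s \<ge> 0" "p \<ge> 0" "q \<ge> 0" and nonneg: "u \<ge> 0" "v \<ge> 0" "A \<ge> 0" "B \<ge> 0"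
    and A: "\<And>a. u ^ a * A \<le> CA * gevrey s p a"
    and B: "\<And>a. v ^ a * B \<le> CB * gevrey s q a"
  shows "(u + v) ^ a * (A * B) \<le> (CA * CB) * gevrey s (p + q) a"
proof -
  have C: "CA \<ge> 0" "CB \<ge> 0" using A[of 0] B[of 0] nonneg by auto
  have "(u + v) ^ a * (A * B) = (\<Sum>k\<le>a. real (a choose k) * ((u ^ k * A) * (v ^ (a - k) * B)))"
    by (simp add: binomial_ring sum_distrib_left sum_distrib_right mult_ac)
  also have "\<dots> \<le> (\<Sum>k\<le>a. real (a choose k) * ((CA * gevrey s p k) * (CB * gevrey s q (a - k))))"
    by (intro sum_mono mult_left_mono mult_mono A B) (use nonneg C assms in auto)
  also have "\<dots> = (CA * CB) * (\<Sum>k\<le>a. real (a choose k) * (gevrey s p k * gevrey s q (a - k)))"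
    by (simp add: sum_distrib_left mult_ac)
  also have "\<dots> \<le> (CA * CB) * gevrey s (p + q) a"
    by (intro mult_left_mono sum_binomial_gevrey_le) (use C assms in auto)
  finally show ?thesis .
qed

lemma gevrey_Suc_Suc:
  assumes "s \<ge> 0" "h \<ge> 0"
  shows "gevrey s h (a + 2) \<le> (h\<^sup>2 * 2 powr s) * gevrey s (4 powr s * h) a"
proof -
  have a1: "real a + 1 \<le> 2 ^ a" by (induction a) auto
  have "(real a + 1) * (real a + 2) \<le> 2 ^ a * (2 * 2 ^ a)"
    by (intro mult_mono) (use a1 in auto)
  also have "\<dots> = 2 * 4 ^ a" by (simp add: power_mult_distrib[symmetric])
  finally have "(real a + 1) * (real a + 2) * fact a \<le> 2 * 4 ^ a * fact a"
    by (intro mult_right_mono) auto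
  moreover have "fact (a + 2) = (real a + 1) * (real a + 2) * fact a"
    by (simp add: algebra_simps)
  ultimately have "fact (a + 2) powr s \<le> (2 * 4 ^ a * fact a) powr s"
    using assms by (intro powr_mono2) (auto simp del: fact_Suc)
  also have "\<dots> = 2 powr s * (4 powr s) ^ a * fact a powr s"
    by (simp add: powr_mult powr_power powr_realpow[symmetric] powr_powr mult.commute)
  finally have "h ^ (a + 2) * fact (a + 2) powr s \<le> h ^ (a + 2) * (2 powr s * (4 powr s) ^ a * fact a powr s)"
    using assms by (intro mult_left_mono) auto
  then show ?thesis
    by (simp add: gevrey_def power_mult_distrib power_add power2_eq_square mult_ac)
qed

text \<open>
  Two more moments give a summable weight. They multiply \<open>fact a\<close> by at most \<open>2 * 4 ^ a\<close>, so \<open>h\<close> is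
  multiplied by a constant that does not depend on \<open>h\<close>.
\<close>

lemma gevrey_decay:
  assumes "s \<ge> 0" "h > 0" "v \<ge> 0" "B \<ge> 0"
    and bd: "\<And>a. v ^ a * B \<le> C * gevrey s h a"
  shows "v ^ a * ((1 + v\<^sup>2) * B) \<le> (C * (1 + h\<^sup>2 * 2 powr s)) * gevrey s (4 powr s * h) a"
proof -
  have C: "C \<ge> 0" using bd[of 0] assms by simp
  have "1 \<le> (4::real) powr s" using assms by (simp add: ge_one_powr_ge_zero)
  then have "h \<le> 4 powr s * h" using assms by simp
  then have 1: "v ^ a * B \<le> C * gevrey s (4 powr s * h) a"
    using bd[of a] gevrey_mono[of h "4 powr s * h" s a] assms C
    by (meson less_imp_le mult_left_mono order_trans)
  have "v ^ (a + 2) * B \<le> C * ((h\<^sup>2 * 2 powr s) * gevrey s (4 powr s * h) a)"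
    using bd[of "a + 2"] gevrey_Suc_Suc[of s h a] assms C
    by (meson less_imp_le mult_left_mono order_trans)
  then have "v ^ a * B + v ^ (a + 2) * B
      \<le> C * gevrey s (4 powr s * h) a + C * ((h\<^sup>2 * 2 powr s) * gevrey s (4 powr s * h) a)"
    using 1 by linarith
  then show ?thesis by (simp add: algebra_simps power2_eq_square)
qed

definition weight ::
    "nat \<Rightarrow> (nat \<Rightarrow> real) \<Rightarrow> (nat \<Rightarrow> real) \<Rightarrow> real \<Rightarrow> (nat \<Rightarrow> nat) \<Rightarrow> (nat \<Rightarrow> nat) \<Rightarrow> real"
  where "weight d s \<sigma> h \<alpha> \<beta> = (\<Prod>i<d. gevrey (s i) h (\<alpha> i) * gevrey (\<sigma> i) h (\<beta> i))"

lemma weight_pos [simp]: "h > 0 \<Longrightarrow> weight d s \<sigma> h \<alpha> \<beta> > 0"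
  by (simp add: weight_def prod_pos)

lemma weight_nonneg [simp]: "h > 0 \<Longrightarrow> weight d s \<sigma> h \<alpha> \<beta> \<ge> 0"
  by (simp add: less_imp_le)

lemma weight_0 [simp]: "weight d s \<sigma> h (\<lambda>_. 0) (\<lambda>_. 0) = 1"
  by (simp add: weight_def)

lemma weight_mono: "0 < h \<Longrightarrow> h \<le> h' \<Longrightarrow> weight d s \<sigma> h \<alpha> \<beta> \<le> weight d s \<sigma> h' \<alpha> \<beta>"
  unfolding weight_def by (intro prod_mono conjI mult_mono gevrey_mono) auto

lemma weight_scale:
  "weight d s \<sigma> (c * h) \<alpha> \<beta> = c ^ (\<Sum>i<d. \<alpha> i + \<beta> i) * weight d s \<sigma> h \<alpha> \<beta>"
  by (simp add: weight_def gevrey_scale power_sum prod.distrib[symmetric] power_add mult_ac)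

lemma weight_split:
  assumes "i < d"
  shows "weight d s \<sigma> h \<alpha> \<beta> = gevrey (s i) h (\<alpha> i) * gevrey (\<sigma> i) h (\<beta> i) *
    (\<Prod>j\<in>{..<d}-{i}. gevrey (s j) h (\<alpha> j) * gevrey (\<sigma> j) h (\<beta> j))"
  unfolding weight_def using assms by (simp add: prod.remove)

lemma monomial_split:
  assumes "i < d"
  shows "\<bar>monomial d \<alpha> x\<bar> = \<bar>x i\<bar> ^ \<alpha> i * (\<Prod>j\<in>{..<d}-{i}. \<bar>x j\<bar> ^ \<alpha> j)"
  unfolding monomial_def using assms by (simp add: prod.remove abs_mult abs_prod power_abs)

section \<open>Weighted sup-norm bounds\<close>

definition bound_family ::
    "nat \<Rightarrow> (nat \<Rightarrow> real) \<Rightarrow> (nat \<Rightarrow> real) \<Rightarrow> real \<Rightarrow> real \<Rightarrow>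
     ((nat \<Rightarrow> nat) \<Rightarrow> (nat \<Rightarrow> real) \<Rightarrow> complex) \<Rightarrow> bool"
  where "bound_family d s \<sigma> h C D \<longleftrightarrow>
    (\<forall>\<alpha> \<beta>. \<forall>x\<in>Rd d. \<bar>monomial d \<alpha> x\<bar> * cmod (D \<beta> x) \<le> C * weight d s \<sigma> h \<alpha> \<beta>)"

text \<open>
  By the pointwise form of the norm below, this says that the norm with parameter \<open>h\<close> is at most \<open>C\<close>.
\<close>

definition gs_bounded ::
    "nat \<Rightarrow> (nat \<Rightarrow> real) \<Rightarrow> (nat \<Rightarrow> real) \<Rightarrow> real \<Rightarrow> real \<Rightarrow> ((nat \<Rightarrow> real) \<Rightarrow> complex) \<Rightarrow> bool"
  where "gs_bounded d s \<sigma> h C f \<longleftrightarrow> f \<in> Cinf d \<and> bound_family d s \<sigma> h C (\<lambda>\<beta>. multi_deriv d \<beta> f)"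

lemma bound_familyD:
  "bound_family d s \<sigma> h C D \<Longrightarrow> x \<in> Rd d \<Longrightarrow>
    \<bar>monomial d \<alpha> x\<bar> * cmod (D \<beta> x) \<le> C * weight d s \<sigma> h \<alpha> \<beta>"
  by (simp add: bound_family_def)

lemma Rd_nonempty: "(\<lambda>i. if i < d then 0 else undefined) \<in> Rd d"
  by (auto simp: Rd_def PiE_iff extensional_def)

lemma monomial_0 [simp]: "monomial d (\<lambda>_. 0) x = 1"
  by (simp add: monomial_def)

lemma bound_family_sup:
  "bound_family d s \<sigma> h C D \<Longrightarrow> x \<in> Rd d \<Longrightarrow> cmod (D \<beta> x) \<le> C * weight d s \<sigma> h (\<lambda>_. 0) \<beta>"
  using bound_familyD[of d s \<sigma> h C D x "\<lambda>_. 0" \<beta>] by simp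

lemma bound_family_nonneg: "bound_family d s \<sigma> h C D \<Longrightarrow> C \<ge> 0"
  using bound_family_sup[of d s \<sigma> h C D _ "\<lambda>_. 0", OF _ Rd_nonempty]
  by (simp add: order_trans[OF norm_ge_zero])

lemma bound_family_bounded: "bound_family d s \<sigma> h C D \<Longrightarrow> bounded_family d D"
  unfolding bounded_family_def using bound_family_sup by blast

lemma bound_family_mono:
  assumes "bound_family d s \<sigma> h C D" "0 < h" "h \<le> h'" "C \<le> C'"
  shows "bound_family d s \<sigma> h' C' D"
  unfolding bound_family_def
proof (intro allI ballI)
  fix \<alpha> \<beta> x assume "x \<in> Rd d"
  then have "\<bar>monomial d \<alpha> x\<bar> * cmod (D \<beta> x) \<le> C * weight d s \<sigma> h \<alpha> \<beta>"
    using assms(1) by (simp add: bound_family_def)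
  also have "\<dots> \<le> C' * weight d s \<sigma> h' \<alpha> \<beta>"
    using assms bound_family_nonneg[OF assms(1)] by (intro mult_mono weight_mono) auto
  finally show "\<bar>monomial d \<alpha> x\<bar> * cmod (D \<beta> x) \<le> C' * weight d s \<sigma> h' \<alpha> \<beta>" .
qed

lemma gs_bounded_Cinf: "gs_bounded d s \<sigma> h C f \<Longrightarrow> f \<in> Cinf d"
  by (simp add: gs_bounded_def)

lemma gs_bounded_nonneg: "gs_bounded d s \<sigma> h C f \<Longrightarrow> C \<ge> 0"
  using bound_family_nonneg by (auto simp: gs_bounded_def)

lemma gs_bounded_mono: "gs_bounded d s \<sigma> h C f \<Longrightarrow> 0 < h \<Longrightarrow> h \<le> h' \<Longrightarrow> C \<le> C' \<Longrightarrow> gs_bounded d s \<sigma> h' C' f"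
  using bound_family_mono by (auto simp: gs_bounded_def)

text \<open>
  A function is usually bounded by exhibiting its partial derivatives as a smooth family, rather
  than by computing iterated derivatives.
\<close>

lemma gs_boundedI:
  assumes D: "smooth_family d D" and bd: "bound_family d s \<sigma> h C D" and f: "f = D (\<lambda>_. 0)"
  shows "gs_bounded d s \<sigma> h C f"
proof -
  have "weight d s \<sigma> h \<alpha> (zero_beyond d \<beta>) = weight d s \<sigma> h \<alpha> \<beta>" for \<alpha> \<beta>
    by (simp add: weight_def zero_beyond_def)
  then show ?thesis
    using smooth_family_Cinf[OF D bound_family_bounded[OF bd]] bd
    unfolding gs_bounded_def bound_family_def f by (metis smooth_family_multi_deriv[OF D])
qed

lemma gs_boundedD:
  assumes "gs_bounded d s \<sigma> h C f"
  shows "smooth_family d (\<lambda>\<beta>. multi_deriv d \<beta> f)" "bound_family d s \<sigma> h C (\<lambda>\<beta>. multi_deriv d \<beta> f)"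
  using assms Cinf_smooth_family by (auto simp: gs_bounded_def)

lemma smooth_family_add:
  assumes "smooth_family d D" "smooth_family d E"
  shows "smooth_family d (\<lambda>\<beta> x. D \<beta> x + E \<beta> x)"
  using assms unfolding smooth_family_def by (auto intro!: derivative_intros)

lemma smooth_family_mult:
  assumes "smooth_family d D"
  shows "smooth_family d (\<lambda>\<beta> x. c * D \<beta> x)"
  using assms unfolding smooth_family_def by (auto intro!: derivative_intros)

lemma bound_family_add:
  assumes "bound_family d s \<sigma> h C D" "bound_family d s \<sigma> h C' E"
  shows "bound_family d s \<sigma> h (C + C') (\<lambda>\<beta> x. D \<beta> x + E \<beta> x)"
  unfolding bound_family_def
proof (intro allI ballI)
  fix \<alpha> \<beta> x assume x: "x \<in> Rd d"
  have "\<bar>monomial d \<alpha> x\<bar> * cmod (D \<beta> x + E \<beta> x)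
      \<le> \<bar>monomial d \<alpha> x\<bar> * (cmod (D \<beta> x) + cmod (E \<beta> x))"
    by (intro mult_left_mono norm_triangle_ineq) auto
  then show "\<bar>monomial d \<alpha> x\<bar> * cmod (D \<beta> x + E \<beta> x) \<le> (C + C') * weight d s \<sigma> h \<alpha> \<beta>"
    using bound_familyD[OF assms(1) x, of \<alpha> \<beta>] bound_familyD[OF assms(2) x, of \<alpha> \<beta>]
    by (simp add: distrib_left distrib_right)
qed

lemma bound_family_mult:
  assumes "bound_family d s \<sigma> h C D"
  shows "bound_family d s \<sigma> h (cmod c * C) (\<lambda>\<beta> x. c * D \<beta> x)"
  unfolding bound_family_def
proof (intro allI ballI)
  fix \<alpha> \<beta> x assume x: "x \<in> Rd d"
  have "cmod c * (\<bar>monomial d \<alpha> x\<bar> * cmod (D \<beta> x)) \<le> cmod c * (C * weight d s \<sigma> h \<alpha> \<beta>)"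
    by (intro mult_left_mono bound_familyD[OF assms x]) auto
  then show "\<bar>monomial d \<alpha> x\<bar> * cmod (c * D \<beta> x) \<le> cmod c * C * weight d s \<sigma> h \<alpha> \<beta>"
    by (simp add: norm_mult mult_ac)
qed

lemma gs_bounded_add:
  assumes "gs_bounded d s \<sigma> h C f" "gs_bounded d s \<sigma> h C' g"
  shows "gs_bounded d s \<sigma> h (C + C') (\<lambda>x. f x + g x)"
  by (rule gs_boundedI[OF smooth_family_add[OF gs_boundedD(1)[OF assms(1)] gs_boundedD(1)[OF assms(2)]]
        bound_family_add[OF gs_boundedD(2)[OF assms(1)] gs_boundedD(2)[OF assms(2)]]]) simp

lemma gs_bounded_mult:
  assumes "gs_bounded d s \<sigma> h C f"
  shows "gs_bounded d s \<sigma> h (cmod c * C) (\<lambda>x. c * f x)"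
  by (rule gs_boundedI[OF smooth_family_mult[OF gs_boundedD(1)[OF assms]] bound_family_mult[OF gs_boundedD(2)[OF assms]]]) simp

lemma gs_bounded_diff:
  assumes "gs_bounded d s \<sigma> h C f" "gs_bounded d s \<sigma> h C' g"
  shows "gs_bounded d s \<sigma> h (C + C') (\<lambda>x. f x - g x)"
  using gs_bounded_add[OF assms(1) gs_bounded_mult[OF assms(2), of "-1"]] by simp

lemma gs_bounded_zero: "gs_bounded d s \<sigma> h 0 (\<lambda>_. 0)"
proof -
  have "smooth_family d (\<lambda>\<beta> x. 0)" by (auto simp: smooth_family_def)
  moreover have "bound_family d s \<sigma> h 0 (\<lambda>\<beta> x. 0)" by (simp add: bound_family_def)
  ultimately show ?thesis by (rule gs_boundedI) simp
qed

lemma gs_bounded_sum: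
  assumes "finite I" "\<And>k. k \<in> I \<Longrightarrow> gs_bounded d s \<sigma> h (C k) (f k)"
  shows "gs_bounded d s \<sigma> h (\<Sum>k\<in>I. C k) (\<lambda>x. \<Sum>k\<in>I. f k x)"
  using assms by (induction I) (auto simp: gs_bounded_zero intro: gs_bounded_add)

section \<open>Small sup-norm implies small weighted norm\<close>

text \<open>
  Landau's inequality: a first derivative is small when the function is small and the second
  derivative is bounded, by choice of \<open>\<tau>\<close>.
\<close>

lemma derivative_interpolation:
  assumes D: "smooth_family d D" and "i < d" and x: "x \<in> Rd d" and "\<tau> > 0"
    and e: "\<And>x. x \<in> Rd d \<Longrightarrow> cmod (D \<beta> x) \<le> e"
    and B: "\<And>x. x \<in> Rd d \<Longrightarrow> cmod (D (\<beta>(i := Suc (Suc (\<beta> i)))) x) \<le> B"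
  shows "cmod (D (\<beta>(i := Suc (\<beta> i))) x) \<le> 2 * e / \<tau> + \<tau> * B"
proof -
  let ?\<beta>' = "\<beta>(i := Suc (\<beta> i))"
  have B0: "B \<ge> 0" using B[OF x] norm_ge_zero order_trans by blast
  have "norm (D \<beta> (x(i := x i + \<tau>)) - D \<beta> (x(i := x i)) - (x i + \<tau> - x i) *\<^sub>R D ?\<beta>' x)
      \<le> (\<tau> * B) * \<bar>x i + \<tau> - x i\<bar>"
  proof (rule vector_mean_value_bound[of "{x i..x i + \<tau>}" _ "\<lambda>t. D ?\<beta>' (x(i := t))"])
    fix t assume t: "t \<in> {x i..x i + \<tau>}"
    have "cmod (D ?\<beta>' (x(i := t)) - D ?\<beta>' (x(i := x i))) \<le> B * \<bar>t - x i\<bar>"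
      using smooth_family_increment[OF D \<open>i < d\<close> x, of ?\<beta>' B t "x i"] B by simp
    also have "\<dots> \<le> B * \<tau>" using t B0 by (intro mult_left_mono) auto
    finally show "cmod (D ?\<beta>' (x(i := t)) - D ?\<beta>' x) \<le> \<tau> * B" by (simp add: mult.commute)
  next
    show "((\<lambda>t. D \<beta> (x(i := t))) has_vector_derivative D ?\<beta>' (x(i := t))) (at t)" for t
      by (rule smooth_familyD[OF D \<open>i < d\<close> x])
  qed (use \<open>\<tau> > 0\<close> in auto)
  then have 1: "norm (D \<beta> (x(i := x i + \<tau>)) - D \<beta> x - \<tau> *\<^sub>R D ?\<beta>' x) \<le> \<tau> * B * \<tau>"
    using \<open>\<tau> > 0\<close> by simp
  have "norm (\<tau> *\<^sub>R D ?\<beta>' x) \<le> norm (D \<beta> (x(i := x i + \<tau>))) + norm (D \<beta> x) + \<tau> * B * \<tau>"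
    using 1 norm_triangle_ineq4[of "D \<beta> (x(i := x i + \<tau>))" "D \<beta> x"]
      norm_triangle_sub[of "\<tau> *\<^sub>R D ?\<beta>' x" "D \<beta> (x(i := x i + \<tau>)) - D \<beta> x"]
      norm_minus_commute[of "\<tau> *\<^sub>R D ?\<beta>' x" "D \<beta> (x(i := x i + \<tau>)) - D \<beta> x"]
    by linarith
  also have "\<dots> \<le> e + e + \<tau> * B * \<tau>"
    using e[OF x] e[of "x(i := x i + \<tau>)"] x \<open>i < d\<close> by (intro add_mono) auto
  finally have "\<tau> * norm (D ?\<beta>' x) \<le> 2 * e + \<tau> * B * \<tau>" using \<open>\<tau> > 0\<close> by simp
  then show ?thesis using \<open>\<tau> > 0\<close> by (simp add: field_simps)
qed

lemma small_sup_small_derivative: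
  assumes "h > 0" "e > 0"
  shows "\<exists>\<delta>>0. \<forall>D. smooth_family d D \<longrightarrow> bound_family d s \<sigma> h C D \<longrightarrow>
    (\<forall>x\<in>Rd d. cmod (D (\<lambda>_. 0) x) \<le> \<delta>) \<longrightarrow> (\<forall>x\<in>Rd d. cmod (D (zero_beyond d \<beta>) x) \<le> e)"
  using \<open>e > 0\<close>
proof (induction "\<Sum>i<d. \<beta> i" arbitrary: \<beta> e)
  case 0
  then have "zero_beyond d \<beta> = (\<lambda>_. 0)" by (auto simp: zero_beyond_def)
  then show ?case using 0 by auto
next
  case (Suc n)
  obtain i where i: "i < d" "\<beta> i > 0"
    using Suc(2) by (metis bot_nat_0.not_eq_extremum lessThan_iff nat.distinct(1) sum.neutral)
  define \<gamma> where "\<gamma> = \<beta>(i := \<beta> i - 1)"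
  have n: "n = (\<Sum>i<d. \<gamma> i)"
  proof -
    have "(\<Sum>j<d. \<beta> j) = (\<Sum>j<d. \<gamma> j) + 1"
      using i by (simp add: \<gamma>_def sum.remove[of _ i])
    then show ?thesis using Suc(2) by simp
  qed
  have \<beta>: "zero_beyond d \<beta> = (zero_beyond d \<gamma>)(i := Suc (zero_beyond d \<gamma> i))"
    using i by (auto simp: zero_beyond_def \<gamma>_def)
  define B where "B = \<bar>C\<bar> * weight d s \<sigma> h (\<lambda>_. 0) ((zero_beyond d \<gamma>)(i := Suc (Suc (zero_beyond d \<gamma> i))))"
  have "B \<ge> 0" using \<open>h > 0\<close> by (simp add: B_def)
  define \<tau> where "\<tau> = e / (2 * (B + 1))"
  have \<tau>: "\<tau> > 0" "\<tau> * B \<le> e / 2"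
    using \<open>B \<ge> 0\<close> \<open>e > 0\<close> by (auto simp: \<tau>_def field_simps)
  have "e * \<tau> / 4 > 0" using \<tau> \<open>e > 0\<close> by simp
  from Suc(1)[OF n this] obtain \<delta> where \<delta>: "\<delta> > 0"
    "\<And>D. smooth_family d D \<Longrightarrow> bound_family d s \<sigma> h C D \<Longrightarrow>
      (\<forall>x\<in>Rd d. cmod (D (\<lambda>_. 0) x) \<le> \<delta>) \<Longrightarrow> (\<forall>x\<in>Rd d. cmod (D (zero_beyond d \<gamma>) x) \<le> e * \<tau> / 4)"
    by blast
  show ?case
  proof (intro exI[of _ \<delta>] conjI \<delta>(1) allI impI ballI)
    fix D x assume D: "smooth_family d D" "bound_family d s \<sigma> h C D"
      and small: "\<forall>x\<in>Rd d. cmod (D (\<lambda>_. 0) x) \<le> \<delta>" and x: "x \<in> Rd d"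
    have "cmod (D (zero_beyond d \<beta>) x) \<le> 2 * (e * \<tau> / 4) / \<tau> + \<tau> * B"
      unfolding \<beta>
    proof (rule derivative_interpolation[OF D(1) i(1) x \<tau>(1)])
      show "cmod (D (zero_beyond d \<gamma>) y) \<le> e * \<tau> / 4" if "y \<in> Rd d" for y
        using \<delta>(2)[OF D small] that by blast
      show "cmod (D ((zero_beyond d \<gamma>)(i := Suc (Suc (zero_beyond d \<gamma> i)))) y) \<le> B" if "y \<in> Rd d" for y
        using bound_family_sup[OF D(2) that] bound_family_nonneg[OF D(2)] by (simp add: B_def)
    qed
    also have "\<dots> \<le> e" using \<tau> by simp
    finally show "cmod (D (zero_beyond d \<beta>) x) \<le> e" .
  qed
qed

lemma finite_multi_indices: "finite {\<alpha>. (\<forall>i\<ge>d. \<alpha> i = 0) \<and> (\<Sum>i<(d::nat). \<alpha> i) < (M::nat)}"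
proof (rule finite_subset)
  show "{\<alpha>. (\<forall>i\<ge>d. \<alpha> i = 0) \<and> (\<Sum>i<d. \<alpha> i) < M}
      \<subseteq> {\<alpha>. \<forall>i. (i \<in> {..<d} \<longrightarrow> \<alpha> i \<in> {..<M}) \<and> (i \<notin> {..<d} \<longrightarrow> \<alpha> i = 0)}"
  proof (clarsimp simp: not_less)
    fix \<alpha> :: "nat \<Rightarrow> nat" and i :: nat assume "(\<Sum>i<d. \<alpha> i) < M" "i < d"
    moreover have "\<alpha> i \<le> (\<Sum>i<d. \<alpha> i)" by (rule member_le_sum) (use \<open>i < d\<close> in auto)
    ultimately show "\<alpha> i < M" by simp
  qed
  show "finite {\<alpha>. \<forall>i. (i \<in> {..<d} \<longrightarrow> \<alpha> i \<in> {..<M}) \<and> (i \<notin> {..<d} \<longrightarrow> \<alpha> i = (0::nat))}"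
    by (rule finite_set_of_finite_funs) auto
qed

text \<open>
  Multi-indices of large order are harmless,
  because doubling \<open>h\<close> gains \<open>2\<close> to the power of the order. For each of the finitely many others,
  Landau interpolation handles the derivatives, and
  \<open>\<bar>x\<^sup>\<alpha> F\<bar>\<^sup>2 = \<bar>x\<^sup>2\<^sup>\<alpha> F\<bar> \<bar>F\<bar>\<close> handles the monomials.
\<close>

lemma small_sup_small_norm:
  assumes "h > 0" "e > 0"
  shows "\<exists>\<delta>>0. \<forall>f. gs_bounded d s \<sigma> h C f \<longrightarrow> (\<forall>x\<in>Rd d. cmod (f x) \<le> \<delta>) \<longrightarrow> gs_bounded d s \<sigma> (2 * h) e f"
proof -
  obtain M where M: "\<bar>C\<bar> < e * 2 ^ M"
    using real_arch_pow[of 2 "\<bar>C\<bar> / e"] \<open>e > 0\<close> by (auto simp: field_simps)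
  define P where "P = {\<alpha>. (\<forall>i\<ge>d. \<alpha> i = 0) \<and> (\<Sum>i<d. \<alpha> i) < M}"
  have "finite P" unfolding P_def by (rule finite_multi_indices)
  have wpos: "weight d s \<sigma> (2*h) \<alpha> \<beta> > 0" "weight d s \<sigma> h \<alpha> \<beta> > 0" for \<alpha> \<beta>
    using \<open>h > 0\<close> by auto
  \<comment> \<open>the bound on \<open>\<bar>F\<bar>\<close> that makes \<open>\<bar>x\<^sup>\<alpha> F\<bar>\<^sup>2\<close> small enough\<close>
  define \<eta> where "\<eta> \<alpha> \<beta> = (e * weight d s \<sigma> (2*h) \<alpha> \<beta>)\<^sup>2 / (\<bar>C\<bar> * weight d s \<sigma> h (\<lambda>i. 2 * \<alpha> i) \<beta> + 1)" for \<alpha> \<beta>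
  have \<eta>: "\<eta> \<alpha> \<beta> > 0" for \<alpha> \<beta>
    unfolding \<eta>_def using wpos \<open>e > 0\<close>
    by (intro divide_pos_pos zero_less_power mult_pos_pos add_nonneg_pos mult_nonneg_nonneg)
       (auto intro: less_imp_le)
  have "\<forall>\<alpha> \<beta>. \<exists>\<delta>>0. \<forall>D. smooth_family d D \<longrightarrow> bound_family d s \<sigma> h C D \<longrightarrow>
    (\<forall>x\<in>Rd d. cmod (D (\<lambda>_. 0) x) \<le> \<delta>) \<longrightarrow> (\<forall>x\<in>Rd d. cmod (D (zero_beyond d \<beta>) x) \<le> \<eta> \<alpha> \<beta>)"
    using small_sup_small_derivative[OF \<open>h > 0\<close> \<eta>] by blast
  then obtain \<delta> where \<delta>: "\<And>\<alpha> \<beta>. \<delta> \<alpha> \<beta> > 0"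
    "\<And>\<alpha> \<beta> D. smooth_family d D \<Longrightarrow> bound_family d s \<sigma> h C D \<Longrightarrow>
    (\<forall>x\<in>Rd d. cmod (D (\<lambda>_. 0) x) \<le> \<delta> \<alpha> \<beta>) \<Longrightarrow> (\<forall>x\<in>Rd d. cmod (D (zero_beyond d \<beta>) x) \<le> \<eta> \<alpha> \<beta>)"
    by metis
  define \<delta>0 where "\<delta>0 = Min (insert 1 ((\<lambda>(\<alpha>, \<beta>). \<delta> \<alpha> \<beta>) ` (P \<times> P)))"
  have \<delta>0: "\<delta>0 > 0" unfolding \<delta>0_def using \<open>finite P\<close> \<delta>(1) by (subst Min_gr_iff) auto
  have \<delta>0_le: "\<delta>0 \<le> \<delta> \<alpha> \<beta>" if "\<alpha> \<in> P" "\<beta> \<in> P" for \<alpha> \<beta>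
    unfolding \<delta>0_def using that \<open>finite P\<close> by (intro Min_le) auto
  show ?thesis
  proof (intro exI[of _ \<delta>0] conjI \<delta>0 allI impI)
    fix f assume f: "gs_bounded d s \<sigma> h C f" and small: "\<forall>x\<in>Rd d. cmod (f x) \<le> \<delta>0"
    have zz: "zero_beyond d (zero_beyond d \<beta>) = zero_beyond d \<beta>" for \<beta>
      by (auto simp: zero_beyond_def)
    have wz: "weight d s \<sigma> h' (zero_beyond d \<alpha>) (zero_beyond d \<beta>) = weight d s \<sigma> h' \<alpha> \<beta>" for \<alpha> \<beta> h'
      by (simp add: weight_def zero_beyond_def)
    have mz: "monomial d (zero_beyond d \<alpha>) x = monomial d \<alpha> x" for \<alpha> x
      by (simp add: monomial_def zero_beyond_def)
    let ?D = "\<lambda>\<beta>. multi_deriv d \<beta> f"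
    note D = gs_boundedD[OF f]
    have C0: "C \<ge> 0" using gs_bounded_nonneg[OF f] .
    have Dz: "multi_deriv d (zero_beyond d \<beta>) f = multi_deriv d \<beta> f" for \<beta>
      using smooth_family_multi_deriv[OF D(1), of \<beta>] by simp
    have "\<bar>monomial d \<alpha> x\<bar> * cmod (?D \<beta> x) \<le> e * weight d s \<sigma> (2 * h) \<alpha> \<beta>"
      if x: "x \<in> Rd d" and \<alpha>: "\<alpha> = zero_beyond d \<alpha>" and \<beta>: "\<beta> = zero_beyond d \<beta>" for \<alpha> \<beta> x
    proof (cases "M \<le> (\<Sum>i<d. \<alpha> i + \<beta> i)")
      case True
      have "\<bar>monomial d \<alpha> x\<bar> * cmod (?D \<beta> x) \<le> C * weight d s \<sigma> h \<alpha> \<beta>"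
        by (rule bound_familyD[OF D(2) x])
      also have "\<dots> \<le> (e * 2 ^ (\<Sum>i<d. \<alpha> i + \<beta> i)) * weight d s \<sigma> h \<alpha> \<beta>"
      proof (rule mult_right_mono)
        have "C \<le> e * 2 ^ M" using M by linarith
        also have "\<dots> \<le> e * 2 ^ (\<Sum>i<d. \<alpha> i + \<beta> i)"
          using True \<open>e > 0\<close> by (intro mult_left_mono power_increasing) auto
        finally show "C \<le> e * 2 ^ (\<Sum>i<d. \<alpha> i + \<beta> i)" .
      qed (use \<open>h > 0\<close> in auto)
      also have "\<dots> = e * weight d s \<sigma> (2 * h) \<alpha> \<beta>"
        by (subst weight_scale) (rule mult.assoc)
      finally show ?thesis .
    next
      case False
      have "\<gamma> i = 0" if "\<gamma> = zero_beyond d \<gamma>" "i \<ge> d" for \<gamma> i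
        using fun_cong[OF that(1), of i] that(2) by (simp add: zero_beyond_def)
      with False have "\<alpha> \<in> P" "\<beta> \<in> P"
        using \<alpha> \<beta> unfolding P_def by (auto simp: sum.distrib)
      then have "\<forall>x\<in>Rd d. cmod (?D (\<lambda>_. 0) x) \<le> \<delta> \<alpha> \<beta>"
        using small \<delta>0_le by fastforce
      then have s1: "cmod (?D \<beta> x) \<le> \<eta> \<alpha> \<beta>"
        using \<delta>(2)[OF D] x \<beta> by metis
      have s2: "\<bar>monomial d (\<lambda>i. 2 * \<alpha> i) x\<bar> * cmod (?D \<beta> x) \<le> C * weight d s \<sigma> h (\<lambda>i. 2 * \<alpha> i) \<beta>"
        by (rule bound_familyD[OF D(2) x])
      have m2: "\<bar>monomial d (\<lambda>i. 2 * \<alpha> i) x\<bar> = \<bar>monomial d \<alpha> x\<bar>\<^sup>2"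
        by (simp add: monomial_def power_mult prod_power_distrib power2_eq_square power_mult_distrib
              prod.distrib abs_mult)
      have "(\<bar>monomial d \<alpha> x\<bar> * cmod (?D \<beta> x))\<^sup>2
          = (\<bar>monomial d (\<lambda>i. 2 * \<alpha> i) x\<bar> * cmod (?D \<beta> x)) * cmod (?D \<beta> x)"
        by (subst m2) (simp only: power2_eq_square mult_ac)
      also have "\<dots> \<le> (C * weight d s \<sigma> h (\<lambda>i. 2 * \<alpha> i) \<beta>) * \<eta> \<alpha> \<beta>"
        using C0 \<open>h > 0\<close> by (intro mult_mono[OF s2 s1]) auto
      also have "\<dots> \<le> (C * weight d s \<sigma> h (\<lambda>i. 2 * \<alpha> i) \<beta> + 1) * \<eta> \<alpha> \<beta>"
        using \<eta>[of \<alpha> \<beta>] by (intro mult_right_mono) auto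
      also have "\<dots> = (e * weight d s \<sigma> (2*h) \<alpha> \<beta>)\<^sup>2"
      proof -
        have "C * weight d s \<sigma> h (\<lambda>i. 2 * \<alpha> i) \<beta> \<ge> 0"
          using C0 wpos(2)[of "\<lambda>i. 2 * \<alpha> i" \<beta>] by simp
        then have "C * weight d s \<sigma> h (\<lambda>i. 2 * \<alpha> i) \<beta> + 1 \<noteq> 0" by linarith
        then show ?thesis unfolding \<eta>_def using C0 by simp
      qed
      finally show ?thesis
        by (rule power2_le_imp_le) (use \<open>e > 0\<close> \<open>h > 0\<close> in simp)
    qed
    note key = this
    have "bound_family d s \<sigma> (2 * h) e ?D"
      unfolding bound_family_def
    proof (intro allI ballI)
      fix \<alpha> \<beta> x assume "x \<in> Rd d"
      from key[OF this, of "zero_beyond d \<alpha>" "zero_beyond d \<beta>"]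
      show "\<bar>monomial d \<alpha> x\<bar> * cmod (?D \<beta> x) \<le> e * weight d s \<sigma> (2 * h) \<alpha> \<beta>"
        by (simp add: Dz mz wz zz)
    qed
    then show "gs_bounded d s \<sigma> (2 * h) e f" using f by (simp add: gs_bounded_def)
  qed
qed

section \<open>The norms and the topologies in terms of weighted bounds\<close>

lemma emeasure_lborel_open_nonzero:
  fixes X :: "real set"
  assumes "open X" "X \<noteq> {}"
  shows "emeasure lborel X \<noteq> 0"
proof -
  obtain x e where x: "e > 0" "ball x e \<subseteq> X" using assms openE by blast
  have "ball x e = {x - e<..<x + e}" by (auto simp: dist_real_def)
  then have "emeasure lborel (ball x e) = ennreal (2 * e)" using x(1) by simp
  moreover have "emeasure lborel (ball x e) \<le> emeasure lborel X"
    by (rule emeasure_mono) (use x assms in auto)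
  ultimately show ?thesis using x(1) by (auto simp: ennreal_eq_0_iff)
qed

text \<open>
  Nonempty open boxes have positive Lebesgue measure, so for continuous functions the essential
  supremum is the supremum.
\<close>

lemma Linf_norm_le_iff:
  assumes g: "continuous_on (Rd d) g"
  shows "Linf_norm d g \<le> ereal c \<longleftrightarrow> (\<forall>x\<in>Rd d. cmod (g x) \<le> c)"
proof -
  let ?M = "PiM {..<d} (\<lambda>_. lborel :: real measure)"
  have space: "space ?M = Rd d" by (simp add: space_PiM Rd_def)
  define G where "G y = g (restrict y {..<d})" for y
  have "continuous_on UNIV (\<lambda>y::nat \<Rightarrow> real. restrict y {..<d})"
  proof (rule continuous_on_coordinatewise_then_product)
    fix i show "continuous_on UNIV (\<lambda>y::nat \<Rightarrow> real. restrict y {..<d} i)"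
      by (cases "i < d") auto
  qed
  then have "continuous_on UNIV G"
    unfolding G_def by (rule continuous_on_compose2[OF g]) (simp_all add: Rd_def image_subset_iff PiE_iff)
  then have G: "G \<in> borel_measurable borel" by (rule borel_measurable_continuous_onI)
  have "(\<lambda>x. x) \<in> measurable ?M (PiM UNIV (\<lambda>_. borel))"
  proof (rule measurable_PiM_single')
    fix i show "(\<lambda>x. x i) \<in> measurable ?M borel"
    proof (cases "i < d")
      case True
      then show ?thesis
        using measurable_component_singleton[of i "{..<d}" "\<lambda>_. lborel :: real measure"] by simp
    next
      case False
      then have "x i = undefined" if "x \<in> space ?M" for x
        using that by (auto simp: space Rd_def PiE_iff extensional_def)
      then show ?thesis by (subst measurable_cong[where g = "\<lambda>_. undefined"]) auto
    qed
  qed auto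
  then have id: "(\<lambda>x. x) \<in> measurable ?M borel"
    using measurable_cong_sets[OF refl sets_PiM_equal_borel] by blast
  have "(\<lambda>x. G x) \<in> borel_measurable ?M"
    using measurable_compose[OF id G] .
  moreover have "G x = g x" if "x \<in> space ?M" for x
    using that unfolding G_def space Rd_def by (simp add: PiE_restrict)
  ultimately have meas_g: "g \<in> borel_measurable ?M"
    by (simp cong: measurable_cong)
  then have meas: "(\<lambda>x. ereal (cmod (g x))) \<in> borel_measurable ?M"
    by measurable
  show ?thesis
  proof
    assume le: "Linf_norm d g \<le> ereal c"
    have "AE x in ?M. ereal (cmod (g x)) \<le> Linf_norm d g"
      unfolding Linf_norm_def by (rule esssup_AE)
    then have ae: "AE x in ?M. cmod (g x) \<le> c"
      using le by (auto elim!: eventually_mono dest: order_trans)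
    show "\<forall>x\<in>Rd d. cmod (g x) \<le> c"
    proof (rule ccontr)
      assume "\<not> (\<forall>x\<in>Rd d. cmod (g x) \<le> c)"
      then obtain x where x: "x \<in> Rd d" "c < cmod (g x)" by auto
      have "continuous_on UNIV (\<lambda>y. cmod (G y))"
        using \<open>continuous_on UNIV G\<close> by (intro continuous_intros)
      then have "open {y. c < cmod (G y)}"
        by (intro open_Collect_less) (auto intro: continuous_intros)
      then have op: "openin (product_topology (\<lambda>_. euclidean) UNIV) {y. c < cmod (G y)}"
        by (simp only: open_openin euclidean_product_topology)
      have "G x = g x" using x(1) unfolding G_def Rd_def by (simp add: PiE_restrict)
      then have "x \<in> {y. c < cmod (G y)}" using x(2) by simp
      from product_topology_open_contains_basis[OF op this] obtain X where X: "x \<in> Pi\<^sub>E UNIV X" "\<And>i. openin euclidean (X i)"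
          "Pi\<^sub>E UNIV X \<subseteq> {y. c < cmod (G y)}"
        by blast
      have oX: "open (X i)" "x i \<in> X i" for i
        using X by (simp_all only: open_openin PiE_iff) auto
      let ?B = "Pi\<^sub>E {..<d} X"
      interpret product_sigma_finite "\<lambda>_::nat. lborel :: real measure"
        by standard
      have "emeasure ?M ?B = (\<Prod>i<d. emeasure lborel (X i))"
        by (rule emeasure_PiM) (use oX in auto)
      also have "\<dots> \<noteq> 0"
        using emeasure_lborel_open_nonzero[OF oX(1)] oX(2) by (auto simp: prod_zero_iff)
      finally have pos: "emeasure ?M ?B \<noteq> 0" .
      have "c < cmod (g y)" if "y \<in> ?B" for y
      proof -
        define y' where "y' i = (if i < d then y i else x i)" for i
        have "y' \<in> Pi\<^sub>E UNIV X" using that oX by (auto simp: y'_def)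
        then have "c < cmod (G y')" using X(3) by auto
        moreover have "restrict y' {..<d} = y" using that by (auto simp: y'_def PiE_iff extensional_def fun_eq_iff)
        ultimately show ?thesis by (simp add: G_def)
      qed
      then have sub: "?B \<subseteq> {y \<in> space ?M. \<not> cmod (g y) \<le> c}"
        by (auto simp: space Rd_def PiE_iff not_le)
      obtain N where N: "{y \<in> space ?M. \<not> cmod (g y) \<le> c} \<subseteq> N" "emeasure ?M N = 0" "N \<in> sets ?M"
        using AE_E[OF ae] by blast
      have "emeasure ?M ?B \<le> emeasure ?M N"
        by (rule emeasure_mono) (use sub N in auto)
      then show False using pos N by simp
    qed
  next
    assume "\<forall>x\<in>Rd d. cmod (g x) \<le> c"
    then show "Linf_norm d g \<le> ereal c"
      unfolding Linf_norm_def by (intro esssup_I meas AE_I2) (simp add: space)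
  qed
qed

text \<open>
  The exponents of a block structure, spread over the coordinates as functions \<open>s\<close> and \<open>\<sigma>\<close>.
\<close>

locale gs_weights =
  fixes ds :: "nat list" and ss \<sigma>s :: "real list" and d :: nat and s \<sigma> :: "nat \<Rightarrow> real"
  assumes d: "d = sum_list ds"
    and fact_s: "\<And>\<alpha>. fact_powr ds ss \<alpha> = (\<Prod>i<d. fact (\<alpha> i) powr s i)"
    and fact_\<sigma>: "\<And>\<beta>. fact_powr ds \<sigma>s \<beta> = (\<Prod>i<d. fact (\<beta> i) powr \<sigma> i)"
begin

lemma weight_eq:
  "h ^ ((\<Sum>i<d. \<alpha> i) + (\<Sum>i<d. \<beta> i)) * fact_powr ds ss \<alpha> * fact_powr ds \<sigma>s \<beta> = weight d s \<sigma> h \<alpha> \<beta>"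
  by (simp add: weight_def gevrey_def fact_s fact_\<sigma> prod.distrib power_add power_sum mult_ac)

lemma GS_norm_le_iff:
  assumes f: "f \<in> Cinf d" and "h > 0"
  shows "GS_norm ds ss \<sigma>s h f \<le> ereal C \<longleftrightarrow> gs_bounded d s \<sigma> h C f"
proof -
  have cont: "continuous_on (Rd d) (\<lambda>x. complex_of_real (monomial d \<alpha> x) * multi_deriv d \<beta> f x)" for \<alpha> \<beta>
  proof -
    have "continuous_on UNIV (monomial d \<alpha>)"
      unfolding monomial_def by (intro continuous_intros continuous_on_product_coordinates)
    then have "continuous_on (Rd d) (monomial d \<alpha>)" by (rule continuous_on_subset) simp
    then show ?thesis
      using Cinf_continuous[OF multi_deriv_Cinf[OF f]] by (intro continuous_intros)
  qed
  have one: "Linf_norm d (\<lambda>x. complex_of_real (monomial d \<alpha> x) * multi_deriv d \<beta> f x) /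
        ereal (weight d s \<sigma> h \<alpha> \<beta>) \<le> ereal C \<longleftrightarrow>
      (\<forall>x\<in>Rd d. \<bar>monomial d \<alpha> x\<bar> * cmod (multi_deriv d \<beta> f x) \<le> C * weight d s \<sigma> h \<alpha> \<beta>)" for \<alpha> \<beta>
    using Linf_norm_le_iff[OF cont, of \<alpha> \<beta> "C * weight d s \<sigma> h \<alpha> \<beta>"] \<open>h > 0\<close>
    by (simp add: ereal_divide_le_pos norm_mult mult.commute)
  have "GS_norm ds ss \<sigma>s h f \<le> ereal C \<longleftrightarrow> (\<forall>\<alpha>\<in>Nd d. \<forall>\<beta>\<in>Nd d.
      \<forall>x\<in>Rd d. \<bar>monomial d \<alpha> x\<bar> * cmod (multi_deriv d \<beta> f x) \<le> C * weight d s \<sigma> h \<alpha> \<beta>)"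
    unfolding GS_norm_def Let_def d[symmetric] weight_eq SUP_le_iff by (auto simp: one)
  also have "\<dots> \<longleftrightarrow> bound_family d s \<sigma> h C (\<lambda>\<beta>. multi_deriv d \<beta> f)"
  proof
    assume *: "\<forall>\<alpha>\<in>Nd d. \<forall>\<beta>\<in>Nd d.
      \<forall>x\<in>Rd d. \<bar>monomial d \<alpha> x\<bar> * cmod (multi_deriv d \<beta> f x) \<le> C * weight d s \<sigma> h \<alpha> \<beta>"
    show "bound_family d s \<sigma> h C (\<lambda>\<beta>. multi_deriv d \<beta> f)"
      unfolding bound_family_def
    proof (intro allI ballI)
      fix \<alpha> \<beta> :: "nat \<Rightarrow> nat" and x assume x: "x \<in> Rd d"
      let ?\<alpha> = "restrict \<alpha> {..<d}" and ?\<beta> = "restrict \<beta> {..<d}"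
      have "?\<alpha> \<in> Nd d" "?\<beta> \<in> Nd d" by (auto simp: Nd_def)
      with * x have "\<bar>monomial d ?\<alpha> x\<bar> * cmod (multi_deriv d ?\<beta> f x) \<le> C * weight d s \<sigma> h ?\<alpha> ?\<beta>"
        by blast
      moreover have "multi_deriv d ?\<beta> f = multi_deriv d \<beta> f"
        unfolding multi_deriv_def by (rule foldr_cong) auto
      ultimately show "\<bar>monomial d \<alpha> x\<bar> * cmod (multi_deriv d \<beta> f x) \<le> C * weight d s \<sigma> h \<alpha> \<beta>"
        by (simp add: monomial_def weight_def)
    qed
  qed (auto simp: bound_family_def)
  finally show ?thesis using f by (simp add: gs_bounded_def)
qed

lemma GS_norm_less_iff:
  assumes f: "f \<in> Cinf d" and "h > 0"
  shows "GS_norm ds ss \<sigma>s h f < ereal e \<longleftrightarrow> (\<exists>C<e. gs_bounded d s \<sigma> h C f)"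
proof
  assume less: "GS_norm ds ss \<sigma>s h f < ereal e"
  have "\<exists>C<e. GS_norm ds ss \<sigma>s h f \<le> ereal C"
  proof (cases "GS_norm ds ss \<sigma>s h f")
    case (real r)
    then show ?thesis using less by auto
  next
    case MInf
    then show ?thesis by (auto intro!: exI[of _ "e - 1"])
  qed (use less in auto)
  then show "\<exists>C<e. gs_bounded d s \<sigma> h C f" by (simp add: GS_norm_le_iff[OF assms])
next
  assume "\<exists>C<e. gs_bounded d s \<sigma> h C f"
  then show "GS_norm ds ss \<sigma>s h f < ereal e"
    using GS_norm_le_iff[OF assms] by (metis ereal_less_eq(3) le_less_trans less_ereal.simps(1))
qed

lemma GS_h_iff:
  assumes "h > 0"
  shows "f \<in> GS_h ds ss \<sigma>s h \<longleftrightarrow> (\<exists>C. gs_bounded d s \<sigma> h C f)"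
proof -
  have "GS_norm ds ss \<sigma>s h f < \<infinity> \<longleftrightarrow> (\<exists>C. GS_norm ds ss \<sigma>s h f \<le> ereal C)"
    by (cases "GS_norm ds ss \<sigma>s h f") auto
  then show ?thesis
    unfolding GS_h_def d[symmetric] using GS_norm_le_iff[OF _ assms] gs_bounded_Cinf by blast
qed

lemma topspace_GS_h_top: "topspace (GS_h_top ds ss \<sigma>s h) = GS_h ds ss \<sigma>s h"
proof -
  have "openin (GS_h_top ds ss \<sigma>s h) (GS_h ds ss \<sigma>s h)"
    unfolding GS_h_top_def openin_norm_topology by (auto intro: exI[of _ 1])
  moreover have "U \<subseteq> GS_h ds ss \<sigma>s h" if "openin (GS_h_top ds ss \<sigma>s h) U" for U
    using that unfolding GS_h_top_def openin_norm_topology by blast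
  ultimately show ?thesis by (meson openin_subset openin_topspace subset_antisym)
qed

lemma GS_h_diff:
  "h > 0 \<Longrightarrow> f \<in> GS_h ds ss \<sigma>s h \<Longrightarrow> g \<in> GS_h ds ss \<sigma>s h \<Longrightarrow> (\<lambda>x. g x - f x) \<in> Cinf d"
  using GS_h_iff gs_bounded_diff gs_bounded_Cinf by meson

lemma openin_GS_h_top:
  assumes "h > 0"
  shows "openin (GS_h_top ds ss \<sigma>s h) U \<longleftrightarrow> U \<subseteq> GS_h ds ss \<sigma>s h \<and>
    (\<forall>f\<in>U. \<exists>\<epsilon>>0. \<forall>g\<in>GS_h ds ss \<sigma>s h. \<forall>C<\<epsilon>. gs_bounded d s \<sigma> h C (\<lambda>x. g x - f x) \<longrightarrow> g \<in> U)"
proof -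
  have "GS_norm ds ss \<sigma>s h (\<lambda>x. g x - f x) < ereal \<epsilon> \<longleftrightarrow> (\<exists>C<\<epsilon>. gs_bounded d s \<sigma> h C (\<lambda>x. g x - f x))"
    if "f \<in> GS_h ds ss \<sigma>s h" "g \<in> GS_h ds ss \<sigma>s h" for f g \<epsilon>
    by (rule GS_norm_less_iff[OF GS_h_diff[OF assms that] assms])
  then show ?thesis
    unfolding GS_h_top_def openin_norm_topology by (smt (verit, ccfv_threshold) subset_iff)
qed

end

section \<open>The dual spaces in terms of weighted bounds\<close>

text \<open>
  The flag selects the union over \<open>h\<close> (\<open>True\<close>) or the intersection (\<open>False\<close>), so that one argument serves
  both kinds of spaces.
\<close>

definition GS_space ::
    "bool \<Rightarrow> nat \<Rightarrow> (nat \<Rightarrow> real) \<Rightarrow> (nat \<Rightarrow> real) \<Rightarrow> ((nat \<Rightarrow> real) \<Rightarrow> complex) set"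
  where "GS_space b d s \<sigma> =
    {f. if b then \<exists>h>0. \<exists>C. gs_bounded d s \<sigma> h C f else \<forall>h>0. \<exists>C. gs_bounded d s \<sigma> h C f}"

definition op_bounded ::
    "bool \<Rightarrow> nat \<Rightarrow> (nat \<Rightarrow> real) \<Rightarrow> (nat \<Rightarrow> real) \<Rightarrow> real \<Rightarrow> real \<Rightarrow>
     (((nat \<Rightarrow> real) \<Rightarrow> complex) \<Rightarrow> complex) \<Rightarrow> bool"
  where "op_bounded m d s \<sigma> h K u \<longleftrightarrow>
    K \<ge> 0 \<and> (\<forall>f\<in>GS_space m d s \<sigma>. \<forall>C. gs_bounded d s \<sigma> h C f \<longrightarrow> cmod (u f) \<le> K * C)"

definition linear_on_space :: "('a \<Rightarrow> complex) set \<Rightarrow> (('a \<Rightarrow> complex) \<Rightarrow> complex) \<Rightarrow> bool"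
  where "linear_on_space V u \<longleftrightarrow>
    (\<forall>f\<in>V. \<forall>g\<in>V. u (\<lambda>x. f x + g x) = u f + u g) \<and> (\<forall>c. \<forall>f\<in>V. u (\<lambda>x. c * f x) = c * u f)"

text \<open>
  The dual spaces without reference to topologies; the equivalence is shown below for each kind.
\<close>

definition GS_functional ::
    "bool \<Rightarrow> nat \<Rightarrow> (nat \<Rightarrow> real) \<Rightarrow> (nat \<Rightarrow> real) \<Rightarrow> (((nat \<Rightarrow> real) \<Rightarrow> complex) \<Rightarrow> complex) \<Rightarrow> bool"
  where "GS_functional b d s \<sigma> u \<longleftrightarrow> linear_on_space (GS_space b d s \<sigma>) u \<and>
    (if b then \<forall>h>0. \<exists>K. op_bounded b d s \<sigma> h K u
     else \<exists>h>0. \<exists>K. op_bounded b d s \<sigma> h K u)"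

lemma op_boundedD:
  "op_bounded m d s \<sigma> h K u \<Longrightarrow> f \<in> GS_space m d s \<sigma> \<Longrightarrow> gs_bounded d s \<sigma> h C f \<Longrightarrow> cmod (u f) \<le> K * C"
  by (simp add: op_bounded_def)

lemma op_bounded_antimono:
  assumes "op_bounded m d s \<sigma> h K u" "0 < h'" "h' \<le> h"
  shows "op_bounded m d s \<sigma> h' K u"
  using assms gs_bounded_mono[OF _ assms(2,3) order_refl] unfolding op_bounded_def by blast

lemma GS_space_add: "f \<in> GS_space b d s \<sigma> \<Longrightarrow> g \<in> GS_space b d s \<sigma> \<Longrightarrow> (\<lambda>x. f x + g x) \<in> GS_space b d s \<sigma>"
proof (cases b)
  case True
  assume "f \<in> GS_space b d s \<sigma>" "g \<in> GS_space b d s \<sigma>"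
  then obtain h1 h2 C1 C2 where *: "h1 > 0" "h2 > 0" "gs_bounded d s \<sigma> h1 C1 f" "gs_bounded d s \<sigma> h2 C2 g"
    using True by (auto simp: GS_space_def)
  then have "gs_bounded d s \<sigma> (max h1 h2) C1 f" "gs_bounded d s \<sigma> (max h1 h2) C2 g"
    by (auto intro: gs_bounded_mono)
  with *(1) show ?thesis
    using True gs_bounded_add unfolding GS_space_def by (simp, metis max.strict_coboundedI1)
next
  case False
  assume "f \<in> GS_space b d s \<sigma>" "g \<in> GS_space b d s \<sigma>"
  then show ?thesis using False gs_bounded_add unfolding GS_space_def by (simp, metis)
qed

lemma GS_space_mult: "f \<in> GS_space b d s \<sigma> \<Longrightarrow> (\<lambda>x. c * f x) \<in> GS_space b d s \<sigma>"
  using gs_bounded_mult unfolding GS_space_def by (cases b) (simp_all, metis+)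

lemma GS_space_diff:
  "f \<in> GS_space b d s \<sigma> \<Longrightarrow> g \<in> GS_space b d s \<sigma> \<Longrightarrow> (\<lambda>x. f x - g x) \<in> GS_space b d s \<sigma>"
  using GS_space_add[OF _ GS_space_mult[of g b d s \<sigma> "-1"], of f] by simp

lemma GS_space_zero: "(\<lambda>_. 0) \<in> GS_space b d s \<sigma>"
proof -
  have "\<exists>C. gs_bounded d s \<sigma> h C (\<lambda>_. 0)" for h using gs_bounded_zero by blast
  then show ?thesis using gt_ex[of "0::real"] by (auto simp: GS_space_def)
qed

lemma GS_space_sum:
  "finite I \<Longrightarrow> (\<And>k. k \<in> I \<Longrightarrow> f k \<in> GS_space b d s \<sigma>) \<Longrightarrow> (\<lambda>x. \<Sum>k\<in>I. f k x) \<in> GS_space b d s \<sigma>"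
  by (induction I rule: finite_induct) (auto intro: GS_space_zero GS_space_add)

lemma linear_add: "linear_on_space V u \<Longrightarrow> f \<in> V \<Longrightarrow> g \<in> V \<Longrightarrow> u (\<lambda>x. f x + g x) = u f + u g"
  by (simp add: linear_on_space_def)

lemma linear_mult: "linear_on_space V u \<Longrightarrow> f \<in> V \<Longrightarrow> u (\<lambda>x. c * f x) = c * u f"
  by (simp add: linear_on_space_def)

lemma linear_diff:
  assumes "linear_on_space (GS_space b d s \<sigma>) u" "f \<in> GS_space b d s \<sigma>" "g \<in> GS_space b d s \<sigma>"
  shows "u (\<lambda>x. f x - g x) = u f - u g"
  using linear_add[OF assms(1,2) GS_space_mult[OF assms(3), of "-1"]]
    linear_mult[OF assms(1,3), of "-1"] by simp

lemma linear_zero: "linear_on_space (GS_space b d s \<sigma>) u \<Longrightarrow> u (\<lambda>_. 0) = 0"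
  using linear_mult[OF _ GS_space_zero, of b d s \<sigma> u 0] by simp

lemma linear_sum:
  assumes "linear_on_space (GS_space b d s \<sigma>) u" "finite I" "\<And>k. k \<in> I \<Longrightarrow> f k \<in> GS_space b d s \<sigma>"
  shows "u (\<lambda>x. \<Sum>k\<in>I. f k x) = (\<Sum>k\<in>I. u (f k))"
  using assms(2,3)
  by (induction I rule: finite_induct)
     (auto simp: linear_zero[OF assms(1)] linear_add[OF assms(1)] GS_space_sum)

lemma op_bounded_from_unit_ball:
  assumes u: "linear_on_space (GS_space b d s \<sigma>) u" and "h > 0" "\<epsilon> > 0"
    and ball: "\<And>f. f \<in> GS_space b d s \<sigma> \<Longrightarrow> gs_bounded d s \<sigma> h \<epsilon> f \<Longrightarrow> cmod (u f) \<le> 1"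
  shows "op_bounded b d s \<sigma> h (1 / \<epsilon>) u"
  unfolding op_bounded_def
proof (intro conjI ballI allI impI)
  fix f C assume f: "f \<in> GS_space b d s \<sigma>" "gs_bounded d s \<sigma> h C f"
  have C: "C \<ge> 0" using gs_bounded_nonneg[OF f(2)] .
  show "cmod (u f) \<le> 1 / \<epsilon> * C"
  proof (rule field_le_epsilon)
    fix e :: real assume "e > 0"
    \<comment> \<open>scales \<open>f\<close> into the ball; the term with \<open>e\<close> covers the case \<open>C = 0\<close>\<close>
    define c where "c = \<epsilon> / (C + \<epsilon> * e)"
    have c: "c > 0" using \<open>\<epsilon> > 0\<close> \<open>e > 0\<close> C by (simp add: c_def add_nonneg_pos)
    have "c * C \<le> \<epsilon>"
      using C \<open>\<epsilon> > 0\<close> \<open>e > 0\<close> by (simp add: c_def divide_simps add_nonneg_pos)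
    then have "cmod (of_real c) * C \<le> \<epsilon>" using c by simp
    then have "gs_bounded d s \<sigma> h \<epsilon> (\<lambda>x. of_real c * f x)"
      using gs_bounded_mono[OF gs_bounded_mult[OF f(2)] \<open>h > 0\<close> order_refl] by blast
    then have "cmod (u (\<lambda>x. of_real c * f x)) \<le> 1"
      by (intro ball GS_space_mult f)
    then have "c * cmod (u f) \<le> 1" using c by (simp add: linear_mult[OF u f(1)] norm_mult)
    then have "cmod (u f) \<le> 1 / c" using c by (simp add: field_simps)
    also have "1 / c = 1 / \<epsilon> * C + e" using \<open>\<epsilon> > 0\<close> by (simp add: c_def field_simps)
    finally show "cmod (u f) \<le> 1 / \<epsilon> * C + e" .
  qed
qed (use \<open>\<epsilon> > 0\<close> in auto)

context gs_weights
begin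

lemma GS_S_eq: "GS_S ds ss \<sigma>s = GS_space True d s \<sigma>"
  unfolding GS_S_def GS_space_def using GS_h_iff by auto

lemma GS_Sigma_eq: "GS_Sigma ds ss \<sigma>s = GS_space False d s \<sigma>"
  unfolding GS_Sigma_def GS_space_def using GS_h_iff by auto

text \<open>
  A functional that is bounded on every step is continuous for the inductive limit, since the
  topology that it pulls back from the complex plane is one of the locally convex topologies
  whose supremum is taken.
\<close>

lemma pullback_in_inductive_system:
  assumes u: "GS_functional True d s \<sigma> u"
  defines "T \<equiv> pullback_topology (GS_S ds ss \<sigma>s) u euclidean"
  shows "topspace T = (\<Union>h\<in>{0<..}. topspace (GS_h_top ds ss \<sigma>s h))"
    and "locally_convex_topology T"
    and "\<forall>h\<in>{0<..}. continuous_map (GS_h_top ds ss \<sigma>s h) T (\<lambda>f. f)"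
proof -
  let ?V = "GS_S ds ss \<sigma>s"
  have lin: "linear_on_space ?V u" using u by (simp add: GS_functional_def GS_S_eq)
  have top: "topspace T = ?V" by (simp add: T_def topspace_pullback_topology)
  then show "topspace T = (\<Union>h\<in>{0<..}. topspace (GS_h_top ds ss \<sigma>s h))"
    by (simp add: topspace_GS_h_top GS_S_def)
  have cu: "continuous_map T euclidean u"
    using continuous_map_pullback[of euclidean euclidean id ?V u] by (simp add: T_def)
  have add: "continuous_map (prod_topology T T) T (\<lambda>(f, g). \<lambda>x. f x + g x)"
    unfolding T_def
  proof (rule continuous_map_pullback', fold T_def)
    have "continuous_map (prod_topology T T) euclidean (\<lambda>p. u (fst p) + u (snd p))"
      by (intro continuous_map_add continuous_map_compose[OF continuous_map_fst cu, unfolded o_def]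
            continuous_map_compose[OF continuous_map_snd cu, unfolded o_def])
    then show "continuous_map (prod_topology T T) euclidean (u \<circ> (\<lambda>(f, g). \<lambda>x. f x + g x))"
      by (rule continuous_map_eq) (auto simp: top linear_add[OF lin])
    show "topspace (prod_topology T T) \<subseteq> (\<lambda>(f, g). \<lambda>x. f x + g x) -` ?V"
      using GS_space_add by (auto simp: top GS_S_eq)
  qed
  have mult: "continuous_map (prod_topology euclidean T) T (\<lambda>(c::complex, f). \<lambda>x. c * f x)"
    unfolding T_def
  proof (rule continuous_map_pullback', fold T_def)
    have "continuous_map (prod_topology euclidean T) euclidean (\<lambda>p. fst p * u (snd p))"
      using continuous_map_fst[of euclidean T] continuous_map_compose[OF continuous_map_snd cu, of euclidean]
      unfolding continuous_map_atin o_def by (auto intro!: tendsto_mult)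
    then show "continuous_map (prod_topology euclidean T) euclidean (u \<circ> (\<lambda>(c::complex, f). \<lambda>x. c * f x))"
      by (rule continuous_map_eq) (auto simp: top linear_mult[OF lin])
    show "topspace (prod_topology euclidean T) \<subseteq> (\<lambda>(c::complex, f). \<lambda>x. c * f x) -` ?V"
      using GS_space_mult by (auto simp: top GS_S_eq)
  qed
  have convex: "\<exists>W. openin T W \<and> (\<lambda>_. 0) \<in> W \<and> W \<subseteq> U \<and>
        (\<forall>f\<in>W. \<forall>g\<in>W. \<forall>t\<in>{0..1::real}. (\<lambda>x. of_real t * f x + of_real (1 - t) * g x) \<in> W)"
    if U: "openin T U" "(\<lambda>_. 0) \<in> U" for U
  proof -
    obtain O' where O': "open O'" "U = u -` O' \<inter> ?V"
      using U(1) unfolding T_def openin_pullback_topology by auto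
    have "0 \<in> O'" using U(2) O' linear_zero[OF lin[unfolded GS_S_eq]] by auto
    then obtain e where e: "e > 0" "ball 0 e \<subseteq> O'" using O' openE by blast
    have "(\<lambda>x. of_real t * f x + of_real (1 - t) * g x) \<in> u -` ball 0 e \<inter> ?V"
      if f: "f \<in> u -` ball 0 e \<inter> ?V" and g: "g \<in> u -` ball 0 e \<inter> ?V" and t: "t \<in> {0..1::real}" for f g t
    proof -
      have in_V: "(\<lambda>x. of_real t * f x) \<in> ?V" "(\<lambda>x. of_real (1 - t) * g x) \<in> ?V"
        using f g GS_space_mult by (auto simp: GS_S_eq simp del: of_real_diff)
      have "u (\<lambda>x. of_real t * f x + of_real (1 - t) * g x) = t *\<^sub>R u f + (1 - t) *\<^sub>R u g"
        using f g by (simp add: linear_add[OF lin in_V] linear_mult[OF lin] scaleR_conv_of_real del: of_real_diff)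
      also have "\<dots> \<in> ball 0 e"
        using convexD[OF convex_ball, of "u f" 0 e "u g" t "1 - t"] f g t by auto
      finally show ?thesis using GS_space_add in_V by (auto simp: GS_S_eq)
    qed
    moreover have "openin T (u -` ball 0 e \<inter> ?V)"
      unfolding T_def openin_pullback_topology by (auto intro!: exI[of _ "ball 0 e"])
    moreover have "(\<lambda>_. 0) \<in> u -` ball 0 e \<inter> ?V"
      using e linear_zero[OF lin[unfolded GS_S_eq]] GS_space_zero by (auto simp: GS_S_eq)
    ultimately show ?thesis using e O'(2) by (intro exI[of _ "u -` ball 0 e \<inter> ?V"]) blast
  qed
  show "locally_convex_topology T"
    unfolding locally_convex_topology_def using add mult convex by blast
  show "\<forall>h\<in>{0<..}. continuous_map (GS_h_top ds ss \<sigma>s h) T (\<lambda>f. f)"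
  proof
    fix h :: real assume "h \<in> {0<..}"
    then have h: "h > 0" by simp
    have sub: "GS_h ds ss \<sigma>s h \<subseteq> ?V" using h by (auto simp: GS_S_def)
    obtain K where K: "op_bounded True d s \<sigma> h K u"
      using u h unfolding GS_functional_def GS_S_eq by auto
    show "continuous_map (GS_h_top ds ss \<sigma>s h) T (\<lambda>f. f)"
      unfolding T_def
    proof (rule continuous_map_pullback')
      show "topspace (GS_h_top ds ss \<sigma>s h) \<subseteq> (\<lambda>f. f) -` ?V" using sub by (auto simp: topspace_GS_h_top)
      show "continuous_map (GS_h_top ds ss \<sigma>s h) euclidean (u \<circ> (\<lambda>f. f))"
        unfolding continuous_map topspace_GS_h_top
      proof (intro conjI allI impI)
        fix U :: "complex set" assume "openin euclidean U"
        then have "open U" by (simp only: open_openin)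
        show "openin (GS_h_top ds ss \<sigma>s h) {f \<in> GS_h ds ss \<sigma>s h. (u \<circ> (\<lambda>f. f)) f \<in> U}"
          unfolding openin_GS_h_top[OF h]
        proof (intro conjI ballI)
          fix f assume f: "f \<in> {f \<in> GS_h ds ss \<sigma>s h. (u \<circ> (\<lambda>f. f)) f \<in> U}"
          then have "u f \<in> U" by simp
          with \<open>open U\<close> obtain e where e: "e > 0" "ball (u f) e \<subseteq> U" by (rule openE)
          have K0: "K \<ge> 0" using K by (simp add: op_bounded_def)
          show "\<exists>\<epsilon>>0. \<forall>g\<in>GS_h ds ss \<sigma>s h. \<forall>C<\<epsilon>. gs_bounded d s \<sigma> h C (\<lambda>x. g x - f x) \<longrightarrow>
              g \<in> {f \<in> GS_h ds ss \<sigma>s h. (u \<circ> (\<lambda>f. f)) f \<in> U}"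
          proof (intro exI[of _ "e / (K + 1)"] conjI ballI allI impI)
            show "e / (K + 1) > 0" using e K0 by simp
            fix g C assume g: "g \<in> GS_h ds ss \<sigma>s h" "C < e / (K + 1)" "gs_bounded d s \<sigma> h C (\<lambda>x. g x - f x)"
            have fg: "f \<in> GS_space True d s \<sigma>" "g \<in> GS_space True d s \<sigma>"
              using f g(1) sub by (auto simp: GS_S_eq)
            have "cmod (u g - u f) = cmod (u (\<lambda>x. g x - f x))"
              using lin fg by (simp add: linear_diff[of True d s \<sigma>] GS_S_eq)
            also have "\<dots> \<le> K * C"
              using fg GS_space_diff by (intro op_boundedD[OF K _ g(3)]) (auto simp: GS_S_eq)
            also have "\<dots> < e"
            proof -
              have "C * (K + 1) < e" using g(2) K0 by (simp add: pos_less_divide_eq)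
              moreover have "C \<ge> 0" using gs_bounded_nonneg[OF g(3)] .
              ultimately show ?thesis by (simp add: algebra_simps)
            qed
            finally have "u g \<in> ball (u f) e" by (simp add: dist_norm norm_minus_commute)
            then show "g \<in> {f \<in> GS_h ds ss \<sigma>s h. (u \<circ> (\<lambda>f. f)) f \<in> U}" using e g(1) by auto
          qed
        qed auto
      qed auto
    qed
  qed
qed

lemma GS_functional_zero: "GS_functional b d s \<sigma> (\<lambda>_. 0)"
proof -
  have "op_bounded m d s \<sigma> h 0 (\<lambda>_. 0)" for m h by (simp add: op_bounded_def)
  then have "\<exists>K. op_bounded m d s \<sigma> h K (\<lambda>_. 0)" for m h by blast
  then show ?thesis unfolding GS_functional_def linear_on_space_def using gt_ex[of "0::real"] by auto
qed

lemma topspace_GS_S_top: "topspace (GS_S_top ds ss \<sigma>s) = GS_S ds ss \<sigma>s"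
proof -
  have V: "GS_S ds ss \<sigma>s = (\<Union>h\<in>{0<..}. topspace (GS_h_top ds ss \<sigma>s h))"
    by (simp add: GS_S_def topspace_GS_h_top)
  let ?T = "pullback_topology (GS_S ds ss \<sigma>s) (\<lambda>_. 0 :: complex) euclidean"
  let ?\<U> = "{U. \<exists>T. topspace T = (\<Union>h\<in>{0<..}. topspace (GS_h_top ds ss \<sigma>s h)) \<and>
          locally_convex_topology T \<and>
          (\<forall>h\<in>{0<..}. continuous_map (GS_h_top ds ss \<sigma>s h) T (\<lambda>f. f)) \<and> openin T U}"
  have T: "topspace ?T = (\<Union>h\<in>{0<..}. topspace (GS_h_top ds ss \<sigma>s h))" "locally_convex_topology ?T"
    "\<forall>h\<in>{0<..}. continuous_map (GS_h_top ds ss \<sigma>s h) ?T (\<lambda>f. f)" "openin ?T (topspace ?T)"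
    using pullback_in_inductive_system[OF GS_functional_zero[of True]] openin_topspace[of ?T]
    by simp_all
  have "topspace ?T \<in> ?\<U>" using T by blast
  moreover have "U \<subseteq> GS_S ds ss \<sigma>s" if U: "U \<in> ?\<U>" for U
  proof -
    obtain T where "topspace T = GS_S ds ss \<sigma>s" "openin T U" using U unfolding V by blast
    then show ?thesis using openin_subset by metis
  qed
  moreover have "topspace ?T = GS_S ds ss \<sigma>s" using T(1) by (simp only: V)
  ultimately have "\<Union> ?\<U> = GS_S ds ss \<sigma>s"
    by (metis (no_types, lifting) Sup_least Sup_upper subset_antisym)
  then show ?thesis
    unfolding GS_S_top_def inductive_limit_topology_def topology_generated_by_topspace .
qed

text \<open>
  The inclusions of the steps are continuous by construction, so a continuous functional is bounded on
  a ball of each norm. The converse is the lemma on pulled back topologies.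
\<close>

lemma GS_S_dual_iff:
  "u \<in> GS_S_dual ds ss \<sigma>s \<longleftrightarrow> u \<in> GS_S ds ss \<sigma>s \<rightarrow>\<^sub>E UNIV \<and> GS_functional True d s \<sigma> u"
proof -
  let ?V = "GS_S ds ss \<sigma>s"
  have "continuous_map (GS_S_top ds ss \<sigma>s) euclidean u \<longleftrightarrow>
      (\<forall>h>0. \<exists>K. op_bounded True d s \<sigma> h K u)" if lin: "linear_on_space ?V u"
  proof
    assume cont: "continuous_map (GS_S_top ds ss \<sigma>s) euclidean u"
    show "\<forall>h>0. \<exists>K. op_bounded True d s \<sigma> h K u"
    proof (intro allI impI)
      fix h :: real assume h: "h > 0"
      have sub: "GS_h ds ss \<sigma>s h \<subseteq> ?V" using h by (auto simp: GS_S_def)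
      have "continuous_map (GS_h_top ds ss \<sigma>s h) (GS_S_top ds ss \<sigma>s) (\<lambda>f. f)"
        unfolding GS_S_top_def inductive_limit_topology_def continuous_on_generated_topo_iff
      proof (intro conjI allI impI)
        fix U assume "U \<in> {U. \<exists>T. topspace T = (\<Union>h\<in>{0<..}. topspace (GS_h_top ds ss \<sigma>s h)) \<and>
          locally_convex_topology T \<and>
          (\<forall>h\<in>{0<..}. continuous_map (GS_h_top ds ss \<sigma>s h) T (\<lambda>f. f)) \<and> openin T U}"
        then obtain T where "continuous_map (GS_h_top ds ss \<sigma>s h) T (\<lambda>f. f)" "openin T U"
          using h by auto
        then have "openin (GS_h_top ds ss \<sigma>s h) {f \<in> topspace (GS_h_top ds ss \<sigma>s h). f \<in> U}"
          by (rule openin_continuous_map_preimage)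
        then show "openin (GS_h_top ds ss \<sigma>s h) ((\<lambda>f. f) -` U \<inter> topspace (GS_h_top ds ss \<sigma>s h))"
          by (simp add: Int_def conj_commute vimage_def)
      next
        show "(\<lambda>f. f) ` topspace (GS_h_top ds ss \<sigma>s h) \<subseteq>
          \<Union> {U. \<exists>T. topspace T = (\<Union>h\<in>{0<..}. topspace (GS_h_top ds ss \<sigma>s h)) \<and>
          locally_convex_topology T \<and>
          (\<forall>h\<in>{0<..}. continuous_map (GS_h_top ds ss \<sigma>s h) T (\<lambda>f. f)) \<and> openin T U}"
          using topspace_GS_S_top sub
          unfolding GS_S_top_def inductive_limit_topology_def topology_generated_by_topspace
            topspace_GS_h_top by simp
      qed
      from continuous_map_compose[OF this cont]
      have "continuous_map (GS_h_top ds ss \<sigma>s h) euclidean u" by (simp add: o_def)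
      from openin_continuous_map_preimage[OF this, of "ball 0 1"]
      have op: "openin (GS_h_top ds ss \<sigma>s h) {f \<in> GS_h ds ss \<sigma>s h. u f \<in> ball 0 1}"
        by (simp add: topspace_GS_h_top)
      have mem: "(\<lambda>_. 0) \<in> {f \<in> GS_h ds ss \<sigma>s h. u f \<in> ball 0 1}"
        using linear_zero[OF lin[unfolded GS_S_eq]] gs_bounded_zero[of d s \<sigma> h] GS_h_iff[OF h] by auto
      have "\<exists>\<epsilon>>0. \<forall>g\<in>GS_h ds ss \<sigma>s h. \<forall>C<\<epsilon>. gs_bounded d s \<sigma> h C (\<lambda>x. g x - 0) \<longrightarrow>
          g \<in> {f \<in> GS_h ds ss \<sigma>s h. u f \<in> ball 0 1}"
        using bspec[OF conjunct2[OF op[unfolded openin_GS_h_top[OF h]]] mem] .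
      then obtain \<epsilon> where \<epsilon>: "\<epsilon> > 0"
        "\<And>g C. g \<in> GS_h ds ss \<sigma>s h \<Longrightarrow> C < \<epsilon> \<Longrightarrow> gs_bounded d s \<sigma> h C (\<lambda>x. g x - 0) \<Longrightarrow> u g \<in> ball 0 1"
        by blast
      have "op_bounded True d s \<sigma> h (1 / (\<epsilon>/2)) u"
        unfolding GS_S_eq
      proof (rule op_bounded_from_unit_ball)
        fix f assume "gs_bounded d s \<sigma> h (\<epsilon>/2) f"
        moreover from this have "f \<in> GS_h ds ss \<sigma>s h" using GS_h_iff[OF h] by blast
        ultimately show "cmod (u f) \<le> 1" using \<epsilon>(2)[of f "\<epsilon>/2"] \<epsilon>(1) by auto
      qed (use lin h \<epsilon> in \<open>auto simp: GS_S_eq\<close>)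
      then show "\<exists>K. op_bounded True d s \<sigma> h K u" by blast
    qed
  next
    assume "\<forall>h>0. \<exists>K. op_bounded True d s \<sigma> h K u"
    then have u: "GS_functional True d s \<sigma> u"
      using lin unfolding GS_functional_def GS_S_eq by simp
    show "continuous_map (GS_S_top ds ss \<sigma>s) euclidean u"
      unfolding continuous_map topspace_GS_S_top
    proof (intro conjI allI impI)
      fix U :: "complex set" assume "openin euclidean U"
      then have "openin (pullback_topology ?V u euclidean) {f \<in> ?V. u f \<in> U}"
        unfolding openin_pullback_topology by blast
      then show "openin (GS_S_top ds ss \<sigma>s) {f \<in> ?V. u f \<in> U}"
        unfolding GS_S_top_def inductive_limit_topology_def
        using pullback_in_inductive_system[OF u] by (intro topology_generated_by_Basis) blast
    qed auto
  qed
  then show ?thesis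
    unfolding GS_S_dual_def topological_dual_def GS_functional_def linear_on_space_def GS_S_eq by auto
qed

lemma topspace_GS_Sigma_top: "topspace (GS_Sigma_top ds ss \<sigma>s) = GS_Sigma ds ss \<sigma>s"
proof -
  let ?\<U> = "{GS_Sigma ds ss \<sigma>s \<inter> U |h U. h \<in> {0<..} \<and> openin (GS_h_top ds ss \<sigma>s h) U}"
  have "GS_Sigma ds ss \<sigma>s = GS_Sigma ds ss \<sigma>s \<inter> GS_h ds ss \<sigma>s 1"
    by (auto simp: GS_Sigma_def)
  moreover have "openin (GS_h_top ds ss \<sigma>s 1) (GS_h ds ss \<sigma>s 1)"
    using openin_topspace[of "GS_h_top ds ss \<sigma>s 1"] by (simp add: topspace_GS_h_top)
  ultimately have "GS_Sigma ds ss \<sigma>s \<in> ?\<U>"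
    by (intro CollectI exI[of _ "1::real"] exI[of _ "GS_h ds ss \<sigma>s 1"] conjI) auto
  then have "\<Union> ?\<U> = GS_Sigma ds ss \<sigma>s" by blast
  then show ?thesis
    unfolding GS_Sigma_top_def projective_limit_topology_def topology_generated_by_topspace
      topspace_GS_h_top GS_Sigma_def[symmetric] .
qed

lemma GS_Sigma_sub: "h > 0 \<Longrightarrow> GS_Sigma ds ss \<sigma>s \<subseteq> GS_h ds ss \<sigma>s h"
  by (auto simp: GS_Sigma_def)

text \<open>
  The norms increase as \<open>h\<close> decreases, so finitely many of them are dominated by one, and the
  neighbourhoods of the projective limit are described by single norms.
\<close>

lemma openin_GS_Sigma_top_ball:
  assumes "openin (GS_Sigma_top ds ss \<sigma>s) W" "f \<in> W"
  shows "\<exists>h>0. \<exists>\<epsilon>>0. \<forall>g\<in>GS_Sigma ds ss \<sigma>s. gs_bounded d s \<sigma> h \<epsilon> (\<lambda>x. g x - f x) \<longrightarrow> g \<in> W"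
proof -
  have "generate_topology_on {GS_Sigma ds ss \<sigma>s \<inter> U |h U. h \<in> {0<..} \<and> openin (GS_h_top ds ss \<sigma>s h) U} W"
    using assms(1) unfolding GS_Sigma_top_def projective_limit_topology_def topspace_GS_h_top
      GS_Sigma_def[symmetric] by (rule openin_topology_generated_by)
  then show ?thesis using assms(2)
  proof (induction W)
    case (Int a b)
    have "f \<in> a" "f \<in> b" using Int.prems by auto
    from Int.IH(1)[OF this(1)] Int.IH(2)[OF this(2)] obtain h1 e1 h2 e2 where *: "h1 > 0" "e1 > 0" "h2 > 0" "e2 > 0"
      "\<And>g. g\<in>GS_Sigma ds ss \<sigma>s \<Longrightarrow> gs_bounded d s \<sigma> h1 e1 (\<lambda>x. g x - f x) \<Longrightarrow> g \<in> a"
      "\<And>g. g\<in>GS_Sigma ds ss \<sigma>s \<Longrightarrow> gs_bounded d s \<sigma> h2 e2 (\<lambda>x. g x - f x) \<Longrightarrow> g \<in> b"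
      by blast
    have "g \<in> a \<inter> b" if "g \<in> GS_Sigma ds ss \<sigma>s" "gs_bounded d s \<sigma> (min h1 h2) (min e1 e2) (\<lambda>x. g x - f x)" for g
      using *(5)[OF that(1) gs_bounded_mono[OF that(2)]] *(6)[OF that(1) gs_bounded_mono[OF that(2)]] * by auto
    then show ?case using * by (intro exI[of _ "min h1 h2"] conjI exI[of _ "min e1 e2"]) auto
  next
    case (UN K)
    then show ?case by blast
  next
    case (Basis S)
    then obtain h U where h: "h > 0" "openin (GS_h_top ds ss \<sigma>s h) U" "S = GS_Sigma ds ss \<sigma>s \<inter> U"
      by auto
    then obtain \<epsilon> where "\<epsilon> > 0"
      "\<And>g C. g \<in> GS_h ds ss \<sigma>s h \<Longrightarrow> C < \<epsilon> \<Longrightarrow> gs_bounded d s \<sigma> h C (\<lambda>x. g x - f x) \<Longrightarrow> g \<in> U"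
      using Basis(2) unfolding openin_GS_h_top[OF h(1)] by auto
    note \<epsilon> = this
    have "g \<in> S" if "g \<in> GS_Sigma ds ss \<sigma>s" "gs_bounded d s \<sigma> h (\<epsilon>/2) (\<lambda>x. g x - f x)" for g
      using \<epsilon>(2)[OF _ _ that(2)] \<epsilon>(1) that(1) h(3) GS_Sigma_sub[OF h(1)] by auto
    moreover have "\<epsilon>/2 > 0" using \<epsilon>(1) by simp
    ultimately show ?case using h(1) by blast
  qed auto
qed

text \<open>
  A neighbourhood of zero for the projective limit contains a ball of one of the norms, and conversely
  each norm is continuous.
\<close>

lemma GS_Sigma_dual_iff:
  "u \<in> GS_Sigma_dual ds ss \<sigma>s \<longleftrightarrow> u \<in> GS_Sigma ds ss \<sigma>s \<rightarrow>\<^sub>E UNIV \<and> GS_functional False d s \<sigma> u"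
proof -
  let ?V = "GS_Sigma ds ss \<sigma>s"
  have "continuous_map (GS_Sigma_top ds ss \<sigma>s) euclidean u \<longleftrightarrow>
      (\<exists>h>0. \<exists>K. op_bounded False d s \<sigma> h K u)" if lin: "linear_on_space ?V u"
  proof
    assume cont: "continuous_map (GS_Sigma_top ds ss \<sigma>s) euclidean u"
    from openin_continuous_map_preimage[OF this, of "ball 0 1"]
    have "openin (GS_Sigma_top ds ss \<sigma>s) {f \<in> ?V. u f \<in> ball 0 1}"
      by (simp add: topspace_GS_Sigma_top)
    moreover have "(\<lambda>_. 0) \<in> {f \<in> ?V. u f \<in> ball 0 1}"
      using linear_zero[OF lin[unfolded GS_Sigma_eq]] GS_space_zero by (auto simp: GS_Sigma_eq)
    ultimately obtain h \<epsilon> where h: "h > 0" "\<epsilon> > 0"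
      "\<forall>g\<in>?V. gs_bounded d s \<sigma> h \<epsilon> (\<lambda>x. g x - 0) \<longrightarrow> g \<in> {f \<in> ?V. u f \<in> ball 0 1}"
      using openin_GS_Sigma_top_ball by meson
    have "op_bounded False d s \<sigma> h (1 / \<epsilon>) u"
      unfolding GS_Sigma_eq
      by (rule op_bounded_from_unit_ball) (use lin h in \<open>auto simp: GS_Sigma_eq\<close>)
    then show "\<exists>h>0. \<exists>K. op_bounded False d s \<sigma> h K u" using h by blast
  next
    assume "\<exists>h>0. \<exists>K. op_bounded False d s \<sigma> h K u"
    then obtain h K where h: "h > 0" and K: "op_bounded False d s \<sigma> h K u" by blast
    have K0: "K \<ge> 0" using K by (simp add: op_bounded_def)
    show "continuous_map (GS_Sigma_top ds ss \<sigma>s) euclidean u"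
      unfolding continuous_map topspace_GS_Sigma_top
    proof (intro conjI allI impI)
      fix U :: "complex set" assume "openin euclidean U"
      then have "open U" by (simp only: open_openin)
      \<comment> \<open>The functional need not extend to the step, so the preimage is written as the trace of a
        union of balls centred in the space.\<close>
      define W where "W = {g \<in> GS_h ds ss \<sigma>s h. \<exists>f\<in>?V. \<exists>\<epsilon>>0. (\<forall>z. cmod (z - u f) \<le> K * \<epsilon> \<longrightarrow> z \<in> U) \<and>
        (\<exists>C<\<epsilon>. gs_bounded d s \<sigma> h C (\<lambda>x. g x - f x))}"
      have "openin (GS_h_top ds ss \<sigma>s h) W"
        unfolding openin_GS_h_top[OF h]
      proof (intro conjI ballI)
        fix g assume "g \<in> W"
        then obtain f \<epsilon> C where f: "f \<in> ?V" "\<epsilon> > 0" "\<forall>z. cmod (z - u f) \<le> K * \<epsilon> \<longrightarrow> z \<in> U"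
          "C < \<epsilon>" "gs_bounded d s \<sigma> h C (\<lambda>x. g x - f x)"
          unfolding W_def by blast
        have "g' \<in> W" if g': "g' \<in> GS_h ds ss \<sigma>s h" "C' < \<epsilon> - C" "gs_bounded d s \<sigma> h C' (\<lambda>x. g' x - g x)" for g' C'
        proof -
          have "gs_bounded d s \<sigma> h (C' + C) (\<lambda>x. g' x - f x)"
            using gs_bounded_add[OF g'(3) f(5)] by simp
          moreover have "C' + C < \<epsilon>" using g' by simp
          ultimately show ?thesis unfolding W_def using g'(1) f by blast
        qed
        then show "\<exists>\<epsilon>>0. \<forall>g'\<in>GS_h ds ss \<sigma>s h. \<forall>C<\<epsilon>. gs_bounded d s \<sigma> h C (\<lambda>x. g' x - g x) \<longrightarrow> g' \<in> W"
          using f(4) by (intro exI[of _ "\<epsilon> - C"]) auto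
      qed (auto simp: W_def)
      moreover have "{f \<in> ?V. u f \<in> U} = ?V \<inter> W"
      proof (intro set_eqI iffI)
        fix f assume f: "f \<in> {f \<in> ?V. u f \<in> U}"
        then have "u f \<in> U" by simp
        with \<open>open U\<close> obtain e where e: "e > 0" "ball (u f) e \<subseteq> U" by (rule openE)
        let ?\<epsilon> = "e / (2 * (K + 1))"
        have "K * ?\<epsilon> < e" using e K0 by (simp add: field_simps add_nonneg_pos)
        then have "\<forall>z. cmod (z - u f) \<le> K * ?\<epsilon> \<longrightarrow> z \<in> U"
          using e(2) by (auto simp: dist_norm norm_minus_commute subset_iff)
        moreover have "?\<epsilon> > 0" using e K0 by simp
        moreover have "gs_bounded d s \<sigma> h 0 (\<lambda>x. f x - f x)" using gs_bounded_zero by simp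
        ultimately show "f \<in> ?V \<inter> W"
          using f GS_Sigma_sub[OF h] unfolding W_def by blast
      next
        fix g assume "g \<in> ?V \<inter> W"
        then obtain f \<epsilon> C where f: "g \<in> ?V" "f \<in> ?V" "\<forall>z. cmod (z - u f) \<le> K * \<epsilon> \<longrightarrow> z \<in> U"
          "C < \<epsilon>" "gs_bounded d s \<sigma> h C (\<lambda>x. g x - f x)"
          unfolding W_def by blast
        have "cmod (u g - u f) = cmod (u (\<lambda>x. g x - f x))"
          using lin f by (simp add: linear_diff[of False d s \<sigma>] GS_Sigma_eq)
        also have "\<dots> \<le> K * C"
          using f GS_space_diff by (intro op_boundedD[OF K _ f(5)]) (auto simp: GS_Sigma_eq)
        also have "\<dots> \<le> K * \<epsilon>" using K0 f(4) by (intro mult_left_mono) auto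
        finally show "g \<in> {f \<in> ?V. u f \<in> U}" using f by simp
      qed
      ultimately show "openin (GS_Sigma_top ds ss \<sigma>s) {f \<in> ?V. u f \<in> U}"
        unfolding GS_Sigma_top_def projective_limit_topology_def topspace_GS_h_top
          GS_Sigma_def[symmetric]
        using h by (intro topology_generated_by_Basis) auto
    qed auto
  qed
  then show ?thesis
    unfolding GS_Sigma_dual_def topological_dual_def GS_functional_def linear_on_space_def GS_Sigma_eq
    by auto
qed

end

section \<open>Applying a functional in one group of variables\<close>

lemma second_order_bound:
  fixes f :: "real \<Rightarrow> complex"
  assumes f: "\<And>t. (f has_vector_derivative f' t) (at t)"
    and f': "\<And>t. (f' has_vector_derivative f'' t) (at t)"
    and B: "\<And>t. cmod (f'' t) \<le> B"
  shows "cmod (f t - f t0 - of_real (t - t0) * f' t0) \<le> B * \<bar>t - t0\<bar>\<^sup>2"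
proof -
  have B0: "B \<ge> 0" using B[of 0] norm_ge_zero order_trans by blast
  have "cmod (f t - f t0 - (t - t0) *\<^sub>R f' t0) \<le> (B * \<bar>t - t0\<bar>) * \<bar>t - t0\<bar>"
  proof (rule vector_mean_value_bound[of "cball t0 \<bar>t - t0\<bar>" f f'])
    fix \<tau> assume \<tau>: "\<tau> \<in> cball t0 \<bar>t - t0\<bar>"
    have "cmod (f' \<tau> - f' t0) \<le> B * \<bar>\<tau> - t0\<bar>"
      using vector_mean_value_bound[of UNIV f' f'' 0 B t0 \<tau>] f' B by simp
    also have "\<dots> \<le> B * \<bar>t - t0\<bar>"
      using \<tau> B0 by (intro mult_left_mono) (auto simp: dist_real_def)
    finally show "cmod (f' \<tau> - f' t0) \<le> B * \<bar>t - t0\<bar>" .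
  qed (auto simp: dist_real_def f)
  then show ?thesis by (simp add: scaleR_conv_of_real power2_eq_square mult.assoc)
qed

lemma has_vector_derivative_quadratic_remainder:
  fixes f :: "real \<Rightarrow> complex"
  assumes "\<And>t. cmod (f t - f t0 - of_real (t - t0) * c) \<le> M * \<bar>t - t0\<bar>\<^sup>2"
  shows "(f has_vector_derivative c) (at t0)"
  unfolding has_vector_derivative_def has_derivative_at
proof (intro conjI bounded_linear_scaleR_left)
  have lim: "((\<lambda>h::real. M * \<bar>h\<bar>) \<longlongrightarrow> 0) (at 0)"
    by (auto intro!: tendsto_eq_intros)
  have "norm (norm (f (t0 + h) - f t0 - h *\<^sub>R c) / norm h) \<le> M * \<bar>h\<bar>" if "h \<noteq> 0" for h
    using assms[of "t0 + h"] that
    by (simp add: scaleR_conv_of_real divide_le_eq power2_eq_square mult.assoc)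
  then show "(\<lambda>h. norm (f (t0 + h) - f t0 - h *\<^sub>R c) / norm h) \<midarrow>0\<rightarrow> 0"
    by (intro Lim_null_comparison[OF _ lim]) (auto simp: eventually_at_filter)
qed

text \<open>
  The coordinates \<open>{..<d}\<close> are split into those satisfying \<open>P\<close>, numbered by \<open>eo\<close>, which are kept,
  and the others, numbered by \<open>ei\<close>, on which a functional acts. Exchanging the roles of the two
  factors of a product is then an interpretation of the same locale.
\<close>

locale splitting =
  fixes a b d :: nat and P :: "nat \<Rightarrow> bool" and eo ei qo qi :: "nat \<Rightarrow> nat"
  assumes eo: "\<And>i. i < a \<Longrightarrow> eo i < d \<and> P (eo i) \<and> qo (eo i) = i"
    and qo: "\<And>j. j < d \<Longrightarrow> P j \<Longrightarrow> qo j < a \<and> eo (qo j) = j"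
    and ei: "\<And>i. i < b \<Longrightarrow> ei i < d \<and> \<not> P (ei i) \<and> qi (ei i) = i"
    and qi: "\<And>j. j < d \<Longrightarrow> \<not> P j \<Longrightarrow> qi j < b \<and> ei (qi j) = j"
begin

definition merge :: "'x \<Rightarrow> (nat \<Rightarrow> 'x) \<Rightarrow> (nat \<Rightarrow> 'x) \<Rightarrow> nat \<Rightarrow> 'x"
  where "merge z x y = (\<lambda>j. if j < d then if P j then x (qo j) else y (qi j) else z)"

lemma merge_Rd [simp]: "merge undefined x y \<in> Rd d"
  by (auto simp: merge_def Rd_def PiE_iff extensional_def)

lemma merge_eo [simp]: "i < a \<Longrightarrow> merge z x y (eo i) = x i"
  and merge_ei [simp]: "i < b \<Longrightarrow> merge z x y (ei i) = y i"
  using eo ei by (auto simp: merge_def)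

lemma merge_upd_eo: "i < a \<Longrightarrow> merge z (x(i := t)) y = (merge z x y)(eo i := t)"
  using eo qo by (auto simp: merge_def fun_eq_iff)

lemma merge_upd_ei: "i < b \<Longrightarrow> merge z x (y(i := t)) = (merge z x y)(ei i := t)"
  using ei qi by (auto simp: merge_def fun_eq_iff)

lemma prod_split:
  fixes F :: "nat \<Rightarrow> 'x::comm_monoid_mult"
  shows "(\<Prod>j<d. F j) = (\<Prod>i<a. F (eo i)) * (\<Prod>i<b. F (ei i))"
proof -
  have o: "inj_on eo {..<a}" and i: "inj_on ei {..<b}"
    using eo ei by (metis inj_on_inverseI lessThan_iff)+
  have "{..<d} = eo ` {..<a} \<union> ei ` {..<b}"
    using eo ei qo qi by (auto simp: image_iff) (metis lessThan_iff)
  moreover have "eo ` {..<a} \<inter> ei ` {..<b} = {}" using eo ei by fastforce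
  ultimately have "(\<Prod>j<d. F j) = (\<Prod>j\<in>eo ` {..<a}. F j) * (\<Prod>j\<in>ei ` {..<b}. F j)"
    by (simp add: prod.union_disjoint)
  then show ?thesis using o i by (simp add: prod.reindex)
qed

lemma monomial_merge:
  "monomial d (merge 0 \<alpha>1 \<alpha>2) (merge undefined x y) = monomial a \<alpha>1 x * monomial b \<alpha>2 y"
  by (simp add: monomial_def prod_split)

lemma weight_merge:
  "weight d s \<sigma> h (merge 0 \<alpha>1 \<alpha>2) (merge 0 \<beta>1 \<beta>2)
    = weight a (s \<circ> eo) (\<sigma> \<circ> eo) h \<alpha>1 \<beta>1 * weight b (s \<circ> ei) (\<sigma> \<circ> ei) h \<alpha>2 \<beta>2"
  by (simp add: weight_def prod_split)

definition slice_family ::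
    "((nat \<Rightarrow> nat) \<Rightarrow> (nat \<Rightarrow> real) \<Rightarrow> complex) \<Rightarrow> (nat \<Rightarrow> real) \<Rightarrow> (nat \<Rightarrow> nat) \<Rightarrow>
     (nat \<Rightarrow> nat) \<Rightarrow> (nat \<Rightarrow> real) \<Rightarrow> complex"
  where "slice_family D x \<beta>1 \<beta>2 = on_Rd b (\<lambda>y. D (merge 0 \<beta>1 \<beta>2) (merge undefined x y))"

lemma smooth_slice_family:
  assumes D: "smooth_family d D"
  shows "smooth_family b (slice_family D x \<beta>1)"
  unfolding smooth_family_def
proof (intro conjI allI impI)
  fix \<beta>2 i y assume i: "i < b" and y: "y \<in> Rd b"
  have "((\<lambda>t. D (merge 0 \<beta>1 \<beta>2) ((merge undefined x y)(ei i := t))) has_vector_derivative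
      D ((merge 0 \<beta>1 \<beta>2)(ei i := Suc (merge 0 \<beta>1 \<beta>2 (ei i)))) ((merge undefined x y)(ei i := y i))) (at (y i))"
    using ei[OF i] by (intro smooth_familyD[OF D]) auto
  then have "((\<lambda>t. D (merge 0 \<beta>1 \<beta>2) (merge undefined x (y(i := t)))) has_vector_derivative
      D (merge 0 \<beta>1 (\<beta>2(i := Suc (\<beta>2 i)))) (merge undefined x (y(i := y i)))) (at (y i))"
    using i by (simp only: merge_upd_ei merge_ei)
  then show "((\<lambda>t. slice_family D x \<beta>1 \<beta>2 (y(i := t))) has_vector_derivative
      slice_family D x \<beta>1 (\<beta>2(i := Suc (\<beta>2 i))) y) (at (y i))"
    using i y by (simp add: slice_family_def on_Rd_def)
qed (simp add: slice_family_def on_Rd_def)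

text \<open>
  The weights are products over the coordinates, so they factor along the splitting: the kept variables
  contribute only a scalar to the norm of the slice.
\<close>

lemma bound_slice_family:
  assumes D: "bound_family d s \<sigma> h C D"
  shows "bound_family b (s \<circ> ei) (\<sigma> \<circ> ei) h (C * weight a (s \<circ> eo) (\<sigma> \<circ> eo) h \<alpha>1 \<beta>1)
    (\<lambda>\<beta>2 y. of_real (monomial a \<alpha>1 x) * slice_family D x \<beta>1 \<beta>2 y)"
  unfolding bound_family_def
proof (intro allI ballI)
  fix \<alpha>2 \<beta>2 y assume y: "y \<in> Rd b"
  have "\<bar>monomial d (merge 0 \<alpha>1 \<alpha>2) (merge undefined x y)\<bar> * cmod (D (merge 0 \<beta>1 \<beta>2) (merge undefined x y))
      \<le> C * weight d s \<sigma> h (merge 0 \<alpha>1 \<alpha>2) (merge 0 \<beta>1 \<beta>2)"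
    by (intro bound_familyD[OF D]) simp
  then show "\<bar>monomial b \<alpha>2 y\<bar> * cmod (of_real (monomial a \<alpha>1 x) * slice_family D x \<beta>1 \<beta>2 y)
      \<le> C * weight a (s \<circ> eo) (\<sigma> \<circ> eo) h \<alpha>1 \<beta>1 * weight b (s \<circ> ei) (\<sigma> \<circ> ei) h \<alpha>2 \<beta>2"
    using y by (simp add: monomial_merge weight_merge slice_family_def on_Rd_def abs_mult norm_mult mult_ac)
qed

lemma gs_bounded_slice_family:
  assumes "smooth_family d D" "bound_family d s \<sigma> h C D"
  shows "gs_bounded b (s \<circ> ei) (\<sigma> \<circ> ei) h (C * weight a (s \<circ> eo) (\<sigma> \<circ> eo) h \<alpha>1 \<beta>1)
    (\<lambda>y. of_real (monomial a \<alpha>1 x) * slice_family D x \<beta>1 (\<lambda>_. 0) y)"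
  by (rule gs_boundedI[OF smooth_family_mult[OF smooth_slice_family[OF assms(1)]] bound_slice_family[OF assms(2)]])
     (rule refl)

lemma slice_family_in_GS_space:
  assumes f: "f \<in> GS_space m d s \<sigma>"
  shows "slice_family (\<lambda>\<beta>. multi_deriv d \<beta> f) x \<beta>1 (\<lambda>_. 0) \<in> GS_space m b (s \<circ> ei) (\<sigma> \<circ> ei)"
proof -
  have "\<exists>C'. gs_bounded b (s \<circ> ei) (\<sigma> \<circ> ei) h C' (slice_family (\<lambda>\<beta>. multi_deriv d \<beta> f) x \<beta>1 (\<lambda>_. 0))"
    if "gs_bounded d s \<sigma> h C f" for h C
    using gs_bounded_slice_family[OF gs_boundedD[OF that], of "\<lambda>_. 0" \<beta>1 x] by auto
  then show ?thesis using f unfolding GS_space_def by (auto split: if_splits)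
qed

text \<open>
  The second-order Taylor remainder of the slices is quadratically small in every norm, so the
  functional may be applied under the derivative.
\<close>

lemma gs_bounded_slice_remainder:
  assumes D: "smooth_family d D" and bd: "bound_family d s \<sigma> h C D" and i: "i < a"
  shows "gs_bounded b (s \<circ> ei) (\<sigma> \<circ> ei) h
    (C * weight a (s \<circ> eo) (\<sigma> \<circ> eo) h (\<lambda>_. 0) (\<beta>1(i := Suc (Suc (\<beta>1 i)))) * \<bar>t - t0\<bar>\<^sup>2)
    (\<lambda>y. slice_family D (x(i := t)) \<beta>1 (\<lambda>_. 0) y - slice_family D (x(i := t0)) \<beta>1 (\<lambda>_. 0) y
      - of_real (t - t0) * slice_family D (x(i := t0)) (\<beta>1(i := Suc (\<beta>1 i))) (\<lambda>_. 0) y)"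
    (is "gs_bounded b ?s ?\<sigma> h (?M * _) _")
proof -
  define R where "R \<beta>2 y = (slice_family D (x(i := t)) \<beta>1 \<beta>2 y + (-1) * slice_family D (x(i := t0)) \<beta>1 \<beta>2 y)
      + (- of_real (t - t0)) * slice_family D (x(i := t0)) (\<beta>1(i := Suc (\<beta>1 i))) \<beta>2 y" for \<beta>2 y
  have "smooth_family b R"
    unfolding R_def by (intro smooth_family_add smooth_family_mult smooth_slice_family D)
  moreover have "bound_family b ?s ?\<sigma> h (?M * \<bar>t - t0\<bar>\<^sup>2) R"
    unfolding bound_family_def
  proof (intro allI ballI)
    fix \<alpha>2 \<beta>2 y assume y: "y \<in> Rd b"
    let ?z = "\<lambda>\<tau>. (merge undefined x y)(eo i := \<tau>)" and ?\<mu> = "complex_of_real (monomial b \<alpha>2 y)"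
    let ?\<gamma> = "\<lambda>k. merge 0 (\<beta>1(i := k)) \<beta>2"
    let ?B = "?M * weight b ?s ?\<sigma> h \<alpha>2 \<beta>2"
    have ei': "eo i < d" using eo[OF i] by simp
    have \<gamma>: "?\<gamma> k = (merge 0 \<beta>1 \<beta>2)(eo i := k)" for k by (rule merge_upd_eo[OF i])
    have der: "((\<lambda>\<tau>. ?\<mu> * D (?\<gamma> k) (?z \<tau>)) has_vector_derivative ?\<mu> * D (?\<gamma> (Suc k)) (?z \<tau>)) (at \<tau>)" for k \<tau>
      using smooth_familyD[OF D ei' merge_Rd, of "?\<gamma> k" x y \<tau>]
      by (intro has_vector_derivative_mult_right) (simp add: \<gamma>)
    have "cmod (?\<mu> * D (?\<gamma> (Suc (Suc (\<beta>1 i)))) (?z \<tau>)) \<le> ?B" for \<tau>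
    proof -
      have "\<bar>monomial d (merge 0 (\<lambda>_. 0) \<alpha>2) (merge undefined (x(i := \<tau>)) y)\<bar> *
          cmod (D (?\<gamma> (Suc (Suc (\<beta>1 i)))) (merge undefined (x(i := \<tau>)) y))
          \<le> C * weight d s \<sigma> h (merge 0 (\<lambda>_. 0) \<alpha>2) (?\<gamma> (Suc (Suc (\<beta>1 i))))"
        by (rule bound_familyD[OF bd merge_Rd])
      then have "\<bar>monomial b \<alpha>2 y\<bar> *
          cmod (D (?\<gamma> (Suc (Suc (\<beta>1 i)))) (merge undefined (x(i := \<tau>)) y)) \<le> ?B"
        by (simp add: monomial_merge weight_merge mult_ac)
      then show ?thesis
        by (simp add: merge_upd_eo[OF i, of undefined] norm_mult)
    qed
    from second_order_bound[OF der der this, of t t0]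
    have "cmod (?\<mu> * D (?\<gamma> (\<beta>1 i)) (?z t) - ?\<mu> * D (?\<gamma> (\<beta>1 i)) (?z t0)
        - of_real (t - t0) * (?\<mu> * D (?\<gamma> (Suc (\<beta>1 i))) (?z t0))) \<le> ?B * \<bar>t - t0\<bar>\<^sup>2" .
    also have "?\<mu> * D (?\<gamma> (\<beta>1 i)) (?z t) - ?\<mu> * D (?\<gamma> (\<beta>1 i)) (?z t0)
        - of_real (t - t0) * (?\<mu> * D (?\<gamma> (Suc (\<beta>1 i))) (?z t0)) = ?\<mu> * R \<beta>2 y"
      using y by (simp add: R_def slice_family_def on_Rd_def merge_upd_eo[OF i, of undefined] algebra_simps
            del: of_real_diff)
    finally show "\<bar>monomial b \<alpha>2 y\<bar> * cmod (R \<beta>2 y) \<le> ?M * \<bar>t - t0\<bar>\<^sup>2 * weight b ?s ?\<sigma> h \<alpha>2 \<beta>2"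
      by (simp add: norm_mult mult_ac del: o_apply fun_upd_apply)
  qed
  ultimately show ?thesis by (rule gs_boundedI) (simp add: R_def fun_eq_iff algebra_simps)
qed

definition partial_family ::
    "(((nat \<Rightarrow> real) \<Rightarrow> complex) \<Rightarrow> complex) \<Rightarrow> ((nat \<Rightarrow> nat) \<Rightarrow> (nat \<Rightarrow> real) \<Rightarrow> complex) \<Rightarrow>
     (nat \<Rightarrow> nat) \<Rightarrow> (nat \<Rightarrow> real) \<Rightarrow> complex"
  where "partial_family u D \<beta>1 = on_Rd a (\<lambda>x. u (slice_family D x \<beta>1 (\<lambda>_. 0)))"

lemma smooth_partial_family:
  assumes f: "f \<in> GS_space m d s \<sigma>" and bd: "gs_bounded d s \<sigma> h C f"
    and lin: "linear_on_space (GS_space m b (s \<circ> ei) (\<sigma> \<circ> ei)) u"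
    and K: "op_bounded m b (s \<circ> ei) (\<sigma> \<circ> ei) h K u"
  shows "smooth_family a (partial_family u (\<lambda>\<beta>. multi_deriv d \<beta> f))"
  unfolding smooth_family_def
proof (intro conjI allI impI)
  fix \<beta>1 i x assume i: "i < a" and x: "x \<in> Rd a"
  let ?D = "\<lambda>\<beta>. multi_deriv d \<beta> f" and ?V = "GS_space m b (s \<circ> ei) (\<sigma> \<circ> ei)"
  let ?E = "\<lambda>t. slice_family ?D (x(i := t)) \<beta>1 (\<lambda>_. 0)"
  let ?E' = "slice_family ?D x (\<beta>1(i := Suc (\<beta>1 i))) (\<lambda>_. 0)"
  let ?M = "C * weight a (s \<circ> eo) (\<sigma> \<circ> eo) h (\<lambda>_. 0) (\<beta>1(i := Suc (Suc (\<beta>1 i))))"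
  have mem: "?E t \<in> ?V" "?E' \<in> ?V" for t by (rule slice_family_in_GS_space[OF f])+
  have "((\<lambda>t. u (?E t)) has_vector_derivative u ?E') (at (x i))"
  proof (rule has_vector_derivative_quadratic_remainder)
    fix t
    let ?R = "\<lambda>y. ?E t y - ?E (x i) y - of_real (t - x i) * ?E' y"
    have "gs_bounded b (s \<circ> ei) (\<sigma> \<circ> ei) h (?M * \<bar>t - x i\<bar>\<^sup>2) ?R"
      using gs_bounded_slice_remainder[OF gs_boundedD[OF bd] i, of \<beta>1 t "x i" x] by simp
    moreover have "?R \<in> ?V" by (intro GS_space_diff GS_space_mult mem)
    ultimately have "cmod (u ?R) \<le> K * (?M * \<bar>t - x i\<bar>\<^sup>2)" by (intro op_boundedD[OF K])
    moreover have "u ?R = u (?E t) - u (?E (x i)) - of_real (t - x i) * u ?E'"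
      using linear_diff[OF lin GS_space_diff[OF mem(1)[of t] mem(1)[of "x i"]]
              GS_space_mult[OF mem(2), of "of_real (t - x i)"]]
        linear_diff[OF lin mem(1)[of t] mem(1)[of "x i"]] linear_mult[OF lin mem(2)] by simp
    ultimately show "cmod (u (?E t) - u (?E (x i)) - of_real (t - x i) * u ?E') \<le> (K * ?M) * \<bar>t - x i\<bar>\<^sup>2"
      by (simp add: mult.assoc)
  qed
  then show "((\<lambda>t. partial_family u ?D \<beta>1 (x(i := t))) has_vector_derivative
      partial_family u ?D (\<beta>1(i := Suc (\<beta>1 i))) x) (at (x i))"
    using i x by (simp add: partial_family_def on_Rd_def)
qed (simp add: partial_family_def on_Rd_def)

lemma bound_partial_family:
  assumes f: "f \<in> GS_space m d s \<sigma>" and bd: "gs_bounded d s \<sigma> h C f"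
    and lin: "linear_on_space (GS_space m b (s \<circ> ei) (\<sigma> \<circ> ei)) u"
    and K: "op_bounded m b (s \<circ> ei) (\<sigma> \<circ> ei) h K u"
  shows "bound_family a (s \<circ> eo) (\<sigma> \<circ> eo) h (K * C) (partial_family u (\<lambda>\<beta>. multi_deriv d \<beta> f))"
  unfolding bound_family_def
proof (intro allI ballI)
  fix \<alpha>1 \<beta>1 x assume x: "x \<in> Rd a"
  let ?E = "slice_family (\<lambda>\<beta>. multi_deriv d \<beta> f) x \<beta>1 (\<lambda>_. 0)"
  have mem: "?E \<in> GS_space m b (s \<circ> ei) (\<sigma> \<circ> ei)" by (rule slice_family_in_GS_space[OF f])
  have "cmod (u (\<lambda>y. of_real (monomial a \<alpha>1 x) * ?E y)) \<le> K * (C * weight a (s \<circ> eo) (\<sigma> \<circ> eo) h \<alpha>1 \<beta>1)"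
    by (intro op_boundedD[OF K] GS_space_mult mem gs_bounded_slice_family gs_boundedD[OF bd])
  then show "\<bar>monomial a \<alpha>1 x\<bar> * cmod (partial_family u (\<lambda>\<beta>. multi_deriv d \<beta> f) \<beta>1 x)
      \<le> K * C * weight a (s \<circ> eo) (\<sigma> \<circ> eo) h \<alpha>1 \<beta>1"
    using x by (simp add: linear_mult[OF lin mem] partial_family_def on_Rd_def norm_mult mult_ac)
qed

definition slice :: "((nat \<Rightarrow> real) \<Rightarrow> complex) \<Rightarrow> (nat \<Rightarrow> real) \<Rightarrow> (nat \<Rightarrow> real) \<Rightarrow> complex"
  where "slice f x = on_Rd b (\<lambda>y. f (merge undefined x y))"

definition partial_apply ::
    "(((nat \<Rightarrow> real) \<Rightarrow> complex) \<Rightarrow> complex) \<Rightarrow> ((nat \<Rightarrow> real) \<Rightarrow> complex) \<Rightarrow> (nat \<Rightarrow> real) \<Rightarrow> complex"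
  where "partial_apply u f = on_Rd a (\<lambda>x. u (slice f x))"

lemma slice_eq: "slice f x = slice_family (\<lambda>\<beta>. multi_deriv d \<beta> f) x (\<lambda>_. 0) (\<lambda>_. 0)"
proof -
  have "merge 0 (\<lambda>_. 0) (\<lambda>_. 0) = (\<lambda>_. 0::nat)" by (auto simp: merge_def)
  then show ?thesis by (simp add: slice_def slice_family_def)
qed

lemma slice_in_GS_space: "f \<in> GS_space m d s \<sigma> \<Longrightarrow> slice f x \<in> GS_space m b (s \<circ> ei) (\<sigma> \<circ> ei)"
  unfolding slice_eq by (rule slice_family_in_GS_space)

text \<open>No constant is lost in \<open>h\<close>: this makes the estimate usable both for unions and for
  intersections over \<open>h\<close>.\<close>

lemma gs_bounded_partial_apply:
  assumes "f \<in> GS_space m d s \<sigma>" "gs_bounded d s \<sigma> h C f"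
    and "linear_on_space (GS_space m b (s \<circ> ei) (\<sigma> \<circ> ei)) u"
    and "op_bounded m b (s \<circ> ei) (\<sigma> \<circ> ei) h K u"
  shows "gs_bounded a (s \<circ> eo) (\<sigma> \<circ> eo) h (K * C) (partial_apply u f)"
  by (rule gs_boundedI[OF smooth_partial_family[OF assms] bound_partial_family[OF assms]])
     (simp add: partial_apply_def partial_family_def slice_eq)

lemma partial_apply_add:
  assumes lin: "linear_on_space (GS_space m b (s \<circ> ei) (\<sigma> \<circ> ei)) u"
    and f: "f \<in> GS_space m d s \<sigma>" and g: "g \<in> GS_space m d s \<sigma>"
  shows "partial_apply u (\<lambda>x. f x + g x) = (\<lambda>x. partial_apply u f x + partial_apply u g x)"
proof -
  have "slice (\<lambda>x. f x + g x) x = (\<lambda>y. slice f x y + slice g x y)" for x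
    by (auto simp: slice_def on_Rd_def)
  then show ?thesis
    using linear_add[OF lin slice_in_GS_space[OF f] slice_in_GS_space[OF g]]
    by (auto simp: partial_apply_def on_Rd_def)
qed

lemma partial_apply_mult:
  assumes lin: "linear_on_space (GS_space m b (s \<circ> ei) (\<sigma> \<circ> ei)) u"
    and f: "f \<in> GS_space m d s \<sigma>"
  shows "partial_apply u (\<lambda>x. c * f x) = (\<lambda>x. c * partial_apply u f x)"
proof -
  have "slice (\<lambda>x. c * f x) x = (\<lambda>y. c * slice f x y)" for x
    by (auto simp: slice_def on_Rd_def)
  then show ?thesis
    using linear_mult[OF lin slice_in_GS_space[OF f]] by (auto simp: partial_apply_def on_Rd_def)
qed

lemma partial_apply_in_GS_space:
  assumes f: "f \<in> GS_space m d s \<sigma>" and u: "GS_functional m b (s \<circ> ei) (\<sigma> \<circ> ei) u"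
  shows "partial_apply u f \<in> GS_space m a (s \<circ> eo) (\<sigma> \<circ> eo)"
proof (cases m)
  case True
  then obtain h C where h: "h > 0" "gs_bounded d s \<sigma> h C f" using f by (auto simp: GS_space_def)
  then obtain K where "op_bounded m b (s \<circ> ei) (\<sigma> \<circ> ei) h K u"
    using u True by (auto simp: GS_functional_def)
  then have "gs_bounded a (s \<circ> eo) (\<sigma> \<circ> eo) h (K * C) (partial_apply u f)"
    using u by (intro gs_bounded_partial_apply[OF f h(2)]) (auto simp: GS_functional_def)
  then show ?thesis using h(1) True by (auto simp: GS_space_def)
next
  case False
  then obtain h0 K where h0: "h0 > 0"
    and K: "op_bounded m b (s \<circ> ei) (\<sigma> \<circ> ei) h0 K u"
    using u by (auto simp: GS_functional_def)
  have "\<exists>C. gs_bounded a (s \<circ> eo) (\<sigma> \<circ> eo) h C (partial_apply u f)" if "h > 0" for h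
  proof -
    define k where "k = min h h0"
    have k: "k > 0" "k \<le> h" "k \<le> h0" using that h0 by (auto simp: k_def)
    obtain C where C: "gs_bounded d s \<sigma> k C f" using f k(1) False by (auto simp: GS_space_def)
    have "gs_bounded a (s \<circ> eo) (\<sigma> \<circ> eo) k (K * C) (partial_apply u f)"
      using u op_bounded_antimono[OF K k(1,3)]
      by (intro gs_bounded_partial_apply[OF f C]) (auto simp: GS_functional_def)
    then show ?thesis using gs_bounded_mono[OF _ k(1,2) order_refl] by blast
  qed
  then show ?thesis using False by (auto simp: GS_space_def)
qed

lemma GS_functional_iterated:
  assumes u: "GS_functional m b (s \<circ> ei) (\<sigma> \<circ> ei) u" and v: "GS_functional m a (s \<circ> eo) (\<sigma> \<circ> eo) v"
  shows "GS_functional m d s \<sigma> (\<lambda>f. v (partial_apply u f))"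
proof -
  let ?V = "GS_space m d s \<sigma>"
  have ulin: "linear_on_space (GS_space m b (s \<circ> ei) (\<sigma> \<circ> ei)) u"
    and vlin: "linear_on_space (GS_space m a (s \<circ> eo) (\<sigma> \<circ> eo)) v"
    using u v by (auto simp: GS_functional_def)
  have "linear_on_space ?V (\<lambda>f. v (partial_apply u f))"
    unfolding linear_on_space_def
    using linear_add[OF vlin partial_apply_in_GS_space[OF _ u] partial_apply_in_GS_space[OF _ u]]
      linear_mult[OF vlin partial_apply_in_GS_space[OF _ u]]
    by (auto simp: partial_apply_add[OF ulin] partial_apply_mult[OF ulin])
  moreover have bounded: "op_bounded m d s \<sigma> h (K' * K) (\<lambda>f. v (partial_apply u f))"
    if K: "op_bounded m b (s \<circ> ei) (\<sigma> \<circ> ei) h K u"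
      and K': "op_bounded m a (s \<circ> eo) (\<sigma> \<circ> eo) h K' v" for h K K'
    unfolding op_bounded_def
  proof (intro conjI ballI allI impI)
    show "0 \<le> K' * K" using K K' by (simp add: op_bounded_def)
    fix f C assume f: "f \<in> ?V" "gs_bounded d s \<sigma> h C f"
    have "cmod (v (partial_apply u f)) \<le> K' * (K * C)"
      by (intro op_boundedD[OF K'] partial_apply_in_GS_space[OF f(1) u] gs_bounded_partial_apply[OF f ulin K])
    then show "cmod (v (partial_apply u f)) \<le> K' * K * C" by (simp add: mult.assoc)
  qed
  moreover have "\<exists>h>0. \<exists>K. op_bounded m d s \<sigma> h K (\<lambda>f. v (partial_apply u f))" if "\<not> m"
  proof -
    have "\<exists>h>0. \<exists>K. op_bounded m b (s \<circ> ei) (\<sigma> \<circ> ei) h K u"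
      "\<exists>h>0. \<exists>K. op_bounded m a (s \<circ> eo) (\<sigma> \<circ> eo) h K v"
      using u v that by (simp_all add: GS_functional_def)
    then obtain h1 K1 h2 K2 where "h1 > 0" "h2 > 0"
      "op_bounded m b (s \<circ> ei) (\<sigma> \<circ> ei) h1 K1 u"
      "op_bounded m a (s \<circ> eo) (\<sigma> \<circ> eo) h2 K2 v"
      by blast
    then have "op_bounded m d s \<sigma> (min h1 h2) (K2 * K1) (\<lambda>f. v (partial_apply u f))"
      by (intro bounded) (auto intro: op_bounded_antimono)
    then show ?thesis using \<open>h1 > 0\<close> \<open>h2 > 0\<close> by (intro exI[of _ "min h1 h2"]) auto
  qed
  moreover have "\<forall>h>0. \<exists>K. op_bounded m d s \<sigma> h K (\<lambda>f. v (partial_apply u f))" if m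
  proof (intro allI impI)
    fix h :: real assume h: "h > 0"
    have "\<forall>h>0. \<exists>K. op_bounded m b (s \<circ> ei) (\<sigma> \<circ> ei) h K u"
      "\<forall>h>0. \<exists>K. op_bounded m a (s \<circ> eo) (\<sigma> \<circ> eo) h K v"
      using u v that by (simp_all add: GS_functional_def)
    with h obtain K K' where "op_bounded m b (s \<circ> ei) (\<sigma> \<circ> ei) h K u"
      "op_bounded m a (s \<circ> eo) (\<sigma> \<circ> eo) h K' v"
      by blast
    then show "\<exists>K. op_bounded m d s \<sigma> h K (\<lambda>f. v (partial_apply u f))" using bounded by blast
  qed
  ultimately show ?thesis by (simp add: GS_functional_def)
qed

end

section \<open>Riemann sums over the line\<close>

lemma cauchy_weight_le_arctan:
  assumes "0 < \<eta>" "t \<ge> 0"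
  shows "\<eta> / (1 + (t + \<eta>)\<^sup>2) \<le> arctan (t + \<eta>) - arctan t"
proof -
  have "\<exists>z>t. z < t + \<eta> \<and> arctan (t + \<eta>) - arctan t = (t + \<eta> - t) * inverse (1 + z\<^sup>2)"
    by (rule MVT2) (use assms in \<open>auto intro: DERIV_arctan\<close>)
  then obtain z where z: "t < z" "z < t + \<eta>" "arctan (t + \<eta>) - arctan t = \<eta> * inverse (1 + z\<^sup>2)" by auto
  have "z\<^sup>2 \<le> (t + \<eta>)\<^sup>2" using z assms by (intro power_mono) auto
  then have "inverse (1 + (t + \<eta>)\<^sup>2) \<le> inverse (1 + z\<^sup>2)" by (intro le_imp_inverse_le) (auto intro: add_pos_nonneg)
  then show ?thesis using assms unfolding z(3) by (simp add: divide_inverse mult_left_mono)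
qed

text \<open>
  Comparison with the arctangent bounds the sum by \<open>\<eta> + pi\<close>.
\<close>

lemma sum_cauchy_weight_le:
  fixes \<eta> :: real
  assumes "0 < \<eta>" "\<eta> \<le> 1"
  shows "(\<Sum>k\<in>{- int N..int N}. \<eta> / (1 + (\<eta> * of_int k)\<^sup>2)) \<le> 5"
proof -
  have "(\<Sum>k\<in>{- int N..int N}. \<eta> / (1 + (\<eta> * of_int k)\<^sup>2)) \<le> \<eta> + 2 * arctan (\<eta> * real N)"
  proof (induction N)
    case (Suc N)
    have set: "{- int (Suc N)..int (Suc N)} = insert (- int (Suc N)) (insert (int (Suc N)) {- int N..int N})"
      by auto
    have "\<eta> / (1 + (\<eta> * real (Suc N))\<^sup>2) \<le> arctan (\<eta> * real (Suc N)) - arctan (\<eta> * real N)"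
      using cauchy_weight_le_arctan[of \<eta> "\<eta> * real N"] assms by (simp add: algebra_simps)
    then have "2 * (\<eta> / (1 + (\<eta> * real (Suc N))\<^sup>2)) + (\<eta> + 2 * arctan (\<eta> * real N))
        \<le> \<eta> + 2 * arctan (\<eta> * real (Suc N))" by linarith
    moreover have "(\<Sum>k\<in>{- int (Suc N)..int (Suc N)}. \<eta> / (1 + (\<eta> * of_int k)\<^sup>2))
        = 2 * (\<eta> / (1 + (\<eta> * real (Suc N))\<^sup>2)) + (\<Sum>k\<in>{- int N..int N}. \<eta> / (1 + (\<eta> * of_int k)\<^sup>2))"
      unfolding set by (subst sum.insert, simp, simp, subst sum.insert, simp, simp)
        (simp add: power2_eq_square algebra_simps)
    ultimately show ?case using Suc by linarith
  qed simp
  also have "\<dots> \<le> 5"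
    using arctan_ubound[of "\<eta> * real N"] pi_less_4 assms by linarith
  finally show ?thesis .
qed

text \<open>
  The grid with index \<open>n\<close> has mesh \<open>1 / n\<^sup>2\<close> and extends from \<open>-n\<close> to \<open>n\<close>. The mesh decreases faster
  than the length grows, so that errors of first order in the mesh still sum to \<open>O(1 / n)\<close>.
\<close>

definition grid :: "nat \<Rightarrow> int set"
  where "grid n = {- int (n ^ 3)..int (n ^ 3)}"

definition mesh :: "nat \<Rightarrow> real"
  where "mesh n = 1 / (real n)\<^sup>2"

lemma finite_grid [simp]: "finite (grid n)"
  by (simp add: grid_def)

lemma mesh_pos: "n \<ge> 1 \<Longrightarrow> mesh n > 0"
  and mesh_le_1: "n \<ge> 1 \<Longrightarrow> mesh n \<le> 1"
  by (auto simp: mesh_def divide_le_eq_1)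

lemma sum_grid_le:
  assumes "n \<ge> 1"
  shows "(\<Sum>k\<in>grid n. mesh n / (1 + (mesh n * of_int k)\<^sup>2)) \<le> 5"
  using sum_cauchy_weight_le[OF mesh_pos[OF assms] mesh_le_1[OF assms], of "n ^ 3"]
  by (simp add: grid_def)

lemma card_grid_le: "n \<ge> 1 \<Longrightarrow> real (card (grid n)) \<le> 3 * real n ^ 3"
proof -
  assume "n \<ge> 1"
  have "card (grid n) = nat (int (n ^ 3) - - int (n ^ 3) + 1)"
    by (simp only: grid_def card_atLeastAtMost_int)
  also have "\<dots> = 2 * n ^ 3 + 1" by linarith
  also have "\<dots> \<le> 3 * n ^ 3" using \<open>n \<ge> 1\<close> by simp
  finally have "real (card (grid n)) \<le> real (3 * n ^ 3)" by (simp only: of_nat_le_iff)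
  then show ?thesis by simp
qed

lemma floor_multiple:
  assumes "\<eta> > 0"
  shows "\<eta> * of_int \<lfloor>t / \<eta>\<rfloor> \<le> t" "t < \<eta> * of_int \<lfloor>t / \<eta>\<rfloor> + (\<eta> :: real)"
proof -
  have "of_int \<lfloor>t / \<eta>\<rfloor> \<le> t / \<eta>" "t / \<eta> < of_int \<lfloor>t / \<eta>\<rfloor> + 1" by linarith+
  from mult_left_mono[OF this(1), of \<eta>] mult_strict_left_mono[OF this(2), of \<eta>]
  show "\<eta> * of_int \<lfloor>t / \<eta>\<rfloor> \<le> t" "t < \<eta> * of_int \<lfloor>t / \<eta>\<rfloor> + \<eta>"
    using assms by (simp_all add: distrib_left)
qed

text \<open>
  The reflection \<open>t \<mapsto> z - t\<close> maps the grid to a shifted grid. The shift is a multiple of the mesh up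
  to less than one mesh width, which costs a Lipschitz error, and the points of one grid outside the
  other lie where the function is small. Both errors are uniform in \<open>z\<close>.
\<close>

lemma reflected_grid_sums_close:
  fixes A :: "real \<Rightarrow> complex"
  assumes n: "n \<ge> 1" and "M \<ge> 0" "C \<ge> 0"
    and lip: "\<And>t t'. cmod (A t - A t') \<le> M * \<bar>t - t'\<bar>"
    and dec: "\<And>t. (1 + t\<^sup>2) * cmod (A t) \<le> C"
    and dec': "\<And>t. (1 + t\<^sup>2) * cmod (A (z - t)) \<le> C"
  shows "cmod ((\<Sum>k\<in>grid n. of_real (mesh n) * A (mesh n * of_int k))
    - (\<Sum>k\<in>grid n. of_real (mesh n) * A (z - mesh n * of_int k))) \<le> (3 * M + 6 * C) / real n"
proof -
  let ?\<eta> = "mesh n" and ?N = "int (n ^ 3)"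
  have \<eta>: "?\<eta> > 0" by (rule mesh_pos[OF n])
  have n0: "real n > 0" using n by simp
  have \<eta>N: "?\<eta> * real_of_int ?N = real n" using n by (simp add: mesh_def power2_eq_square power3_eq_cube)
  define m where "m = \<lfloor>z / ?\<eta>\<rfloor>"
  define r where "r = z - ?\<eta> * of_int m"
  have r: "0 \<le> r" "r < ?\<eta>"
    using floor_multiple[OF \<eta>, of z] by (simp_all add: r_def m_def)
  define J where "J = {m - ?N..m + ?N}"
  let ?f = "\<lambda>k. of_real ?\<eta> * A (?\<eta> * of_int k)"
  have cardJ: "card J = card (grid n)" by (simp add: J_def grid_def)
  have J: "(\<Sum>k\<in>grid n. of_real ?\<eta> * A (?\<eta> * of_int (m - k))) = (\<Sum>k\<in>J. ?f k)"
    by (rule sum.reindex_bij_witness[of _ "\<lambda>k. m - k" "\<lambda>k. m - k"]) (auto simp: J_def grid_def)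
  have far: "cmod (A t) \<le> C / (real n)\<^sup>2" if "\<bar>s\<bar> \<ge> real n" "(1 + s\<^sup>2) * cmod (A t) \<le> C" for s t
  proof -
    have "(real n)\<^sup>2 \<le> 1 + s\<^sup>2" using power_mono[OF that(1), of 2] n0 by simp
    then have "(real n)\<^sup>2 * cmod (A t) \<le> (1 + s\<^sup>2) * cmod (A t)" by (rule mult_right_mono) simp
    then have "(real n)\<^sup>2 * cmod (A t) \<le> C" using that(2) by linarith
    then show ?thesis using n0 by (simp add: field_simps)
  qed
  have part1: "cmod (\<Sum>k\<in>J - grid n. ?f k) \<le> 3 * C / real n"
    and part2: "cmod (\<Sum>k\<in>grid n - J. ?f k) \<le> 3 * C / real n"
  proof -
    have bound: "cmod (\<Sum>k\<in>S. ?f k) \<le> 3 * C / real n"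
      if S: "finite S" "card S \<le> card (grid n)" and small: "\<And>k. k \<in> S \<Longrightarrow> cmod (A (?\<eta> * of_int k)) \<le> C / (real n)\<^sup>2" for S
    proof -
      have "cmod (\<Sum>k\<in>S. ?f k) \<le> real (card S) * (?\<eta> * (C / (real n)\<^sup>2))"
      proof (rule sum_norm_bound)
        fix k assume "k \<in> S"
        from mult_left_mono[OF small[OF this], of ?\<eta>] \<eta>
        show "cmod (?f k) \<le> ?\<eta> * (C / (real n)\<^sup>2)" by (simp add: norm_mult)
      qed
      also have "\<dots> \<le> (3 * real n ^ 3) * (?\<eta> * (C / (real n)\<^sup>2))"
        using S(2) card_grid_le[OF n] \<eta> \<open>C \<ge> 0\<close> by (intro mult_right_mono) auto
      also have "\<dots> = 3 * C / real n"
        using n0 by (simp add: mesh_def field_simps power2_eq_square power3_eq_cube)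
      finally show ?thesis .
    qed
    show "cmod (\<Sum>k\<in>J - grid n. ?f k) \<le> 3 * C / real n"
    proof (rule bound)
      show "card (J - grid n) \<le> card (grid n)" unfolding cardJ[symmetric] by (intro card_mono) (auto simp: J_def)
      fix k assume "k \<in> J - grid n"
      then have "?N \<le> \<bar>k\<bar>" by (auto simp: grid_def)
      then have "real_of_int ?N \<le> \<bar>real_of_int k\<bar>" by linarith
      then have "?\<eta> * real_of_int ?N \<le> ?\<eta> * \<bar>real_of_int k\<bar>" using \<eta> by (intro mult_left_mono) auto
      then have "real n \<le> \<bar>?\<eta> * of_int k\<bar>" using \<eta> unfolding \<eta>N by (simp add: abs_mult)
      then show "cmod (A (?\<eta> * of_int k)) \<le> C / (real n)\<^sup>2" using dec far by blast
    qed (simp add: J_def)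
    show "cmod (\<Sum>k\<in>grid n - J. ?f k) \<le> 3 * C / real n"
    proof (rule bound)
      show "card (grid n - J) \<le> card (grid n)" by (intro card_mono) auto
      fix k assume "k \<in> grid n - J"
      then consider "m - k \<ge> ?N + 1" | "m - k \<le> - ?N - 1" by (auto simp: J_def)
      then have "real n \<le> \<bar>z - ?\<eta> * of_int k\<bar>"
      proof cases
        case 1
        then have "?\<eta> * real_of_int (?N + 1) \<le> ?\<eta> * of_int (m - k)"
          using \<eta> by (intro mult_left_mono) (simp_all only: of_int_le_iff less_imp_le)
        then show ?thesis using r \<eta> \<eta>N by (simp add: r_def algebra_simps)
      next
        case 2
        then have "?\<eta> * of_int (m - k) \<le> ?\<eta> * real_of_int (- ?N - 1)"
          using \<eta> by (intro mult_left_mono) (simp_all only: of_int_le_iff less_imp_le)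
        then show ?thesis using r \<eta> \<eta>N by (simp add: r_def algebra_simps)
      qed
      then show "cmod (A (?\<eta> * of_int k)) \<le> C / (real n)\<^sup>2"
        using far[of "z - ?\<eta> * of_int k" "?\<eta> * of_int k"] dec'[of "z - ?\<eta> * of_int k"] by simp
    qed simp
  qed
  have lipsum: "cmod (\<Sum>k\<in>grid n. of_real ?\<eta> * (A (?\<eta> * of_int (m - k)) - A (z - ?\<eta> * of_int k))) \<le> 3 * M / real n"
  proof -
    have "cmod (of_real ?\<eta> * (A (?\<eta> * of_int (m - k)) - A (z - ?\<eta> * of_int k))) \<le> ?\<eta> * (M * ?\<eta>)" for k
    proof -
      have "cmod (A (?\<eta> * of_int (m - k)) - A (z - ?\<eta> * of_int k)) \<le> M * \<bar>?\<eta> * of_int (m - k) - (z - ?\<eta> * of_int k)\<bar>"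
        by (rule lip)
      also have "?\<eta> * of_int (m - k) - (z - ?\<eta> * of_int k) = - r" by (simp add: r_def algebra_simps)
      also have "M * \<bar>- r\<bar> \<le> M * ?\<eta>" using r \<open>M \<ge> 0\<close> by (intro mult_left_mono) auto
      finally show ?thesis using \<eta> by (simp add: norm_mult)
    qed
    then have "cmod (\<Sum>k\<in>grid n. of_real ?\<eta> * (A (?\<eta> * of_int (m - k)) - A (z - ?\<eta> * of_int k)))
        \<le> real (card (grid n)) * (?\<eta> * (M * ?\<eta>))" by (intro sum_norm_bound)
    also have "\<dots> \<le> (3 * real n ^ 3) * (?\<eta> * (M * ?\<eta>))"
      using card_grid_le[OF n] \<eta> \<open>M \<ge> 0\<close> by (intro mult_right_mono) auto
    also have "\<dots> = 3 * M / real n"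
      using n0 by (simp add: mesh_def field_simps power2_eq_square power3_eq_cube)
    finally show ?thesis .
  qed
  have split1: "(\<Sum>k\<in>grid n. ?f k) = (\<Sum>k\<in>grid n - J. ?f k) + (\<Sum>k\<in>grid n \<inter> J. ?f k)"
    and split2: "(\<Sum>k\<in>J. ?f k) = (\<Sum>k\<in>J - grid n. ?f k) + (\<Sum>k\<in>grid n \<inter> J. ?f k)"
  proof -
    show "(\<Sum>k\<in>grid n. ?f k) = (\<Sum>k\<in>grid n - J. ?f k) + (\<Sum>k\<in>grid n \<inter> J. ?f k)"
      using sum.Int_Diff[of "grid n" ?f J] by (simp add: add.commute)
    show "(\<Sum>k\<in>J. ?f k) = (\<Sum>k\<in>J - grid n. ?f k) + (\<Sum>k\<in>grid n \<inter> J. ?f k)"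
      using sum.Int_Diff[of J ?f "grid n"] by (simp add: J_def add.commute Int_commute)
  qed
  have "(\<Sum>k\<in>grid n. ?f k) - (\<Sum>k\<in>grid n. of_real ?\<eta> * A (z - ?\<eta> * of_int k))
      = (\<Sum>k\<in>grid n - J. ?f k) - (\<Sum>k\<in>J - grid n. ?f k)
        + (\<Sum>k\<in>grid n. of_real ?\<eta> * (A (?\<eta> * of_int (m - k)) - A (z - ?\<eta> * of_int k)))"
    unfolding right_diff_distrib sum_subtractf J split1 split2 by simp
  also have "cmod \<dots> \<le> 3 * C / real n + 3 * C / real n + 3 * M / real n"
    by (intro norm_triangle_mono order_trans[OF norm_triangle_ineq4] add_mono part1 part2 lipsum)
  also have "\<dots> = (3 * M + 6 * C) / real n" by (simp add: add_divide_distrib)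
  finally show ?thesis .
qed

text \<open>
  The number of grid points near \<open>t0\<close> grows like the inverse of the mesh, and each of them contributes at
  least half of \<open>G t0\<close>.
\<close>

lemma grid_sum_lower_bound:
  fixes G :: "real \<Rightarrow> real"
  assumes cont: "isCont G t0" and nonneg: "\<And>t. G t \<ge> 0" and pos: "G t0 > 0"
  shows "\<exists>c>0. \<exists>N. \<forall>n\<ge>N. c \<le> (\<Sum>k\<in>grid n. mesh n * G (mesh n * of_int k))"
proof -
  obtain r where r: "r > 0" "\<And>t. \<bar>t - t0\<bar> < r \<Longrightarrow> G t0 / 2 \<le> G t"
  proof -
    have "eventually (\<lambda>t. G t0 / 2 < G t) (nhds t0)"
      using cont pos unfolding isCont_def by (intro order_tendstoD(1)) (auto simp: tendsto_at_iff_tendsto_nhds)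
    then show thesis using that unfolding eventually_nhds_metric dist_real_def by (meson less_imp_le)
  qed
  define N where "N = nat \<lceil>\<bar>t0\<bar> + r + 4 / r\<rceil> + 1"
  have "r / 4 * (G t0 / 2) \<le> (\<Sum>k\<in>grid n. mesh n * G (mesh n * of_int k))" if "n \<ge> N" for n
  proof -
    let ?\<eta> = "mesh n" and ?N = "int (n ^ 3)"
    have nn: "real n \<ge> \<bar>t0\<bar> + r + 4 / r" "n \<ge> 1" using that unfolding N_def by linarith+
    have \<eta>: "?\<eta> > 0" by (rule mesh_pos[OF nn(2)])
    have \<eta>N: "?\<eta> * real_of_int ?N = real n"
      using nn(2) by (simp add: mesh_def power2_eq_square power3_eq_cube)
    have "4 / r \<le> real n" using nn r(1) by linarith
    also have "real n \<le> (real n)\<^sup>2" using nn(2) by (simp add: power2_eq_square)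
    finally have "4 / r \<le> (real n)\<^sup>2" .
    then have \<eta>r: "4 * ?\<eta> \<le> r" using r(1) nn(2) by (simp add: mesh_def field_simps)
    define m where "m = \<lfloor>t0 / ?\<eta>\<rfloor>"
    define p where "p = \<lfloor>(r/2) / ?\<eta>\<rfloor>"
    have m: "?\<eta> * of_int m \<le> t0" "t0 < ?\<eta> * of_int m + ?\<eta>"
      unfolding m_def using floor_multiple[OF \<eta>] by auto
    have p: "?\<eta> * of_int p \<le> r/2" "r/2 < ?\<eta> * of_int p + ?\<eta>"
      unfolding p_def by (rule floor_multiple[OF \<eta>])+
    have p0: "p \<ge> 0" using r(1) \<eta> by (simp add: p_def)
    define K where "K = {m + 1..m + p}"
    have near: "t0 < ?\<eta> * of_int k" "?\<eta> * of_int k \<le> t0 + r/2" if "k \<in> K" for k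
    proof -
      have "of_int (m + 1) \<le> (of_int k :: real)" "of_int k \<le> (of_int (m + p) :: real)"
        using that unfolding K_def atLeastAtMost_iff of_int_le_iff by auto
      then have "?\<eta> * of_int (m + 1) \<le> ?\<eta> * of_int k" "?\<eta> * of_int k \<le> ?\<eta> * of_int (m + p)"
        using \<eta> by (auto intro!: mult_left_mono simp del: of_int_add)
      then show "t0 < ?\<eta> * of_int k" "?\<eta> * of_int k \<le> t0 + r/2" using m p by (auto simp: algebra_simps)
    qed
    have "K \<subseteq> grid n"
    proof
      fix k assume "k \<in> K"
      from near[OF this] have "\<bar>?\<eta> * of_int k\<bar> \<le> ?\<eta> * real_of_int ?N"
        using nn r(1) divide_pos_pos[of 4 r] unfolding \<eta>N by linarith
      then have "?\<eta> * \<bar>of_int k\<bar> \<le> ?\<eta> * real_of_int ?N" using \<eta> by (simp add: abs_mult)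
      then have "\<bar>real_of_int k\<bar> \<le> real_of_int ?N" using \<eta> by (simp only: mult_le_cancel_left_pos)
      then have "\<bar>k\<bar> \<le> ?N" by linarith
      then show "k \<in> grid n" by (auto simp: grid_def)
    qed
    have "r / 4 * (G t0 / 2) \<le> (?\<eta> * of_int p) * (G t0 / 2)"
      using p \<eta>r pos by (intro mult_right_mono) auto
    also have "\<dots> = of_nat (card K) * (?\<eta> * (G t0 / 2))" using p0 by (simp add: K_def)
    also have "\<dots> \<le> (\<Sum>k\<in>K. ?\<eta> * G (?\<eta> * of_int k))"
    proof (rule sum_bounded_below)
      fix k assume "k \<in> K"
      from near[OF this] r(1) have "G t0 / 2 \<le> G (?\<eta> * of_int k)" by (intro r(2)) auto
      then show "?\<eta> * (G t0 / 2) \<le> ?\<eta> * G (?\<eta> * of_int k)" using \<eta> by simp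
    qed
    also have "\<dots> \<le> (\<Sum>k\<in>grid n. ?\<eta> * G (?\<eta> * of_int k))"
      using \<open>K \<subseteq> grid n\<close> \<eta> nonneg by (intro sum_mono2) auto
    finally show ?thesis .
  qed
  moreover have "r / 4 * (G t0 / 2) > 0" using r(1) pos by simp
  ultimately show ?thesis by blast
qed

section \<open>Nonnegative kernels\<close>

definition kernel_family :: "(nat \<Rightarrow> real \<Rightarrow> complex) \<Rightarrow> bool"
  where "kernel_family g \<longleftrightarrow> (\<forall>b t. (g b has_vector_derivative g (Suc b) t) (at t))"

definition kernel_bound :: "real \<Rightarrow> real \<Rightarrow> real \<Rightarrow> real \<Rightarrow> (nat \<Rightarrow> real \<Rightarrow> complex) \<Rightarrow> bool"
  where "kernel_bound s \<sigma> h C g \<longleftrightarrow>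
    (\<forall>a b t. \<bar>t\<bar> ^ a * cmod (g b t) \<le> C * (gevrey s h a * gevrey \<sigma> h b))"

lemma kernel_bound_nonneg: "kernel_bound s \<sigma> h C g \<Longrightarrow> C \<ge> 0"
  unfolding kernel_bound_def by (drule spec[of _ 0], drule spec[of _ 0], drule spec[of _ 0])
    (simp add: order_trans[OF norm_ge_zero])

text \<open>The successive derivatives of \<open>\<bar>p 0\<bar>\<^sup>2\<close>, when \<open>p\<close> lists those of \<open>p 0\<close>.\<close>

definition modulus_square :: "(nat \<Rightarrow> real \<Rightarrow> complex) \<Rightarrow> nat \<Rightarrow> real \<Rightarrow> complex"
  where "modulus_square p b t = (\<Sum>k\<le>b. of_nat (b choose k) * (p k t * cnj (p (b - k) t)))"

text \<open>
  Pascal's rule in the form needed for the induction step of the Leibniz formula.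
\<close>

lemma sum_binomial_Suc:
  fixes P Q :: "nat \<Rightarrow> complex"
  shows "(\<Sum>k\<le>b. of_nat (b choose k) * (P (Suc k) * Q (b - k) + P k * Q (Suc (b - k))))
    = (\<Sum>k\<le>Suc b. of_nat (Suc b choose k) * (P k * Q (Suc b - k)))"
proof -
  have "(\<Sum>k\<le>b. of_nat (b choose k) * (P k * Q (Suc (b - k))))
      = (\<Sum>k\<le>Suc b. of_nat (b choose k) * (P k * Q (Suc b - k)))"
    by (simp add: Suc_diff_le)
  also have "\<dots> = P 0 * Q (Suc b) + (\<Sum>k\<le>b. of_nat (b choose Suc k) * (P (Suc k) * Q (b - k)))"
    by (subst sum.atMost_Suc_shift) simp
  finally have 1: "(\<Sum>k\<le>b. of_nat (b choose k) * (P k * Q (Suc (b - k))))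
    = P 0 * Q (Suc b) + (\<Sum>k\<le>b. of_nat (b choose Suc k) * (P (Suc k) * Q (b - k)))" .
  have "(\<Sum>k\<le>Suc b. of_nat (Suc b choose k) * (P k * Q (Suc b - k)))
      = P 0 * Q (Suc b) + (\<Sum>k\<le>b. of_nat (Suc b choose Suc k) * (P (Suc k) * Q (b - k)))"
    by (subst sum.atMost_Suc_shift) simp
  also have "\<dots> = P 0 * Q (Suc b) + (\<Sum>k\<le>b. of_nat (b choose Suc k) * (P (Suc k) * Q (b - k)))
      + (\<Sum>k\<le>b. of_nat (b choose k) * (P (Suc k) * Q (b - k)))"
    by (simp add: algebra_simps sum.distrib)
  finally show ?thesis using 1 by (simp add: algebra_simps sum.distrib)
qed

lemma kernel_family_modulus_square:
  assumes p: "kernel_family p"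
  shows "kernel_family (modulus_square p)"
  unfolding kernel_family_def
proof (intro allI)
  fix b t
  have der: "(p k has_vector_derivative p (Suc k) t) (at t)" for k
    using p by (simp add: kernel_family_def)
  have "((\<lambda>t. \<Sum>k\<le>b. of_nat (b choose k) * (p k t * cnj (p (b - k) t))) has_vector_derivative
      (\<Sum>k\<le>b. of_nat (b choose k) * (p k t * cnj (p (Suc (b - k)) t) + p (Suc k) t * cnj (p (b - k) t)))) (at t)"
    by (intro has_vector_derivative_sum has_vector_derivative_mult_right has_vector_derivative_mult
          has_vector_derivative_cnj der)
  also have "(\<Sum>k\<le>b. of_nat (b choose k) * (p k t * cnj (p (Suc (b - k)) t) + p (Suc k) t * cnj (p (b - k) t)))
      = modulus_square p (Suc b) t"
    unfolding modulus_square_def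
    using sum_binomial_Suc[of b "\<lambda>k. p k t" "\<lambda>k. cnj (p k t)"] by (simp add: add.commute)
  finally show "(modulus_square p b has_vector_derivative modulus_square p (Suc b) t) (at t)"
    by (simp add: modulus_square_def[abs_def])
qed

lemma kernel_bound_modulus_square:
  assumes p: "kernel_bound s \<sigma> h C p" and "h > 0" "\<sigma> \<ge> 0"
  shows "kernel_bound s \<sigma> (2 * h) (C * C) (modulus_square p)"
  unfolding kernel_bound_def
proof (intro allI)
  fix a b t
  have bd: "\<bar>t\<bar> ^ a * cmod (p k t) \<le> C * (gevrey s h a * gevrey \<sigma> h k)" for a k
    using p by (simp add: kernel_bound_def)
  have bd0: "cmod (p k t) \<le> C * gevrey \<sigma> h k" for k using bd[of 0 k] by simp
  have C: "C \<ge> 0" using bd0[of 0] by (simp add: order_trans[OF norm_ge_zero])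
  have "\<bar>t\<bar> ^ a * cmod (modulus_square p b t)
      \<le> \<bar>t\<bar> ^ a * (\<Sum>k\<le>b. real (b choose k) * (cmod (p k t) * cmod (p (b - k) t)))"
    unfolding modulus_square_def
    by (intro mult_left_mono order_trans[OF norm_sum] sum_mono) (auto simp: norm_mult)
  also have "\<dots> = (\<Sum>k\<le>b. real (b choose k) * ((\<bar>t\<bar> ^ a * cmod (p k t)) * cmod (p (b - k) t)))"
    by (simp add: sum_distrib_left mult_ac)
  also have "\<dots> \<le> (\<Sum>k\<le>b. real (b choose k) * ((C * (gevrey s h a * gevrey \<sigma> h k)) * (C * gevrey \<sigma> h (b - k))))"
    by (intro sum_mono mult_left_mono mult_mono bd bd0) (use C \<open>h > 0\<close> in auto)
  also have "\<dots> = (C * C * gevrey s h a) * (\<Sum>k\<le>b. real (b choose k) * (gevrey \<sigma> h k * gevrey \<sigma> h (b - k)))"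
    by (simp add: sum_distrib_left mult_ac)
  also have "\<dots> \<le> (C * C * gevrey s (2 * h) a) * gevrey \<sigma> (h + h) b"
    by (intro mult_mono sum_binomial_gevrey_le mult_left_mono gevrey_mono sum_nonneg)
       (use C \<open>h > 0\<close> \<open>\<sigma> \<ge> 0\<close> in auto)
  finally show "\<bar>t\<bar> ^ a * cmod (modulus_square p b t) \<le> C * C * (gevrey s (2 * h) a * gevrey \<sigma> (2 * h) b)"
    by (simp add: mult.assoc)
qed

lemma modulus_square_0: "modulus_square p 0 t = of_real ((cmod (p 0 t))\<^sup>2)"
  by (simp add: modulus_square_def complex_norm_square[symmetric])

text \<open>
  The restriction of a function to the line through \<open>x\<close> in direction \<open>i\<close>, with its derivatives.
\<close>

definition line_family ::
    "((nat \<Rightarrow> nat) \<Rightarrow> (nat \<Rightarrow> real) \<Rightarrow> complex) \<Rightarrow> nat \<Rightarrow> (nat \<Rightarrow> real) \<Rightarrow> nat \<Rightarrow> real \<Rightarrow> complex"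
  where "line_family D i x b t = D ((\<lambda>_. 0)(i := b)) (x(i := t))"

lemma kernel_family_line_family:
  "smooth_family d D \<Longrightarrow> i < d \<Longrightarrow> x \<in> Rd d \<Longrightarrow> kernel_family (line_family D i x)"
  using smooth_familyD[of d D i x "(\<lambda>_. 0)(i := _)"] by (simp add: kernel_family_def line_family_def[abs_def])

lemma monomial_upd:
  assumes "i < d"
  shows "\<bar>monomial d (\<alpha>(i := a)) (x(i := t))\<bar> = \<bar>t\<bar> ^ a * (\<Prod>j\<in>{..<d}-{i}. \<bar>x j\<bar> ^ \<alpha> j)"
  by (simp add: monomial_split[OF assms])

lemma weight_upd:
  assumes "i < d"
  shows "weight d s \<sigma> h (\<alpha>(i := a)) (\<beta>(i := b)) = gevrey (s i) h a * gevrey (\<sigma> i) h b *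
    (\<Prod>j\<in>{..<d}-{i}. gevrey (s j) h (\<alpha> j) * gevrey (\<sigma> j) h (\<beta> j))"
  by (simp add: weight_split[OF assms])

lemma bound_family_line:
  assumes "bound_family d s \<sigma> h C D" "i < d" "x \<in> Rd d"
  shows "\<bar>t\<bar> ^ a * ((\<Prod>j\<in>{..<d}-{i}. \<bar>x j\<bar> ^ \<alpha> j) * cmod (D (\<beta>(i := b)) (x(i := t))))
    \<le> (C * (gevrey (\<sigma> i) h b * (\<Prod>j\<in>{..<d}-{i}. gevrey (s j) h (\<alpha> j) * gevrey (\<sigma> j) h (\<beta> j))))
      * gevrey (s i) h a"
  using bound_familyD[OF assms(1), of "x(i := t)" "\<alpha>(i := a)" "\<beta>(i := b)"] assms(2,3)
  by (simp add: monomial_upd weight_upd mult_ac del: fun_upd_apply)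

lemma kernel_bound_line_family:
  assumes "bound_family d s \<sigma> h C D" "i < d" "x \<in> Rd d"
  shows "kernel_bound (s i) (\<sigma> i) h C (line_family D i x)"
  unfolding kernel_bound_def
  using bound_family_line[OF assms, of _ _ "\<lambda>_. 0" "\<lambda>_. 0"]
  by (simp add: line_family_def mult_ac)

section \<open>Translated and frozen terms\<close>

lemma smooth_translate:
  assumes D: "smooth_family d D" and i: "i < d"
  shows "smooth_family d (\<lambda>\<beta>. on_Rd d (\<lambda>x. D \<beta> (x(i := x i - y))))"
  unfolding smooth_family_def
proof (intro conjI allI impI)
  fix \<beta> j x assume j: "j < d" and x: "x \<in> Rd d"
  have "((\<lambda>t. D \<beta> ((x(j := t))(i := (x(j := t)) i - y))) has_vector_derivative
      D (\<beta>(j := Suc (\<beta> j))) (x(i := x i - y))) (at (x j))"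
  proof (cases "j = i")
    case True
    have "((\<lambda>t. D \<beta> (x(i := t))) \<circ> (\<lambda>t. t - y) has_vector_derivative
        1 *\<^sub>R D (\<beta>(i := Suc (\<beta> i))) (x(i := x i - y))) (at (x i))"
      by (rule vector_diff_chain_at[OF _ smooth_familyD[OF D i x]])
         (auto intro!: derivative_eq_intros simp: has_real_derivative_iff_has_vector_derivative[symmetric])
    then show ?thesis using True by (simp add: o_def)
  next
    case False
    then have "((\<lambda>t. D \<beta> ((x(i := x i - y))(j := t))) has_vector_derivative
        D (\<beta>(j := Suc (\<beta> j))) ((x(i := x i - y))(j := x j))) (at (x j))"
      using x i by (intro smooth_familyD[OF D j]) simp
    moreover have "(x(i := x i - y))(j := x j) = x(i := x i - y)" using False by auto
    ultimately show ?thesis using False by (simp add: fun_upd_twist)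
  qed
  then show "((\<lambda>t. on_Rd d (\<lambda>x. D \<beta> (x(i := x i - y))) (x(j := t))) has_vector_derivative
      on_Rd d (\<lambda>x. D (\<beta>(j := Suc (\<beta> j))) (x(i := x i - y))) x) (at (x j))"
    using j x by (simp add: on_Rd_def)
qed (simp add: on_Rd_def)

lemma smooth_freeze:
  assumes D: "smooth_family d D" and i: "i < d" and g: "kernel_family g"
  shows "smooth_family d (\<lambda>\<beta>. on_Rd d (\<lambda>x. D (\<beta>(i := 0)) (x(i := y)) *
    (of_real (c ^ \<beta> i) * g (\<beta> i) ((x i - y) * c))))"
  unfolding smooth_family_def
proof (intro conjI allI impI)
  fix \<beta> j x assume j: "j < d" and x: "x \<in> Rd d"
  let ?F = "\<lambda>\<beta> x. D (\<beta>(i := 0)) (x(i := y)) * (of_real (c ^ \<beta> i) * g (\<beta> i) ((x i - y) * c))"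
  have "((\<lambda>t. ?F \<beta> (x(j := t))) has_vector_derivative ?F (\<beta>(j := Suc (\<beta> j))) x) (at (x j))"
  proof (cases "j = i")
    case True
    have "(g (\<beta> i) \<circ> (\<lambda>t. (t - y) * c) has_vector_derivative c *\<^sub>R g (Suc (\<beta> i)) ((x i - y) * c)) (at (x i))"
      using g unfolding kernel_family_def
      by (intro vector_diff_chain_at)
         (auto intro!: derivative_eq_intros simp: has_real_derivative_iff_has_vector_derivative[symmetric])
    then have "((\<lambda>t. D (\<beta>(i := 0)) (x(i := y)) * (of_real (c ^ \<beta> i) * g (\<beta> i) ((t - y) * c))) has_vector_derivative
      D (\<beta>(i := 0)) (x(i := y)) * (of_real (c ^ \<beta> i) * (c *\<^sub>R g (Suc (\<beta> i)) ((x i - y) * c)))) (at (x i))"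
      unfolding o_def by (intro has_vector_derivative_mult_right)
    then show ?thesis using True by (simp add: scaleR_conv_of_real mult_ac)
  next
    case False
    then have "((\<lambda>t. D (\<beta>(i := 0)) ((x(i := y))(j := t))) has_vector_derivative
        D ((\<beta>(i := 0))(j := Suc ((\<beta>(i := 0)) j))) ((x(i := y))(j := x j))) (at (x j))"
      using x i by (intro smooth_familyD[OF D j]) simp
    moreover have "(x(i := y))(j := x j) = x(i := y)" using False by auto
    moreover have "(\<beta>(i := 0))(j := Suc ((\<beta>(i := 0)) j)) = (\<beta>(j := Suc (\<beta> j)))(i := 0)"
      using False by auto
    ultimately have "((\<lambda>t. D (\<beta>(i := 0)) ((x(i := y))(j := t))) has_vector_derivative
        D ((\<beta>(j := Suc (\<beta> j)))(i := 0)) (x(i := y))) (at (x j))" by simp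
    from has_vector_derivative_mult_left[OF this, of "of_real (c ^ \<beta> i) * g (\<beta> i) ((x i - y) * c)"]
    show ?thesis using False by (simp add: fun_upd_twist)
  qed
  then show "((\<lambda>t. on_Rd d (?F \<beta>) (x(j := t))) has_vector_derivative
      on_Rd d (?F (\<beta>(j := Suc (\<beta> j)))) x) (at (x j))"
    using j x by (simp add: on_Rd_def)
qed (simp add: on_Rd_def)

lemma weight_coordinate_le:
  assumes "i < d" "h > 0" "h \<le> h'"
  shows "gevrey (s i) h' (\<alpha> i) * (gevrey (\<sigma> i) h (\<beta> i) *
      (\<Prod>j\<in>{..<d}-{i}. gevrey (s j) h (\<alpha> j) * gevrey (\<sigma> j) h (\<beta> j))) \<le> weight d s \<sigma> h' \<alpha> \<beta>"
  unfolding weight_split[OF assms(1)] mult.assoc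
  by (intro mult_left_mono mult_mono gevrey_mono prod_mono conjI prod_nonneg mult_nonneg_nonneg)
     (use assms in auto)

text \<open>The value of a kernel at \<open>t\<close> pays for the translation by a multiple of \<open>t\<close>, and for a
  summable weight besides.\<close>

lemma bound_translate_term:
  assumes D: "bound_family d s \<sigma> h C D" and g: "kernel_bound (s i) (\<sigma> i) h Cg g"
    and i: "i < d" and si: "s i \<ge> 0" and h: "h > 0" and \<delta>: "0 < \<delta>" "\<delta> \<le> 1"
  shows "bound_family d s \<sigma> ((1 + 4 powr s i) * h) (C * Cg * (1 + h\<^sup>2 * 2 powr s i) / (1 + t\<^sup>2))
    (\<lambda>\<beta> x. g 0 t * on_Rd d (\<lambda>x. D \<beta> (x(i := x i - \<delta> * t))) x)"
  unfolding bound_family_def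
proof (intro allI ballI)
  fix \<alpha> \<beta> x assume x: "x \<in> Rd d"
  let ?z = "x i - \<delta> * t" and ?h' = "(1 + 4 powr s i) * h" and ?q = "1 + h\<^sup>2 * 2 powr s i"
  let ?P = "\<Prod>j\<in>{..<d}-{i}. \<bar>x j\<bar> ^ \<alpha> j"
  let ?W = "gevrey (\<sigma> i) h (\<beta> i) * (\<Prod>j\<in>{..<d}-{i}. gevrey (s j) h (\<alpha> j) * gevrey (\<sigma> j) h (\<beta> j))"
  let ?A = "(1 + \<bar>t\<bar>\<^sup>2) * cmod (g 0 t)" and ?B = "?P * cmod (D \<beta> (x(i := ?z)))"
  have C: "C \<ge> 0" by (rule bound_family_nonneg[OF D])
  have hA: "\<bar>t\<bar> ^ a * ?A \<le> (Cg * ?q) * gevrey (s i) (4 powr s i * h) a" for a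
  proof (rule gevrey_decay[OF si h])
    show "\<bar>t\<bar> ^ a * cmod (g 0 t) \<le> Cg * gevrey (s i) h a" for a
      using g[unfolded kernel_bound_def, rule_format, of t a 0] by simp
  qed auto
  have hB: "\<bar>?z\<bar> ^ a * ?B \<le> (C * ?W) * gevrey (s i) h a" for a
    using bound_family_line[OF D i x, of ?z a \<alpha> \<beta> "\<beta> i"] by simp
  have P: "?P \<ge> 0" by (intro prod_nonneg) auto
  have Cg: "Cg \<ge> 0" by (rule kernel_bound_nonneg[OF g])
  have sum: "(\<bar>t\<bar> + \<bar>?z\<bar>) ^ \<alpha> i * (?A * ?B) \<le> (Cg * ?q * (C * ?W)) * gevrey (s i) (4 powr s i * h + h) (\<alpha> i)"
    by (rule gevrey_power_add_bound[OF si _ _ _ _ _ _ hA hB]) (use h P in auto)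
  have "\<bar>x i\<bar> \<le> \<bar>t\<bar> + \<bar>?z\<bar>"
  proof -
    have "\<bar>\<delta> * t\<bar> \<le> \<bar>t\<bar>" using \<delta> mult_right_mono[of \<delta> 1 "\<bar>t\<bar>"] by (simp add: abs_mult)
    then show ?thesis by linarith
  qed
  then have "\<bar>x i\<bar> ^ \<alpha> i * (?A * ?B) \<le> (\<bar>t\<bar> + \<bar>?z\<bar>) ^ \<alpha> i * (?A * ?B)"
    using P by (intro mult_right_mono power_mono) auto
  also note sum
  also have "(Cg * ?q * (C * ?W)) * gevrey (s i) (4 powr s i * h + h) (\<alpha> i)
      = (C * Cg * ?q) * (gevrey (s i) ?h' (\<alpha> i) * ?W)" by (simp add: algebra_simps)
  also have "\<dots> \<le> (C * Cg * ?q) * weight d s \<sigma> ?h' \<alpha> \<beta>"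
    by (intro mult_left_mono weight_coordinate_le) (use C Cg h i in \<open>auto simp: algebra_simps\<close>)
  finally have *: "\<bar>x i\<bar> ^ \<alpha> i * (?A * ?B) \<le> (C * Cg * ?q) * weight d s \<sigma> ?h' \<alpha> \<beta>" .
  have pos: "1 + t\<^sup>2 > 0" by (simp add: add_pos_nonneg)
  have eq: "(1 + t\<^sup>2) * (\<bar>monomial d \<alpha> x\<bar> * cmod (g 0 t * D \<beta> (x(i := ?z)))) = \<bar>x i\<bar> ^ \<alpha> i * (?A * ?B)"
    by (simp add: monomial_split[OF i] norm_mult mult_ac)
  from * have "(1 + t\<^sup>2) * (\<bar>monomial d \<alpha> x\<bar> * cmod (g 0 t * D \<beta> (x(i := ?z))))
      \<le> (C * Cg * ?q) * weight d s \<sigma> ?h' \<alpha> \<beta>" by (simp only: eq)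
  then have "\<bar>monomial d \<alpha> x\<bar> * cmod (g 0 t * D \<beta> (x(i := ?z)))
      \<le> (C * Cg * ?q) * weight d s \<sigma> ?h' \<alpha> \<beta> / (1 + t\<^sup>2)"
    using pos by (simp only: pos_le_divide_eq mult.commute)
  then show "\<bar>monomial d \<alpha> x\<bar> * cmod (g 0 t * on_Rd d (\<lambda>x. D \<beta> (x(i := x i - \<delta> * t))) x)
      \<le> C * Cg * ?q / (1 + t\<^sup>2) * weight d s \<sigma> ?h' \<alpha> \<beta>"
    using x by (simp add: on_Rd_def)
qed

text \<open>
  Dually, here \<open>f\<close> has decay in \<open>\<delta> * t\<close>, which pays for the translation of the kernel. The rescaling of
  the kernel costs powers of \<open>1 / \<delta>\<close>, so that this bound serves for fixed \<open>\<delta>\<close> only.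
\<close>

lemma bound_freeze_term:
  assumes D: "bound_family d s \<sigma> h C D" and g: "kernel_bound (s i) (\<sigma> i) h Cg g"
    and i: "i < d" and si: "s i \<ge> 0" and h: "h > 0" and \<delta>: "0 < \<delta>" "\<delta> \<le> 1"
  shows "bound_family d s \<sigma> ((1 + 4 powr s i) * h / \<delta>) (C * Cg * (1 + h\<^sup>2 * 2 powr s i) / \<delta>\<^sup>2 / (1 + t\<^sup>2))
    (\<lambda>\<beta>. on_Rd d (\<lambda>x. D (\<beta>(i := 0)) (x(i := \<delta> * t)) *
      (of_real ((1 / \<delta>) ^ \<beta> i) * g (\<beta> i) ((x i - \<delta> * t) * (1 / \<delta>)))))"
  unfolding bound_family_def
proof (intro allI ballI)
  fix \<alpha> \<beta> x assume x: "x \<in> Rd d"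
  let ?y = "\<delta> * t" and ?h' = "(1 + 4 powr s i) * h / \<delta>" and ?q = "1 + h\<^sup>2 * 2 powr s i"
  let ?w = "(x i - ?y) * (1 / \<delta>)"
  let ?P = "\<Prod>j\<in>{..<d}-{i}. \<bar>x j\<bar> ^ \<alpha> j"
  let ?W = "\<Prod>j\<in>{..<d}-{i}. gevrey (s j) h (\<alpha> j) * gevrey (\<sigma> j) h (\<beta> j)"
  let ?X = "?P * cmod (D (\<beta>(i := 0)) (x(i := ?y)))"
  let ?A = "(1 + \<bar>?y\<bar>\<^sup>2) * ?X" and ?B = "cmod (g (\<beta> i) ?w)"
  have C: "C \<ge> 0" by (rule bound_family_nonneg[OF D])
  have P: "?P \<ge> 0" by (intro prod_nonneg) auto
  have W: "?W \<ge> 0" using h by (intro prod_nonneg) auto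
  have Cg: "Cg \<ge> 0" by (rule kernel_bound_nonneg[OF g])
  have hA: "\<bar>?y\<bar> ^ a * ?A \<le> (C * ?W * ?q) * gevrey (s i) (4 powr s i * h) a" for a
  proof (rule gevrey_decay[OF si h])
    show "\<bar>?y\<bar> ^ a * ?X \<le> (C * ?W) * gevrey (s i) h a" for a
      using bound_family_line[OF D i x, of ?y a \<alpha> \<beta> 0] by simp
  qed (use P in auto)
  have hB: "\<bar>?w\<bar> ^ a * ?B \<le> (Cg * gevrey (\<sigma> i) h (\<beta> i)) * gevrey (s i) h a" for a
    using g[unfolded kernel_bound_def, rule_format, of ?w a "\<beta> i"] by (simp only: mult_ac)
  have sum: "(\<bar>?y\<bar> + \<bar>?w\<bar>) ^ \<alpha> i * (?A * ?B)
      \<le> (C * ?W * ?q * (Cg * gevrey (\<sigma> i) h (\<beta> i))) * gevrey (s i) (4 powr s i * h + h) (\<alpha> i)"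
    by (rule gevrey_power_add_bound[OF si _ _ _ _ _ _ hA hB]) (use h P in auto)
  have "\<bar>x i\<bar> \<le> \<bar>?y\<bar> + \<bar>?w\<bar>"
  proof -
    have "\<bar>x i - ?y\<bar> \<le> \<bar>x i - ?y\<bar> / \<delta>" using \<delta> mult_left_mono[of \<delta> 1 "\<bar>x i - ?y\<bar>"] by (simp add: field_simps)
    then have "\<bar>x i - ?y\<bar> \<le> \<bar>?w\<bar>" using \<delta> by (simp add: abs_mult)
    then show ?thesis by linarith
  qed
  then have "\<bar>x i\<bar> ^ \<alpha> i * (?A * ?B) \<le> (\<bar>?y\<bar> + \<bar>?w\<bar>) ^ \<alpha> i * (?A * ?B)"
    using P by (intro mult_right_mono power_mono) auto
  also note sum
  also have "(C * ?W * ?q * (Cg * gevrey (\<sigma> i) h (\<beta> i))) * gevrey (s i) (4 powr s i * h + h) (\<alpha> i)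
      \<le> (C * ?W * ?q * (Cg * gevrey (\<sigma> i) h (\<beta> i))) * gevrey (s i) ?h' (\<alpha> i)"
  proof (rule mult_left_mono[OF gevrey_mono])
    show "4 powr s i * h + h \<le> ?h'"
      using \<delta> h mult_left_mono[of \<delta> 1 "(1 + 4 powr s i) * h"] by (simp add: field_simps)
  qed (use C Cg W h in auto)
  finally have *: "\<bar>x i\<bar> ^ \<alpha> i * (?A * ?B) \<le> (C * Cg * ?q) * (gevrey (s i) ?h' (\<alpha> i) * (gevrey (\<sigma> i) h (\<beta> i) * ?W))"
    by (simp only: mult_ac)
  have scale: "(1 / \<delta>) ^ \<beta> i * gevrey (\<sigma> i) h (\<beta> i) = gevrey (\<sigma> i) (h / \<delta>) (\<beta> i)"
    using gevrey_scale[of "\<sigma> i" "1 / \<delta>" h "\<beta> i"] by simp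
  have hd: "h \<le> h / \<delta>" using \<delta> h by (simp add: field_simps)
  have "(1 / \<delta>) ^ \<beta> i * (\<bar>x i\<bar> ^ \<alpha> i * (?A * ?B))
      \<le> (1 / \<delta>) ^ \<beta> i * ((C * Cg * ?q) * (gevrey (s i) ?h' (\<alpha> i) * (gevrey (\<sigma> i) h (\<beta> i) * ?W)))"
    using \<delta> by (intro mult_left_mono *) auto
  also have "\<dots> = (C * Cg * ?q) * (gevrey (s i) ?h' (\<alpha> i) * (gevrey (\<sigma> i) (h / \<delta>) (\<beta> i) * ?W))"
    by (simp only: scale[symmetric] mult_ac)
  also have "\<dots> \<le> (C * Cg * ?q) * (gevrey (s i) ?h' (\<alpha> i) * (gevrey (\<sigma> i) (h / \<delta>) (\<beta> i) *
      (\<Prod>j\<in>{..<d}-{i}. gevrey (s j) (h / \<delta>) (\<alpha> j) * gevrey (\<sigma> j) (h / \<delta>) (\<beta> j))))"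
    by (intro mult_left_mono prod_mono conjI mult_mono gevrey_mono)
       (use C Cg h hd \<delta> in auto)
  also have "\<dots> \<le> (C * Cg * ?q) * weight d s \<sigma> ?h' \<alpha> \<beta>"
    by (intro mult_left_mono weight_coordinate_le) (use C Cg h i \<delta> in \<open>auto simp: divide_right_mono\<close>)
  finally have **: "(1 / \<delta>) ^ \<beta> i * (\<bar>x i\<bar> ^ \<alpha> i * (?A * ?B)) \<le> (C * Cg * ?q) * weight d s \<sigma> ?h' \<alpha> \<beta>" .
  let ?L = "\<bar>monomial d \<alpha> x\<bar> * cmod (D (\<beta>(i := 0)) (x(i := ?y)) * (of_real ((1 / \<delta>) ^ \<beta> i) * g (\<beta> i) ?w))"
  have eq: "(1 + ?y\<^sup>2) * ?L = (1 / \<delta>) ^ \<beta> i * (\<bar>x i\<bar> ^ \<alpha> i * (?A * ?B))"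
    using \<delta> by (simp add: monomial_split[OF i] norm_mult norm_power norm_divide mult_ac)
  from ** have ***: "(1 + ?y\<^sup>2) * ?L \<le> (C * Cg * ?q) * weight d s \<sigma> ?h' \<alpha> \<beta>" by (simp only: eq)
  have pos: "1 + t\<^sup>2 > 0" by (simp add: add_pos_nonneg)
  have "\<delta>\<^sup>2 \<le> 1" using \<delta> by (simp add: power_le_one)
  then have "\<delta>\<^sup>2 * (1 + t\<^sup>2) \<le> 1 + ?y\<^sup>2" by (simp add: algebra_simps)
  then have "(\<delta>\<^sup>2 * (1 + t\<^sup>2)) * ?L \<le> (1 + ?y\<^sup>2) * ?L" by (rule mult_right_mono) simp
  then have "(\<delta>\<^sup>2 * (1 + t\<^sup>2)) * ?L \<le> (C * Cg * ?q) * weight d s \<sigma> ?h' \<alpha> \<beta>" using *** by linarith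
  moreover have "\<delta>\<^sup>2 * (1 + t\<^sup>2) > 0" using \<delta> pos by simp
  ultimately have "?L \<le> (C * Cg * ?q) * weight d s \<sigma> ?h' \<alpha> \<beta> / (\<delta>\<^sup>2 * (1 + t\<^sup>2))"
    by (simp only: pos_le_divide_eq mult.commute)
  then show "\<bar>monomial d \<alpha> x\<bar> * cmod (on_Rd d (\<lambda>x. D (\<beta>(i := 0)) (x(i := ?y)) *
      (of_real ((1 / \<delta>) ^ \<beta> i) * g (\<beta> i) ((x i - ?y) * (1 / \<delta>)))) x)
      \<le> C * Cg * ?q / \<delta>\<^sup>2 / (1 + t\<^sup>2) * weight d s \<sigma> ?h' \<alpha> \<beta>"
    using x by (simp add: on_Rd_def)
qed

lemma gs_bounded_translate_term:
  assumes f: "gs_bounded d s \<sigma> h C f" and g: "kernel_bound (s i) (\<sigma> i) h Cg g"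
    and "i < d" "s i \<ge> 0" "h > 0" "0 < \<delta>" "\<delta> \<le> 1"
  shows "gs_bounded d s \<sigma> ((1 + 4 powr s i) * h) (C * Cg * (1 + h\<^sup>2 * 2 powr s i) / (1 + t\<^sup>2))
    (\<lambda>x. g 0 t * on_Rd d (\<lambda>x. f (x(i := x i - \<delta> * t))) x)"
  by (rule gs_boundedI[OF smooth_family_mult[OF smooth_translate[OF gs_boundedD(1)[OF f]]]
        bound_translate_term[OF gs_boundedD(2)[OF f] g]]) (use assms in auto)

lemma gs_bounded_freeze_term:
  assumes f: "gs_bounded d s \<sigma> h C f" and g: "kernel_family g" "kernel_bound (s i) (\<sigma> i) h Cg g"
    and "i < d" "s i \<ge> 0" "h > 0" "0 < \<delta>" "\<delta> \<le> 1"
  shows "gs_bounded d s \<sigma> ((1 + 4 powr s i) * h / \<delta>) (C * Cg * (1 + h\<^sup>2 * 2 powr s i) / \<delta>\<^sup>2 / (1 + t\<^sup>2))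
    (on_Rd d (\<lambda>x. f (x(i := \<delta> * t)) * g 0 (x i / \<delta> - t)))"
proof (rule gs_boundedI[OF smooth_freeze[OF gs_boundedD(1)[OF f] _ g(1)] bound_freeze_term[OF gs_boundedD(2)[OF f] g(2)]])
  have "(x - \<delta> * t) * (1 / \<delta>) = x / \<delta> - t" for x using \<open>0 < \<delta>\<close> by (simp add: field_simps)
  moreover have "(\<lambda>_. 0)(i := 0) = (\<lambda>_. 0::nat)" by auto
  ultimately show "on_Rd d (\<lambda>x. f (x(i := \<delta> * t)) * g 0 (x i / \<delta> - t)) =
      on_Rd d (\<lambda>x. multi_deriv d ((\<lambda>_. 0)(i := 0)) f (x(i := \<delta> * t)) *
        (of_real ((1 / \<delta>) ^ 0) * g 0 ((x i - \<delta> * t) * (1 / \<delta>))))"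
    by simp
qed (use assms in auto)

section \<open>Mollification in one coordinate\<close>

text \<open>
  Riemann sums for the two ways to write the convolution of \<open>f\<close> in coordinate \<open>i\<close> with the kernel scaled
  by \<open>\<delta>\<close>: the translation acts on \<open>f\<close> in the first one and on the kernel in the second.
\<close>

definition translate_sum ::
    "nat \<Rightarrow> nat \<Rightarrow> (nat \<Rightarrow> real \<Rightarrow> complex) \<Rightarrow> real \<Rightarrow> nat \<Rightarrow> ((nat \<Rightarrow> real) \<Rightarrow> complex) \<Rightarrow> (nat \<Rightarrow> real) \<Rightarrow> complex"
  where "translate_sum d i g \<delta> n f x = (\<Sum>k\<in>grid n. of_real (mesh n) *
    (g 0 (mesh n * of_int k) * on_Rd d (\<lambda>x. f (x(i := x i - \<delta> * (mesh n * of_int k)))) x))"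

definition freeze_sum ::
    "nat \<Rightarrow> nat \<Rightarrow> (nat \<Rightarrow> real \<Rightarrow> complex) \<Rightarrow> real \<Rightarrow> nat \<Rightarrow> ((nat \<Rightarrow> real) \<Rightarrow> complex) \<Rightarrow> (nat \<Rightarrow> real) \<Rightarrow> complex"
  where "freeze_sum d i g \<delta> n f x = (\<Sum>k\<in>grid n. of_real (mesh n) *
    on_Rd d (\<lambda>x. f (x(i := \<delta> * (mesh n * of_int k))) * g 0 (x i / \<delta> - mesh n * of_int k)) x)"

definition kernel_sum :: "(nat \<Rightarrow> real \<Rightarrow> complex) \<Rightarrow> nat \<Rightarrow> complex"
  where "kernel_sum g n = (\<Sum>k\<in>grid n. of_real (mesh n) * g 0 (mesh n * of_int k))"

lemma sum_grid_weight_le: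
  assumes "n \<ge> 1" "C \<ge> 0"
  shows "(\<Sum>k\<in>grid n. mesh n * (C / (1 + (mesh n * of_int k)\<^sup>2))) \<le> 5 * C"
proof -
  have "(\<Sum>k\<in>grid n. mesh n * (C / (1 + (mesh n * of_int k)\<^sup>2)))
      = C * (\<Sum>k\<in>grid n. mesh n / (1 + (mesh n * of_int k)\<^sup>2))"
    by (simp add: sum_distrib_left mult_ac)
  also have "\<dots> \<le> C * 5" by (intro mult_left_mono sum_grid_le assms)
  finally show ?thesis by simp
qed

lemma gs_bounded_grid_sum:
  assumes n: "n \<ge> 1" and h: "h > 0" and C: "C \<ge> 0"
    and F: "\<And>k. gs_bounded d s \<sigma> h (C / (1 + (mesh n * of_int k)\<^sup>2)) (F k)"
  shows "gs_bounded d s \<sigma> h (5 * C) (\<lambda>x. \<Sum>k\<in>grid n. of_real (mesh n) * F k x)"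
proof -
  have "gs_bounded d s \<sigma> h (\<Sum>k\<in>grid n. mesh n * (C / (1 + (mesh n * of_int k)\<^sup>2)))
      (\<lambda>x. \<Sum>k\<in>grid n. of_real (mesh n) * F k x)"
  proof (rule gs_bounded_sum[OF finite_grid])
    fix k
    show "gs_bounded d s \<sigma> h (mesh n * (C / (1 + (mesh n * of_int k)\<^sup>2))) (\<lambda>x. of_real (mesh n) * F k x)"
      using gs_bounded_mult[OF F[of k], of "of_real (mesh n)"] mesh_pos[OF n] by simp
  qed
  then show ?thesis using sum_grid_weight_le[OF n C] h gs_bounded_mono by blast
qed

lemma kernel_decay:
  assumes g: "kernel_bound s \<sigma> h C g" and "s \<ge> 0" "h > 0"
  shows "\<bar>t\<bar> ^ a * ((1 + t\<^sup>2) * cmod (g 0 t)) \<le> (C * (1 + h\<^sup>2 * 2 powr s)) * gevrey s (4 powr s * h) a"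
proof -
  have "\<bar>t\<bar> ^ a * ((1 + \<bar>t\<bar>\<^sup>2) * cmod (g 0 t)) \<le> (C * (1 + h\<^sup>2 * 2 powr s)) * gevrey s (4 powr s * h) a"
  proof (rule gevrey_decay[OF assms(2,3)])
    show "\<bar>t\<bar> ^ a * cmod (g 0 t) \<le> C * gevrey s h a" for a
      using g[unfolded kernel_bound_def, rule_format, of t a 0] by simp
  qed auto
  then show ?thesis by simp
qed

lemma gs_bounded_point: "gs_bounded d s \<sigma> h C f \<Longrightarrow> x \<in> Rd d \<Longrightarrow> cmod (f x) \<le> C"
  using bound_family_sup[OF gs_boundedD(2), of d s \<sigma> h C f x "\<lambda>_. 0"] by simp

lemma gs_bounded_increment:
  assumes f: "gs_bounded d s \<sigma> h C f" and i: "i < d" and x: "x \<in> Rd d"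
  shows "cmod (f (x(i := t)) - f (x(i := t'))) \<le> (C * weight d s \<sigma> h (\<lambda>_. 0) ((\<lambda>_. 0)(i := 1))) * \<bar>t - t'\<bar>"
  using smooth_family_increment[OF gs_boundedD(1)[OF f] i x, of "\<lambda>_. 0" _ t t'] bound_family_sup[OF gs_boundedD(2)[OF f]]
  by (simp add: One_nat_def[symmetric] del: One_nat_def)

lemma gs_bounded_coordinate_decay:
  assumes f: "gs_bounded d s \<sigma> h C f" and i: "i < d" and x: "x \<in> Rd d" and "s i \<ge> 0" "h > 0"
  shows "(1 + y\<^sup>2) * cmod (f (x(i := y))) \<le> C * (1 + h\<^sup>2 * 2 powr s i)"
proof -
  have "\<bar>y\<bar> ^ 0 * ((1 + \<bar>y\<bar>\<^sup>2) * cmod (f (x(i := y)))) \<le> (C * (1 + h\<^sup>2 * 2 powr s i)) * gevrey (s i) (4 powr s i * h) 0"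
  proof (rule gevrey_decay[OF assms(4,5)])
    have "(\<lambda>_. 0)(i := 0) = (\<lambda>_. 0::nat)" by auto
    then show "\<bar>y\<bar> ^ a * cmod (f (x(i := y))) \<le> C * gevrey (s i) h a" for a
      using bound_family_line[OF gs_boundedD(2)[OF f] i x, of y a "\<lambda>_. 0" "\<lambda>_. 0" 0] by simp
  qed auto
  then show ?thesis by simp
qed

text \<open>
  The translates move by at most \<open>\<delta>\<close> times a kernel argument, so their weighted sum is uniformly
  close to a multiple of \<open>f\<close>, and it is bounded in norm independently of \<open>\<delta>\<close>.
\<close>

lemma translate_sum_close:
  assumes f: "gs_bounded d s \<sigma> h C f" and g: "kernel_bound (s i) (\<sigma> i) h Cg g"
    and i: "i < d" and si: "s i \<ge> 0" and h: "h > 0" and "e > 0"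
  shows "\<exists>\<delta>>0. \<delta> \<le> 1 \<and> (\<forall>n\<ge>1. gs_bounded d s \<sigma> (2 * ((1 + 4 powr s i) * h)) e
    (\<lambda>x. translate_sum d i g \<delta> n f x - kernel_sum g n * f x))"
proof -
  let ?c = "1 + 4 powr s i" and ?q = "1 + h\<^sup>2 * 2 powr s i"
  have C: "C \<ge> 0" by (rule gs_bounded_nonneg[OF f])
  have Cg: "Cg \<ge> 0" by (rule kernel_bound_nonneg[OF g])
  define C1 where "C1 = 5 * (C * Cg * ?q) + 5 * (Cg * ?q) * C"
  have hc: "?c * h > 0" using h by (simp add: add_pos_nonneg)
  have A: "gs_bounded d s \<sigma> (?c * h) (5 * (C * Cg * ?q)) (translate_sum d i g \<delta> n f)"
    if "0 < \<delta>" "\<delta> \<le> 1" "n \<ge> 1" for \<delta> n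
    unfolding translate_sum_def
    by (rule gs_bounded_grid_sum[OF that(3) hc _ gs_bounded_translate_term[OF f g i si h that(1,2)]])
       (use C Cg in auto)
  have S: "cmod (kernel_sum g n) \<le> 5 * (Cg * ?q)" if "n \<ge> 1" for n
  proof -
    have "cmod (kernel_sum g n) \<le> (\<Sum>k\<in>grid n. mesh n * (Cg * ?q / (1 + (mesh n * of_int k)\<^sup>2)))"
      unfolding kernel_sum_def
    proof (rule sum_norm_le)
      fix k :: int
      let ?t = "mesh n * of_int k"
      have "(1 + ?t\<^sup>2) * cmod (g 0 ?t) \<le> Cg * ?q" using kernel_decay[OF g si h, of ?t 0] by simp
      then have "cmod (g 0 ?t) \<le> Cg * ?q / (1 + ?t\<^sup>2)"
        by (simp add: pos_le_divide_eq add_pos_nonneg mult.commute)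
      then show "cmod (of_real (mesh n) * g 0 ?t) \<le> mesh n * (Cg * ?q / (1 + ?t\<^sup>2))"
        using mesh_pos[OF that] by (simp only: norm_mult norm_of_real abs_of_pos mult_le_cancel_left_pos)
    qed
    also have "\<dots> \<le> 5 * (Cg * ?q)" using Cg by (intro sum_grid_weight_le that) auto
    finally show ?thesis .
  qed
  have bound: "gs_bounded d s \<sigma> (?c * h) C1 (\<lambda>x. translate_sum d i g \<delta> n f x - kernel_sum g n * f x)"
    if "0 < \<delta>" "\<delta> \<le> 1" "n \<ge> 1" for \<delta> n
    unfolding C1_def
  proof (rule gs_bounded_diff[OF A[OF that]])
    have "h \<le> ?c * h" using h by simp
    from gs_bounded_mono[OF gs_bounded_mult[OF f] h this mult_right_mono[OF S[OF that(3)] C]]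
    show "gs_bounded d s \<sigma> (?c * h) (5 * (Cg * ?q) * C) (\<lambda>x. kernel_sum g n * f x)" .
  qed
  define L where "L = C * weight d s \<sigma> h (\<lambda>_. 0) ((\<lambda>_. 0)(i := 1))"
  define M where "M = Cg * ?q * gevrey (s i) (4 powr s i * h) 1"
  have L: "L \<ge> 0" unfolding L_def using C h by simp
  have M: "M \<ge> 0" unfolding M_def using Cg h by (intro mult_nonneg_nonneg) auto
  have sup: "cmod (translate_sum d i g \<delta> n f x - kernel_sum g n * f x) \<le> \<delta> * (5 * (L * M))"
    if \<delta>: "0 < \<delta>" and n: "n \<ge> 1" and x: "x \<in> Rd d" for \<delta> n x
  proof -
    let ?t = "\<lambda>k::int. mesh n * of_int k"
    have eq: "translate_sum d i g \<delta> n f x - kernel_sum g n * f x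
        = (\<Sum>k\<in>grid n. of_real (mesh n) * (g 0 (?t k) * (f (x(i := x i - \<delta> * ?t k)) - f (x(i := x i)))))"
      unfolding translate_sum_def kernel_sum_def sum_distrib_right sum_subtractf[symmetric]
      using x by (intro sum.cong) (simp_all add: on_Rd_def algebra_simps)
    have "cmod (translate_sum d i g \<delta> n f x - kernel_sum g n * f x)
        \<le> (\<Sum>k\<in>grid n. mesh n * (\<delta> * (L * M) / (1 + (?t k)\<^sup>2)))"
      unfolding eq
    proof (rule sum_norm_le)
      fix k :: int
      have "\<bar>?t k\<bar> * ((1 + (?t k)\<^sup>2) * cmod (g 0 (?t k))) \<le> M"
        using kernel_decay[OF g si h, of "?t k" 1] by (simp add: M_def)
      then have gk: "\<bar>?t k\<bar> * cmod (g 0 (?t k)) \<le> M / (1 + (?t k)\<^sup>2)"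
        by (simp only: pos_le_divide_eq add_pos_nonneg zero_less_one zero_le_power2 mult_ac)
      have "cmod (f (x(i := x i - \<delta> * ?t k)) - f (x(i := x i))) \<le> L * \<bar>(x i - \<delta> * ?t k) - x i\<bar>"
        unfolding L_def by (rule gs_bounded_increment[OF f i x])
      also have "\<dots> = \<delta> * L * \<bar>?t k\<bar>" using \<delta> by (simp add: abs_mult)
      finally have "cmod (g 0 (?t k)) * cmod (f (x(i := x i - \<delta> * ?t k)) - f (x(i := x i)))
          \<le> cmod (g 0 (?t k)) * (\<delta> * L * \<bar>?t k\<bar>)" by (rule mult_left_mono) simp
      also have "\<dots> = \<delta> * L * (\<bar>?t k\<bar> * cmod (g 0 (?t k)))" by (simp only: mult_ac)
      also have "\<dots> \<le> \<delta> * L * (M / (1 + (?t k)\<^sup>2))" using \<delta> L by (intro mult_left_mono gk) auto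
      finally have "cmod (g 0 (?t k) * (f (x(i := x i - \<delta> * ?t k)) - f (x(i := x i)))) \<le> \<delta> * (L * M) / (1 + (?t k)\<^sup>2)"
        by (simp add: norm_mult mult_ac)
      then show "cmod (of_real (mesh n) * (g 0 (?t k) * (f (x(i := x i - \<delta> * ?t k)) - f (x(i := x i)))))
          \<le> mesh n * (\<delta> * (L * M) / (1 + (?t k)\<^sup>2))"
        using mesh_pos[OF n] by (simp only: norm_mult[of "of_real _"] norm_of_real abs_of_pos mult_le_cancel_left_pos)
    qed
    also have "\<dots> \<le> 5 * (\<delta> * (L * M))" using \<delta> L M by (intro sum_grid_weight_le n) auto
    finally show ?thesis by (simp only: mult_ac)
  qed
  obtain \<delta>0 where \<delta>0: "\<delta>0 > 0"
    "\<And>F. gs_bounded d s \<sigma> (?c * h) C1 F \<Longrightarrow> (\<forall>x\<in>Rd d. cmod (F x) \<le> \<delta>0) \<Longrightarrow> gs_bounded d s \<sigma> (2 * (?c * h)) e F"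
    using small_sup_small_norm[OF hc \<open>e > 0\<close>, of d s \<sigma> C1] by blast
  define \<delta> where "\<delta> = min 1 (\<delta>0 / (5 * (L * M) + 1))"
  have den: "5 * (L * M) + 1 > 0" using L M by (simp add: add_nonneg_pos)
  have \<delta>: "0 < \<delta>" "\<delta> \<le> 1" using \<delta>0(1) den by (auto simp: \<delta>_def)
  have "\<delta> * (5 * (L * M)) \<le> \<delta> * (5 * (L * M) + 1)" using \<delta> by (simp add: algebra_simps)
  also have "\<dots> \<le> \<delta>0 / (5 * (L * M) + 1) * (5 * (L * M) + 1)"
    using den by (intro mult_right_mono) (auto simp: \<delta>_def)
  also have "\<dots> = \<delta>0" using den by simp
  finally have "\<delta> * (5 * (L * M)) \<le> \<delta>0" .
  then have "gs_bounded d s \<sigma> (2 * (?c * h)) e (\<lambda>x. translate_sum d i g \<delta> n f x - kernel_sum g n * f x)" if "n \<ge> 1" for n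
    using sup[OF \<delta>(1) that] by (intro \<delta>0(2) bound \<delta> that) (auto intro: order_trans)
  then show ?thesis using \<delta> by blast
qed

text \<open>
  For fixed \<open>\<delta>\<close>, substituting in the convolution moves the translation from \<open>f\<close> to the kernel. On
  sums over the grid this substitution is only approximate, with an error that vanishes as the grid
  is refined.
\<close>

lemma freeze_sum_close:
  assumes f: "gs_bounded d s \<sigma> h C f" and g: "kernel_family g" "kernel_bound (s i) (\<sigma> i) h Cg g"
    and i: "i < d" and si: "s i \<ge> 0" and h: "h > 0" and "e > 0" and \<delta>: "0 < \<delta>" "\<delta> \<le> 1"
  shows "\<exists>N. \<forall>n\<ge>N. gs_bounded d s \<sigma> (2 * ((1 + 4 powr s i) * h / \<delta>)) e
    (\<lambda>x. translate_sum d i g \<delta> n f x - freeze_sum d i g \<delta> n f x)"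
proof -
  let ?c = "1 + 4 powr s i" and ?q = "1 + h\<^sup>2 * 2 powr s i"
  have C: "C \<ge> 0" by (rule gs_bounded_nonneg[OF f])
  have Cg: "Cg \<ge> 0" by (rule kernel_bound_nonneg[OF g(2)])
  define C1 where "C1 = 5 * (C * Cg * ?q) + 5 * (C * Cg * ?q / \<delta>\<^sup>2)"
  have hc: "?c * h > 0" using h by (simp add: add_pos_nonneg)
  have hc': "?c * h \<le> ?c * h / \<delta>" using \<delta> hc mult_left_mono[of \<delta> 1 "?c * h"] by (simp add: field_simps)
  have hcd: "?c * h / \<delta> > 0" using hc \<delta> by simp
  have bound: "gs_bounded d s \<sigma> (?c * h / \<delta>) C1 (\<lambda>x. translate_sum d i g \<delta> n f x - freeze_sum d i g \<delta> n f x)"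
    if "n \<ge> 1" for n
    unfolding C1_def
  proof (rule gs_bounded_diff)
    have "gs_bounded d s \<sigma> (?c * h) (5 * (C * Cg * ?q)) (translate_sum d i g \<delta> n f)"
      unfolding translate_sum_def
      by (rule gs_bounded_grid_sum[OF that hc _ gs_bounded_translate_term[OF f g(2) i si h \<delta>]]) (use C Cg in auto)
    then show "gs_bounded d s \<sigma> (?c * h / \<delta>) (5 * (C * Cg * ?q)) (translate_sum d i g \<delta> n f)"
      by (rule gs_bounded_mono[OF _ hc hc' order_refl])
    show "gs_bounded d s \<sigma> (?c * h / \<delta>) (5 * (C * Cg * ?q / \<delta>\<^sup>2)) (freeze_sum d i g \<delta> n f)"
      unfolding freeze_sum_def
      by (rule gs_bounded_grid_sum[OF that hcd _ gs_bounded_freeze_term[OF f g i si h \<delta>]]) (use C Cg in auto)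
  qed
  define L where "L = C * weight d s \<sigma> h (\<lambda>_. 0) ((\<lambda>_. 0)(i := 1))"
  define Lg where "Lg = Cg * gevrey (\<sigma> i) h 1"
  define M where "M = Cg * L + Lg * C"
  define C2 where "C2 = Cg * ?q * C / \<delta>\<^sup>2"
  have L: "L \<ge> 0" unfolding L_def using C h by simp
  have Lg: "Lg \<ge> 0" unfolding Lg_def using Cg h by simp
  have M: "M \<ge> 0" unfolding M_def using L Lg C Cg by simp
  have C2: "C2 \<ge> 0" unfolding C2_def using C Cg by simp
  have \<delta>2: "0 < \<delta>\<^sup>2" "\<delta>\<^sup>2 \<le> 1" using \<delta> by (auto simp: power_le_one)
  have g0: "cmod (g 0 t) \<le> Cg" and g1: "cmod (g 1 t) \<le> Lg" for t
    using g(2)[unfolded kernel_bound_def, rule_format, of t 0 0] g(2)[unfolded kernel_bound_def, rule_format, of t 0 1]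
    by (auto simp: Lg_def)
  have glip: "cmod (g 0 t - g 0 t') \<le> Lg * \<bar>t - t'\<bar>" for t t'
    using vector_mean_value_bound[of UNIV "g 0" "g 1" 0 Lg t' t] g(1) g1 by (simp add: kernel_family_def)
  have sup: "cmod (translate_sum d i g \<delta> n f x - freeze_sum d i g \<delta> n f x) \<le> (3 * M + 6 * C2) / real n"
    if n: "n \<ge> 1" and x: "x \<in> Rd d" for n x
  proof -
    define z where "z = x i / \<delta>"
    define A where "A t = g 0 t * f (x(i := x i - \<delta> * t))" for t
    have Az: "A (z - t) = f (x(i := \<delta> * t)) * g 0 (x i / \<delta> - t)" for t
      using \<delta> by (simp add: A_def z_def right_diff_distrib)
    have xi: "x(i := t) \<in> Rd d" for t using x i by simp
    have lip: "cmod (A t - A t') \<le> M * \<bar>t - t'\<bar>" for t t'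
    proof -
      let ?f = "\<lambda>t. f (x(i := x i - \<delta> * t))"
      have "A t - A t' = g 0 t * (?f t - ?f t') + (g 0 t - g 0 t') * ?f t'"
        by (simp add: A_def algebra_simps)
      then have "cmod (A t - A t') \<le> cmod (g 0 t) * cmod (?f t - ?f t') + cmod (g 0 t - g 0 t') * cmod (?f t')"
        by (metis norm_mult norm_triangle_ineq)
      also have "\<dots> \<le> Cg * (L * \<bar>t - t'\<bar>) + (Lg * \<bar>t - t'\<bar>) * C"
      proof (intro add_mono mult_mono g0 glip gs_bounded_point[OF f xi])
        have "cmod (?f t - ?f t') \<le> L * \<bar>(x i - \<delta> * t) - (x i - \<delta> * t')\<bar>"
          unfolding L_def by (rule gs_bounded_increment[OF f i x])
        also have "(x i - \<delta> * t) - (x i - \<delta> * t') = \<delta> * (t' - t)" by (simp add: algebra_simps)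
        also have "L * \<bar>\<delta> * (t' - t)\<bar> \<le> L * \<bar>t - t'\<bar>"
          using \<delta> L mult_right_mono[of \<delta> 1 "\<bar>t' - t\<bar>"] by (intro mult_left_mono) (auto simp: abs_mult)
        finally show "cmod (?f t - ?f t') \<le> L * \<bar>t - t'\<bar>" .
      qed (use Cg Lg in auto)
      finally show ?thesis by (simp add: M_def algebra_simps)
    qed
    have dec: "(1 + t\<^sup>2) * cmod (A t) \<le> C2" for t
    proof -
      have gk: "(1 + t\<^sup>2) * cmod (g 0 t) \<le> Cg * ?q" using kernel_decay[OF g(2) si h, of t 0] by simp
      have "(1 + t\<^sup>2) * cmod (A t) = ((1 + t\<^sup>2) * cmod (g 0 t)) * cmod (f (x(i := x i - \<delta> * t)))"
        by (simp add: A_def norm_mult)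
      also have "\<dots> \<le> (Cg * ?q) * C"
        using Cg by (intro mult_mono[OF gk gs_bounded_point[OF f xi]]) auto
      also have "\<dots> \<le> C2"
      proof -
        have "Cg * ?q * C * \<delta>\<^sup>2 \<le> Cg * ?q * C" using \<delta>2 C Cg by (intro mult_left_le) auto
        then show ?thesis using \<delta>2 unfolding C2_def by (simp only: pos_le_divide_eq)
      qed
      finally show ?thesis .
    qed
    have dec': "(1 + t\<^sup>2) * cmod (A (z - t)) \<le> C2" for t
    proof -
      have "\<delta>\<^sup>2 * (1 + t\<^sup>2) \<le> 1 + (\<delta> * t)\<^sup>2" using \<delta>2 by (simp add: algebra_simps)
      then have "(\<delta>\<^sup>2 * (1 + t\<^sup>2)) * cmod (f (x(i := \<delta> * t))) \<le> (1 + (\<delta> * t)\<^sup>2) * cmod (f (x(i := \<delta> * t)))"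
        by (rule mult_right_mono) simp
      also have "\<dots> \<le> C * ?q" by (rule gs_bounded_coordinate_decay[of d s \<sigma>]) (use f i x si h in auto)
      finally have *: "(\<delta>\<^sup>2 * (1 + t\<^sup>2)) * cmod (f (x(i := \<delta> * t))) \<le> C * ?q" .
      have "((\<delta>\<^sup>2 * (1 + t\<^sup>2)) * cmod (f (x(i := \<delta> * t)))) * cmod (g 0 (x i / \<delta> - t)) \<le> (C * ?q) * Cg"
        using C by (intro mult_mono * g0) auto
      then have "((1 + t\<^sup>2) * cmod (A (z - t))) * \<delta>\<^sup>2 \<le> Cg * ?q * C"
        by (simp only: Az norm_mult mult_ac)
      then show ?thesis using \<delta>2 unfolding C2_def by (simp only: pos_le_divide_eq)
    qed
    have "translate_sum d i g \<delta> n f x = (\<Sum>k\<in>grid n. of_real (mesh n) * A (mesh n * of_int k))"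
      using x by (simp add: translate_sum_def A_def on_Rd_def)
    moreover have "freeze_sum d i g \<delta> n f x = (\<Sum>k\<in>grid n. of_real (mesh n) * A (z - mesh n * of_int k))"
      using x by (simp add: freeze_sum_def Az on_Rd_def)
    ultimately show ?thesis using reflected_grid_sums_close[OF n M C2 lip dec dec'] by simp
  qed
  obtain \<delta>0 where \<delta>0: "\<delta>0 > 0"
    "\<And>F. gs_bounded d s \<sigma> (?c * h / \<delta>) C1 F \<Longrightarrow> (\<forall>x\<in>Rd d. cmod (F x) \<le> \<delta>0) \<Longrightarrow> gs_bounded d s \<sigma> (2 * (?c * h / \<delta>)) e F"
    using small_sup_small_norm[OF hcd \<open>e > 0\<close>, of d s \<sigma> C1] by blast
  define N where "N = nat \<lceil>(3 * M + 6 * C2) / \<delta>0\<rceil> + 1"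
  have "gs_bounded d s \<sigma> (2 * (?c * h / \<delta>)) e (\<lambda>x. translate_sum d i g \<delta> n f x - freeze_sum d i g \<delta> n f x)" if "n \<ge> N" for n
  proof (rule \<delta>0(2))
    have n: "n \<ge> 1" "(3 * M + 6 * C2) / \<delta>0 \<le> real n" using that unfolding N_def by linarith+
    show "gs_bounded d s \<sigma> (?c * h / \<delta>) C1 (\<lambda>x. translate_sum d i g \<delta> n f x - freeze_sum d i g \<delta> n f x)"
      by (rule bound[OF n(1)])
    have "(3 * M + 6 * C2) / real n \<le> \<delta>0" using n \<delta>0(1) by (simp add: field_simps)
    then show "\<forall>x\<in>Rd d. cmod (translate_sum d i g \<delta> n f x - freeze_sum d i g \<delta> n f x) \<le> \<delta>0"
      using sup[OF n(1)] order_trans by blast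
  qed
  then show ?thesis by blast
qed

text \<open>
  For unions over \<open>h\<close> the functional adapts to \<open>f\<close>, for intersections \<open>f\<close> adapts to the functional; in
  both cases a factor \<open>\<kappa>\<close> lost in an estimate is harmless.
\<close>

lemma common_parameter:
  assumes f: "f \<in> GS_space m d s \<sigma>" and u: "GS_functional m d s \<sigma> u" and "\<kappa> > 0"
  obtains h C K where "h > 0" "gs_bounded d s \<sigma> h C f" "op_bounded m d s \<sigma> (\<kappa> * h) K u"
proof (cases m)
  case True
  then obtain h C where h: "h > 0" "gs_bounded d s \<sigma> h C f" using f by (auto simp: GS_space_def)
  then have "\<kappa> * h > 0" using \<open>\<kappa> > 0\<close> by simp
  then obtain K where "op_bounded m d s \<sigma> (\<kappa> * h) K u"
    using u True by (auto simp: GS_functional_def)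
  then show thesis using that h by blast
next
  case False
  then obtain h0 K where h0: "h0 > 0" "op_bounded m d s \<sigma> h0 K u"
    using u by (auto simp: GS_functional_def)
  then have "h0 / \<kappa> > 0" using \<open>\<kappa> > 0\<close> by simp
  moreover from this obtain C where "gs_bounded d s \<sigma> (h0 / \<kappa>) C f" using f False by (auto simp: GS_space_def)
  moreover have "\<kappa> * (h0 / \<kappa>) = h0" using \<open>\<kappa> > 0\<close> by simp
  ultimately show thesis using that h0(2) by metis
qed

lemma GS_space_transfer:
  assumes f: "f \<in> GS_space m d s \<sigma>" and "\<kappa> > 0"
    and step: "\<And>h C. h > 0 \<Longrightarrow> gs_bounded d s \<sigma> h C f \<Longrightarrow> \<exists>C'. gs_bounded d' s' \<sigma>' (\<kappa> * h) C' F"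
  shows "F \<in> GS_space m d' s' \<sigma>'"
proof (cases m)
  case True
  then obtain h C where h: "h > 0" "gs_bounded d s \<sigma> h C f" using f by (auto simp: GS_space_def)
  then show ?thesis using step[OF h] True \<open>\<kappa> > 0\<close> mult_pos_pos unfolding GS_space_def by auto
next
  case False
  have "\<exists>C'. gs_bounded d' s' \<sigma>' h C' F" if "h > 0" for h
  proof -
    have "h / \<kappa> > 0" using that \<open>\<kappa> > 0\<close> by simp
    moreover from this obtain C where "gs_bounded d s \<sigma> (h / \<kappa>) C f" using f False by (auto simp: GS_space_def)
    ultimately show ?thesis using step[of "h / \<kappa>" C] \<open>\<kappa> > 0\<close> by simp
  qed
  then show ?thesis using False by (simp add: GS_space_def)
qed

text \<open>
  If \<open>f\<close> is not zero, the squared modulus of its restriction to a line in direction \<open>i\<close> is a kernel in the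
  right class, whatever the exponents are. Mollification by this kernel approximates a nonzero multiple of
  \<open>f\<close> by sums of translates, these are close to sums of frozen terms, and the functional vanishes on the
  latter.
\<close>

lemma functional_zero_by_freezing:
  assumes u: "GS_functional m d s \<sigma> u" and f: "f \<in> GS_space m d s \<sigma>"
    and i: "i < d" and si: "s i \<ge> 0" and \<sigma>i: "\<sigma> i \<ge> 0"
    and frozen: "\<And>y q. on_Rd d (\<lambda>x. f (x(i := y)) * q (x i)) \<in> GS_space m d s \<sigma> \<Longrightarrow>
      u (on_Rd d (\<lambda>x. f (x(i := y)) * q (x i))) = 0"
  shows "u f = 0"
proof -
  let ?V = "GS_space m d s \<sigma>" and ?c = "1 + 4 powr s i"
  have lin: "linear_on_space ?V u" using u by (simp add: GS_functional_def)
  have c: "?c > 0" by (simp add: add_pos_nonneg)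
  obtain h1 C1 K1 where "gs_bounded d s \<sigma> h1 C1 f" using common_parameter[OF f u zero_less_one] by metis
  then have fC: "f \<in> Cinf d" by (rule gs_bounded_Cinf)
  show ?thesis
  proof (cases "\<exists>x0\<in>Rd d. f x0 \<noteq> 0")
    case False
    then have "f = (\<lambda>_. 0)" using fC by (auto simp: Cinf_def)
    then show ?thesis using linear_zero[OF lin] by simp
  next
    case True
    then obtain x0 where x0: "x0 \<in> Rd d" "f x0 \<noteq> 0" by blast
    define p where "p = line_family (\<lambda>\<beta>. multi_deriv d \<beta> f) i x0"
    define g where "g = modulus_square p"
    have p: "kernel_family p"
      unfolding p_def by (rule kernel_family_line_family[OF Cinf_smooth_family[OF fC] i x0(1)])
    have g: "kernel_family g" unfolding g_def by (rule kernel_family_modulus_square[OF p])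
    have gb: "\<exists>Cg. kernel_bound (s i) (\<sigma> i) (2 * h) Cg g" if "gs_bounded d s \<sigma> h C f" "h > 0" for h C
      using kernel_bound_modulus_square[OF kernel_bound_line_family[OF gs_boundedD(2)[OF that(1)] i x0(1)] that(2) \<sigma>i]
      unfolding g_def p_def by blast
    have zi: "(\<lambda>_. 0)(i := 0) = (\<lambda>_. 0::nat)" by auto
    have p0: "p 0 (x0 i) \<noteq> 0" using x0(2) by (simp add: p_def line_family_def zi)
    define G where "G t = (cmod (p 0 t))\<^sup>2" for t
    have g0: "g 0 t = of_real (G t)" for t by (simp add: g_def G_def modulus_square_0)
    have "isCont (p 0) t" for t
      using p by (auto simp: kernel_family_def intro: has_vector_derivative_continuous)
    then have "isCont G (x0 i)" unfolding G_def by (intro continuous_intros)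
    then obtain c0 N0 where c0: "c0 > 0"
      "\<And>n. n \<ge> N0 \<Longrightarrow> c0 \<le> (\<Sum>k\<in>grid n. mesh n * G (mesh n * of_int k))"
      using grid_sum_lower_bound[of "x0 i" G] p0 by (auto simp: G_def)
    have S: "c0 \<le> cmod (kernel_sum g n)" if "n \<ge> N0" for n
    proof -
      have "kernel_sum g n = of_real (\<Sum>k\<in>grid n. mesh n * G (mesh n * of_int k))"
        by (simp add: kernel_sum_def g0)
      then show ?thesis using c0(2)[OF that] by (simp only: norm_of_real)
    qed
    have memA: "(\<lambda>x. g 0 t * on_Rd d (\<lambda>x. f (x(i := x i - \<delta> * t))) x) \<in> ?V" if "0 < \<delta>" "\<delta> \<le> 1" for \<delta> t
    proof (rule GS_space_transfer[OF f, of "?c * 2"])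
      fix h C assume h: "h > 0" "gs_bounded d s \<sigma> h C f"
      obtain Cg where Cg: "kernel_bound (s i) (\<sigma> i) (2 * h) Cg g" using gb[OF h(2,1)] by blast
      have f2: "gs_bounded d s \<sigma> (2 * h) C f" by (rule gs_bounded_mono[OF h(2,1)]) (use h in auto)
      have eq: "?c * (2 * h) = ?c * 2 * h" by simp
      have "2 * h > 0" using h(1) by simp
      from gs_bounded_translate_term[where t = t, OF f2 Cg i si this that, unfolded eq]
      show "\<exists>C'. gs_bounded d s \<sigma> (?c * 2 * h) C' (\<lambda>x. g 0 t * on_Rd d (\<lambda>x. f (x(i := x i - \<delta> * t))) x)"
        by blast
    qed (use c in simp)
    have memB: "on_Rd d (\<lambda>x. f (x(i := \<delta> * t)) * g 0 (x i / \<delta> - t)) \<in> ?V" if "0 < \<delta>" "\<delta> \<le> 1" for \<delta> t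
    proof (rule GS_space_transfer[OF f, of "?c * 2 / \<delta>"])
      fix h C assume h: "h > 0" "gs_bounded d s \<sigma> h C f"
      obtain Cg where Cg: "kernel_bound (s i) (\<sigma> i) (2 * h) Cg g" using gb[OF h(2,1)] by blast
      have f2: "gs_bounded d s \<sigma> (2 * h) C f" by (rule gs_bounded_mono[OF h(2,1)]) (use h in auto)
      have eq: "?c * (2 * h) / \<delta> = ?c * 2 / \<delta> * h" by simp
      have "2 * h > 0" using h(1) by simp
      from gs_bounded_freeze_term[where t = t, OF f2 g Cg i si this that, unfolded eq]
      show "\<exists>C'. gs_bounded d s \<sigma> (?c * 2 / \<delta> * h) C' (on_Rd d (\<lambda>x. f (x(i := \<delta> * t)) * g 0 (x i / \<delta> - t)))"
        by blast
    qed (use c that in simp)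
    have memTA: "translate_sum d i g \<delta> n f \<in> ?V" and memTB: "freeze_sum d i g \<delta> n f \<in> ?V"
      if "0 < \<delta>" "\<delta> \<le> 1" for \<delta> n
      unfolding translate_sum_def[abs_def] freeze_sum_def[abs_def]
      by (intro GS_space_sum GS_space_mult memA[OF that] memB[OF that] finite_grid)+
    have uB: "u (freeze_sum d i g \<delta> n f) = 0" if "0 < \<delta>" "\<delta> \<le> 1" for \<delta> n
    proof -
      have "u (\<lambda>x. of_real (mesh n) * on_Rd d (\<lambda>x. f (x(i := \<delta> * t)) * g 0 (x i / \<delta> - t)) x) = 0" for t
        using frozen[of "\<delta> * t" "\<lambda>r. g 0 (r / \<delta> - t)"] memB[OF that] linear_mult[OF lin memB[OF that]]
        by simp
      then show ?thesis
        unfolding freeze_sum_def[abs_def]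
        by (subst linear_sum[OF lin finite_grid]) (auto intro!: GS_space_mult memB[OF that])
    qed
    \<comment> \<open>squaring the kernel doubles \<open>h\<close>, and so does the passage from the uniform norm\<close>
    obtain h C K where h: "h > 0" and fh: "gs_bounded d s \<sigma> h C f" and K: "op_bounded m d s \<sigma> (4 * ?c * h) K u"
      using common_parameter[OF f u, of "4 * ?c"] c by auto
    obtain Cg where Cg: "kernel_bound (s i) (\<sigma> i) (2 * h) Cg g" using gb[OF fh h] by blast
    have f2: "gs_bounded d s \<sigma> (2 * h) C f" by (rule gs_bounded_mono[OF fh h]) (use h in auto)
    have K0: "K \<ge> 0" using K by (simp add: op_bounded_def)
    have small: "c0 * cmod (u f) \<le> (K + 1) * e" if e: "e > 0" for e
    proof -
      obtain \<delta> where \<delta>: "0 < \<delta>" "\<delta> \<le> 1"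
        "\<And>n. n \<ge> 1 \<Longrightarrow> gs_bounded d s \<sigma> (2 * (?c * (2 * h))) e (\<lambda>x. translate_sum d i g \<delta> n f x - kernel_sum g n * f x)"
        using translate_sum_close[OF f2 Cg i si _ e] h by auto
      have "4 * ?c / \<delta> > 0" using c \<delta> by simp
      then obtain h' C' K' where h': "h' > 0" and fh': "gs_bounded d s \<sigma> h' C' f"
        and K': "op_bounded m d s \<sigma> (4 * ?c / \<delta> * h') K' u"
        using common_parameter[OF f u] by metis
      obtain Cg' where Cg': "kernel_bound (s i) (\<sigma> i) (2 * h') Cg' g" using gb[OF fh' h'] by blast
      have f2': "gs_bounded d s \<sigma> (2 * h') C' f" by (rule gs_bounded_mono[OF fh' h']) (use h' in auto)
      have K'0: "K' \<ge> 0" using K' by (simp add: op_bounded_def)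
      have "e / (K' + 1) > 0" using e K'0 by simp
      from freeze_sum_close[OF f2' g Cg' i si _ this \<delta>(1,2)] h' obtain N where N:
        "\<And>n. n \<ge> N \<Longrightarrow> gs_bounded d s \<sigma> (2 * (?c * (2 * h') / \<delta>)) (e / (K' + 1))
          (\<lambda>x. translate_sum d i g \<delta> n f x - freeze_sum d i g \<delta> n f x)" by auto
      define n where "n = max (max N N0) 1"
      let ?A = "translate_sum d i g \<delta> n f" and ?B = "freeze_sum d i g \<delta> n f"
      have AB: "?A \<in> ?V" "?B \<in> ?V" "(\<lambda>x. kernel_sum g n * f x) \<in> ?V"
        using memTA memTB \<delta> f by (auto intro: GS_space_mult)
      have "cmod (u (\<lambda>x. ?A x - kernel_sum g n * f x)) \<le> K * e"
      proof (rule op_boundedD[OF K GS_space_diff[OF AB(1,3)]])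
        have "2 * (?c * (2 * h)) = 4 * ?c * h" by simp
        then show "gs_bounded d s \<sigma> (4 * ?c * h) e (\<lambda>x. ?A x - kernel_sum g n * f x)"
          using \<delta>(3)[of n] unfolding n_def by (metis max.cobounded2)
      qed
      moreover have "cmod (u (\<lambda>x. ?A x - ?B x)) \<le> K' * (e / (K' + 1))"
      proof (rule op_boundedD[OF K' GS_space_diff[OF AB(1,2)]])
        have "2 * (?c * (2 * h') / \<delta>) = 4 * ?c / \<delta> * h'" by simp
        moreover have "n \<ge> N" by (simp add: n_def)
        ultimately show "gs_bounded d s \<sigma> (4 * ?c / \<delta> * h') (e / (K' + 1)) (\<lambda>x. ?A x - ?B x)" using N[of n] by metis
      qed
      moreover have "K' * (e / (K' + 1)) \<le> e" using K'0 e by (simp add: field_simps)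
      moreover have "u (\<lambda>x. ?A x - kernel_sum g n * f x) = u ?A - kernel_sum g n * u f"
        using linear_diff[OF lin AB(1,3)] linear_mult[OF lin f] by simp
      moreover have "u (\<lambda>x. ?A x - ?B x) = u ?A"
        using linear_diff[OF lin AB(1,2)] uB \<delta> by simp
      ultimately have "cmod (u ?A - kernel_sum g n * u f) \<le> K * e" "cmod (u ?A) \<le> e" by auto
      then have "cmod (kernel_sum g n * u f) \<le> (K + 1) * e"
        using norm_triangle_sub[of "kernel_sum g n * u f" "u ?A"]
          norm_minus_commute[of "kernel_sum g n * u f" "u ?A"]
        unfolding distrib_right mult_1 by linarith
      moreover have "c0 * cmod (u f) \<le> cmod (kernel_sum g n) * cmod (u f)"
        by (intro mult_right_mono S) (auto simp: n_def)
      ultimately show ?thesis by (simp add: norm_mult)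
    qed
    have "c0 * cmod (u f) \<le> 0"
    proof (rule field_le_epsilon)
      fix e :: real assume "e > 0"
      then have "c0 * cmod (u f) \<le> (K + 1) * (e / (K + 1))" using K0 by (intro small) simp
      then show "c0 * cmod (u f) \<le> 0 + e" using K0 by simp
    qed
    then show ?thesis using c0(1) by (simp add: mult_le_0_iff)
  qed
qed

section \<open>Products of functions of two groups of variables\<close>

lemma op_bounded_diff:
  assumes "op_bounded m d s \<sigma> h K u" "op_bounded m d s \<sigma> h K' v"
  shows "op_bounded m d s \<sigma> h (K + K') (\<lambda>f. u f - v f)"
  unfolding op_bounded_def
proof (intro conjI ballI allI impI)
  show "0 \<le> K + K'" using assms by (simp add: op_bounded_def)
  fix f C assume "f \<in> GS_space m d s \<sigma>" "gs_bounded d s \<sigma> h C f"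
  then have "cmod (u f) \<le> K * C" "cmod (v f) \<le> K' * C"
    using assms op_boundedD by blast+
  then show "cmod (u f - v f) \<le> (K + K') * C"
    using norm_triangle_ineq4[of "u f" "v f"] by (simp add: distrib_right)
qed

lemma GS_functional_diff:
  assumes u: "GS_functional m d s \<sigma> u" and v: "GS_functional m d s \<sigma> v"
  shows "GS_functional m d s \<sigma> (\<lambda>f. u f - v f)"
proof -
  let ?V = "GS_space m d s \<sigma>"
  have "linear_on_space ?V (\<lambda>f. u f - v f)"
    using u v by (auto simp: GS_functional_def linear_on_space_def algebra_simps)
  moreover have "\<exists>K. op_bounded m d s \<sigma> h K (\<lambda>f. u f - v f)" if mh: "m" "h > 0" for h
  proof -
    have "\<exists>K. op_bounded m d s \<sigma> h K u" "\<exists>K. op_bounded m d s \<sigma> h K v"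
      using u v mh by (simp_all add: GS_functional_def)
    then show ?thesis using op_bounded_diff by blast
  qed
  moreover have "\<exists>h>0. \<exists>K. op_bounded m d s \<sigma> h K (\<lambda>f. u f - v f)" if nm: "\<not> m"
  proof -
    obtain h1 K1 h2 K2 where h: "h1 > 0" "h2 > 0"
      "op_bounded m d s \<sigma> h1 K1 u" "op_bounded m d s \<sigma> h2 K2 v"
      using u v nm by (auto simp: GS_functional_def)
    then have "op_bounded m d s \<sigma> (min h1 h2) (K1 + K2) (\<lambda>f. u f - v f)"
      by (intro op_bounded_diff) (auto intro: op_bounded_antimono)
    moreover have "min h1 h2 > 0" using h by simp
    ultimately show ?thesis by blast
  qed
  ultimately show ?thesis by (simp add: GS_functional_def)
qed

lemma GS_functional_restrict:
  assumes "GS_functional m d s \<sigma> u"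
  shows "GS_functional m d s \<sigma> (restrict u (GS_space m d s \<sigma>))"
proof -
  let ?V = "GS_space m d s \<sigma>"
  have lin: "linear_on_space ?V (restrict u ?V) \<longleftrightarrow> linear_on_space ?V u"
    unfolding linear_on_space_def by (simp add: GS_space_add GS_space_mult)
  have bounded: "op_bounded m d s \<sigma> h K (restrict u ?V) \<longleftrightarrow> op_bounded m d s \<sigma> h K u" for h K
    by (simp add: op_bounded_def)
  show ?thesis using assms unfolding GS_functional_def lin bounded .
qed

lemma GS_space_Cinf: "f \<in> GS_space m d s \<sigma> \<Longrightarrow> f \<in> Cinf d"
  unfolding GS_space_def using gs_bounded_Cinf gt_ex[of "0::real"] by (auto split: if_splits)

lemma GS_space_off: "f \<in> GS_space m d s \<sigma> \<Longrightarrow> x \<notin> Rd d \<Longrightarrow> f x = 0"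
  using GS_space_Cinf by (auto simp: Cinf_def)

definition mix :: "nat \<Rightarrow> (nat \<Rightarrow> real) \<Rightarrow> (nat \<Rightarrow> real) \<Rightarrow> nat \<Rightarrow> real"
  where "mix j x y = (\<lambda>i. if i < j then x i else y i)"

text \<open>
  A nonzero function with this property is a product of a function of the first \<open>j\<close> coordinates and a
  function of the others. It holds for \<open>j = 0\<close>.
\<close>

definition splits_at :: "nat \<Rightarrow> nat \<Rightarrow> ((nat \<Rightarrow> real) \<Rightarrow> complex) \<Rightarrow> bool"
  where "splits_at d j f \<longleftrightarrow> (\<forall>x\<in>Rd d. \<forall>y\<in>Rd d. f x * f y = f (mix j x y) * f (mix j y x))"

lemma mix_Rd: "x \<in> Rd d \<Longrightarrow> y \<in> Rd d \<Longrightarrow> mix j x y \<in> Rd d"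
  by (auto simp: mix_def Rd_def PiE_iff extensional_def)

lemma splits_at_freeze:
  assumes f: "splits_at d j f" and j: "j < d"
  shows "splits_at d (Suc j) (on_Rd d (\<lambda>x. f (x(j := y)) * q (x j)))"
  unfolding splits_at_def
proof (intro ballI)
  fix x x' assume x: "x \<in> Rd d" "x' \<in> Rd d"
  have eq: "(mix (Suc j) x x')(j := y) = mix j (x(j := y)) (x'(j := y))" for x x'
    by (auto simp: mix_def less_Suc_eq)
  have "f (x(j := y)) * f (x'(j := y)) = f ((mix (Suc j) x x')(j := y)) * f ((mix (Suc j) x' x)(j := y))"
    unfolding eq using f x j by (simp add: splits_at_def)
  moreover have "mix (Suc j) x x' j = x j" "mix (Suc j) x' x j = x' j" by (simp_all add: mix_def)
  ultimately show "on_Rd d (\<lambda>x. f (x(j := y)) * q (x j)) x * on_Rd d (\<lambda>x. f (x(j := y)) * q (x j)) x'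
      = on_Rd d (\<lambda>x. f (x(j := y)) * q (x j)) (mix (Suc j) x x') *
        on_Rd d (\<lambda>x. f (x(j := y)) * q (x j)) (mix (Suc j) x' x)"
    using x by (simp add: on_Rd_def mix_Rd mult_ac)
qed

text \<open>
  Both ways to single out one of two blocks of variables.
\<close>

locale two_blocks =
  fixes d1 d2 :: nat
begin

sublocale fst_split: splitting d1 d2 "d1 + d2" "\<lambda>j. j < d1" "\<lambda>i. i" "\<lambda>i. d1 + i" "\<lambda>j. j" "\<lambda>j. j - d1"
  by standard auto

sublocale snd_split: splitting d2 d1 "d1 + d2" "\<lambda>j. \<not> j < d1" "\<lambda>i. d1 + i" "\<lambda>i. i" "\<lambda>j. j - d1" "\<lambda>j. j"
  by standard auto

lemma fst_split_slice: "fst_split.slice f x = slice_snd d1 d2 f x"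
  by (simp add: fst_split.slice_def slice_snd_def fst_split.merge_def pair_pt_def restrict_def)

lemma snd_split_slice: "snd_split.slice f x = slice_fst d1 d2 f x"
  by (simp add: snd_split.slice_def slice_fst_def snd_split.merge_def pair_pt_def restrict_def)
     (rule arg_cong[where f = "on_Rd d1"], rule ext, rule arg_cong[where f = f], auto)

text \<open>
  The factors are the slices through any point \<open>z\<close> at which the function does not vanish, and hence they
  lie in the spaces of the two blocks.
\<close>

lemma splits_at_imp_tensor:
  assumes f: "splits_at (d1 + d2) d1 f" and off: "\<And>x. x \<notin> Rd (d1 + d2) \<Longrightarrow> f x = 0"
    and z: "z \<in> Rd (d1 + d2)"
  shows "tensor d1 d2 (slice_fst d1 d2 f (snd_pt d1 d2 z)) (slice_snd d1 d2 f (fst_pt d1 d2 z)) = (\<lambda>x. f z * f x)"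
proof
  fix x
  show "tensor d1 d2 (slice_fst d1 d2 f (snd_pt d1 d2 z)) (slice_snd d1 d2 f (fst_pt d1 d2 z)) x = f z * f x"
  proof (cases "x \<in> Rd (d1 + d2)")
    case True
    have pair: "pair_pt d1 d2 (fst_pt d1 d2 x) (snd_pt d1 d2 y) = mix d1 x y"
      if "x \<in> Rd (d1 + d2)" "y \<in> Rd (d1 + d2)" for x y
      using that by (auto simp: pair_pt_def fst_pt_def snd_pt_def mix_def Rd_def PiE_iff extensional_def fun_eq_iff)
    have "fst_pt d1 d2 x \<in> Rd d1" "snd_pt d1 d2 x \<in> Rd d2"
      by (auto simp: fst_pt_def snd_pt_def Rd_def)
    moreover have "f x * f z = f (mix d1 x z) * f (mix d1 z x)" using f True z by (simp add: splits_at_def)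
    ultimately show ?thesis
      using True z by (simp add: tensor_def on_Rd_def slice_fst_def slice_snd_def pair mult.commute)
  qed (simp add: tensor_def on_Rd_def off)
qed

text \<open>
  Density of the products. Starting from a product at position \<open>j\<close>, freezing coordinate \<open>j\<close> gives products
  at position \<open>j + 1\<close>, so descending induction from \<open>d1\<close>, where the products are tensors, reaches \<open>j = 0\<close>,
  where every function is one.
\<close>

lemma functional_zero_if_zero_on_tensors:
  assumes u: "GS_functional m (d1 + d2) s \<sigma> u"
    and pos: "\<And>i. s i \<ge> 0" "\<And>i. \<sigma> i \<ge> 0"
    and tensors: "\<And>\<phi>1 \<phi>2. \<phi>1 \<in> GS_space m d1 (s \<circ> (\<lambda>i. i)) (\<sigma> \<circ> (\<lambda>i. i)) \<Longrightarrow>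
      \<phi>2 \<in> GS_space m d2 (s \<circ> (\<lambda>i. d1 + i)) (\<sigma> \<circ> (\<lambda>i. d1 + i)) \<Longrightarrow> u (tensor d1 d2 \<phi>1 \<phi>2) = 0"
    and f: "f \<in> GS_space m (d1 + d2) s \<sigma>"
  shows "u f = 0"
proof -
  let ?V = "GS_space m (d1 + d2) s \<sigma>"
  have lin: "linear_on_space ?V u" using u by (simp add: GS_functional_def)
  have "u f = 0" if "j \<le> d1" "f \<in> ?V" "splits_at (d1 + d2) j f" for j f
    using that
  proof (induction j arbitrary: f rule: inc_induct)
    case base
    show ?case
    proof (cases "\<exists>z\<in>Rd (d1 + d2). f z \<noteq> 0")
      case True
      then obtain z where z: "z \<in> Rd (d1 + d2)" "f z \<noteq> 0" by blast
      let ?T = "tensor d1 d2 (slice_fst d1 d2 f (snd_pt d1 d2 z)) (slice_snd d1 d2 f (fst_pt d1 d2 z))"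
      have T: "?T = (\<lambda>x. f z * f x)"
        by (rule splits_at_imp_tensor[OF base(2) GS_space_off[OF base(1)] z(1)])
      have "u ?T = 0"
        using snd_split.slice_in_GS_space[OF base(1)] fst_split.slice_in_GS_space[OF base(1)]
        by (intro tensors) (simp_all only: fst_split_slice snd_split_slice)
      then have "f z * u f = 0" by (simp only: T linear_mult[OF lin base(1)])
      then show ?thesis using z(2) by simp
    next
      case False
      then have "f = (\<lambda>_. 0)" using GS_space_off[OF base(1)] by blast
      then show ?thesis using linear_zero[OF lin] by simp
    qed
  next
    case (step j)
    have j: "j < d1 + d2" using step.hyps by simp
    show ?case
    proof (rule functional_zero_by_freezing[OF u step.prems(1) j pos])
      fix y q assume "on_Rd (d1 + d2) (\<lambda>x. f (x(j := y)) * q (x j)) \<in> ?V"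
      then show "u (on_Rd (d1 + d2) (\<lambda>x. f (x(j := y)) * q (x j))) = 0"
        by (rule step.IH[OF _ splits_at_freeze[OF step.prems(2) j]])
    qed
  qed
  from this[of 0 f] show ?thesis using f by (simp add: splits_at_def mix_def mult.commute)
qed

lemma slice_snd_tensor:
  assumes "x \<in> Rd d1" and off: "\<And>y. y \<notin> Rd d2 \<Longrightarrow> \<phi>2 y = 0"
  shows "slice_snd d1 d2 (tensor d1 d2 \<phi>1 \<phi>2) x = (\<lambda>y. \<phi>1 x * \<phi>2 y)"
proof
  fix y
  have "fst_pt d1 d2 (pair_pt d1 d2 x y) = x"
    using assms(1) by (auto simp: fst_pt_def pair_pt_def Rd_def PiE_iff extensional_def fun_eq_iff)
  moreover have "snd_pt d1 d2 (pair_pt d1 d2 x y) = y" if "y \<in> Rd d2"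
    using that by (auto simp: snd_pt_def pair_pt_def Rd_def PiE_iff extensional_def fun_eq_iff)
  moreover have "pair_pt d1 d2 x y \<in> Rd (d1 + d2)" by (simp add: pair_pt_def Rd_def)
  ultimately show "slice_snd d1 d2 (tensor d1 d2 \<phi>1 \<phi>2) x y = \<phi>1 x * \<phi>2 y"
    by (simp add: slice_snd_def tensor_def on_Rd_def off)
qed

lemma slice_fst_tensor:
  assumes "y \<in> Rd d2" and off: "\<And>x. x \<notin> Rd d1 \<Longrightarrow> \<phi>1 x = 0"
  shows "slice_fst d1 d2 (tensor d1 d2 \<phi>1 \<phi>2) y = (\<lambda>x. \<phi>2 y * \<phi>1 x)"
proof
  fix x
  have "snd_pt d1 d2 (pair_pt d1 d2 x y) = y"
    using assms(1) by (auto simp: snd_pt_def pair_pt_def Rd_def PiE_iff extensional_def fun_eq_iff)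
  moreover have "fst_pt d1 d2 (pair_pt d1 d2 x y) = x" if "x \<in> Rd d1"
    using that by (auto simp: fst_pt_def pair_pt_def Rd_def PiE_iff extensional_def fun_eq_iff)
  moreover have "pair_pt d1 d2 x y \<in> Rd (d1 + d2)" by (simp add: pair_pt_def Rd_def)
  ultimately show "slice_fst d1 d2 (tensor d1 d2 \<phi>1 \<phi>2) y x = \<phi>2 y * \<phi>1 x"
    by (simp add: slice_fst_def tensor_def on_Rd_def off mult.commute)
qed

lemma gs_bounded_tensor:
  assumes \<phi>1: "gs_bounded d1 (s \<circ> (\<lambda>i. i)) (\<sigma> \<circ> (\<lambda>i. i)) h C1 \<phi>1"
    and \<phi>2: "gs_bounded d2 (s \<circ> (\<lambda>i. d1 + i)) (\<sigma> \<circ> (\<lambda>i. d1 + i)) h C2 \<phi>2" and h: "h > 0"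
  shows "gs_bounded (d1 + d2) s \<sigma> h (C1 * C2) (tensor d1 d2 \<phi>1 \<phi>2)"
proof -
  let ?D1 = "\<lambda>\<beta>. multi_deriv d1 \<beta> \<phi>1" and ?D2 = "\<lambda>\<beta>. multi_deriv d2 \<beta> \<phi>2"
  let ?b2 = "\<lambda>\<beta> i. \<beta> (d1 + i)" and ?x1 = "fst_pt d1 d2" and ?x2 = "snd_pt d1 d2"
  define T where "T \<beta> = on_Rd (d1 + d2) (\<lambda>x. ?D1 (zero_beyond d1 \<beta>) (?x1 x) * ?D2 (?b2 \<beta>) (?x2 x))" for \<beta>
  have R: "?x1 x \<in> Rd d1" "?x2 x \<in> Rd d2" for x by (auto simp: fst_pt_def snd_pt_def Rd_def)
  have "smooth_family (d1 + d2) T"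
    unfolding smooth_family_def
  proof (intro conjI allI impI)
    fix \<beta> j x assume j: "j < d1 + d2" and x: "x \<in> Rd (d1 + d2)"
    let ?\<beta>' = "\<beta>(j := Suc (\<beta> j))"
    let ?F = "\<lambda>\<beta> x. ?D1 (zero_beyond d1 \<beta>) (?x1 x) * ?D2 (?b2 \<beta>) (?x2 x)"
    have "((\<lambda>t. ?F \<beta> (x(j := t))) has_vector_derivative ?F ?\<beta>' x) (at (x j))"
    proof (cases "j < d1")
      case True
      have pts: "?x1 (x(j := t)) = (?x1 x)(j := t)" "?x2 (x(j := t)) = ?x2 x" for t
        using True by (auto simp: fst_pt_def snd_pt_def restrict_def fun_eq_iff)
      have \<beta>: "zero_beyond d1 ?\<beta>' = (zero_beyond d1 \<beta>)(j := Suc (zero_beyond d1 \<beta> j))" "?b2 ?\<beta>' = ?b2 \<beta>"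
        using True by (auto simp: zero_beyond_def)
      have "(?x1 x)(j := x j) = ?x1 x" using True by (auto simp: fst_pt_def)
      then show ?thesis
        using smooth_familyD[OF gs_boundedD(1)[OF \<phi>1] True R(1), of "zero_beyond d1 \<beta>" x "x j"]
        unfolding pts \<beta> by (intro has_vector_derivative_mult_left) simp
    next
      case False
      define k where "k = j - d1"
      have k: "k < d2" "j = d1 + k" using j False by (auto simp: k_def)
      have pts: "?x1 (x(j := t)) = ?x1 x" "?x2 (x(j := t)) = (?x2 x)(k := t)" for t
        using k by (auto simp: fst_pt_def snd_pt_def restrict_def fun_eq_iff)
      have \<beta>: "zero_beyond d1 ?\<beta>' = zero_beyond d1 \<beta>" "?b2 ?\<beta>' = (?b2 \<beta>)(k := Suc (?b2 \<beta> k))"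
        using k by (auto simp: zero_beyond_def)
      have "(?x2 x)(k := x j) = ?x2 x" using k by (auto simp: snd_pt_def)
      then show ?thesis
        using smooth_familyD[OF gs_boundedD(1)[OF \<phi>2] k(1) R(2), of "?b2 \<beta>" x "x j"]
        unfolding pts \<beta> by (intro has_vector_derivative_mult_right) simp
    qed
    then show "((\<lambda>t. T \<beta> (x(j := t))) has_vector_derivative T ?\<beta>' x) (at (x j))"
      using j x by (simp add: T_def on_Rd_def)
  qed (simp add: T_def on_Rd_def)
  moreover have "bound_family (d1 + d2) s \<sigma> h (C1 * C2) T"
    unfolding bound_family_def
  proof (intro allI ballI)
    fix \<alpha> \<beta> x assume x: "x \<in> Rd (d1 + d2)"
    let ?w1 = "weight d1 (s \<circ> (\<lambda>i. i)) (\<sigma> \<circ> (\<lambda>i. i)) h \<alpha> \<beta>"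
    let ?w2 = "weight d2 (s \<circ> (\<lambda>i. d1 + i)) (\<sigma> \<circ> (\<lambda>i. d1 + i)) h (?b2 \<alpha>) (?b2 \<beta>)"
    have m: "monomial (d1 + d2) \<alpha> x = monomial d1 \<alpha> (?x1 x) * monomial d2 (?b2 \<alpha>) (?x2 x)"
      by (simp add: monomial_def fst_split.prod_split fst_pt_def snd_pt_def)
    have w: "weight (d1 + d2) s \<sigma> h \<alpha> \<beta> = ?w1 * ?w2"
      by (simp add: weight_def fst_split.prod_split)
    have b1: "\<bar>monomial d1 \<alpha> (?x1 x)\<bar> * cmod (?D1 (zero_beyond d1 \<beta>) (?x1 x)) \<le> C1 * ?w1"
      using bound_familyD[OF gs_boundedD(2)[OF \<phi>1] R(1), of \<alpha> x "zero_beyond d1 \<beta>"]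
      by (simp add: weight_def zero_beyond_def)
    have b2: "\<bar>monomial d2 (?b2 \<alpha>) (?x2 x)\<bar> * cmod (?D2 (?b2 \<beta>) (?x2 x)) \<le> C2 * ?w2"
      by (rule bound_familyD[OF gs_boundedD(2)[OF \<phi>2] R(2)])
    have "(\<bar>monomial d1 \<alpha> (?x1 x)\<bar> * cmod (?D1 (zero_beyond d1 \<beta>) (?x1 x))) *
        (\<bar>monomial d2 (?b2 \<alpha>) (?x2 x)\<bar> * cmod (?D2 (?b2 \<beta>) (?x2 x))) \<le> (C1 * ?w1) * (C2 * ?w2)"
      using gs_bounded_nonneg[OF \<phi>1] h by (intro mult_mono[OF b1 b2]) auto
    then show "\<bar>monomial (d1 + d2) \<alpha> x\<bar> * cmod (T \<beta> x) \<le> C1 * C2 * weight (d1 + d2) s \<sigma> h \<alpha> \<beta>"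
      using x by (simp only: m w T_def on_Rd_def if_True norm_mult abs_mult mult_ac)
  qed
  ultimately show ?thesis
  proof (rule gs_boundedI)
    have "zero_beyond d1 (\<lambda>_. 0) = (\<lambda>_. 0)" by (auto simp: zero_beyond_def)
    then show "tensor d1 d2 \<phi>1 \<phi>2 = T (\<lambda>_. 0)" by (simp add: T_def tensor_def)
  qed
qed

lemma tensor_in_GS_space:
  assumes \<phi>1: "\<phi>1 \<in> GS_space m d1 (s \<circ> (\<lambda>i. i)) (\<sigma> \<circ> (\<lambda>i. i))"
    and \<phi>2: "\<phi>2 \<in> GS_space m d2 (s \<circ> (\<lambda>i. d1 + i)) (\<sigma> \<circ> (\<lambda>i. d1 + i))"
  shows "tensor d1 d2 \<phi>1 \<phi>2 \<in> GS_space m (d1 + d2) s \<sigma>"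
proof (cases m)
  case True
  then obtain h1 C1 h2 C2 where h: "h1 > 0" "h2 > 0"
    and "gs_bounded d1 (s \<circ> (\<lambda>i. i)) (\<sigma> \<circ> (\<lambda>i. i)) h1 C1 \<phi>1"
    and "gs_bounded d2 (s \<circ> (\<lambda>i. d1 + i)) (\<sigma> \<circ> (\<lambda>i. d1 + i)) h2 C2 \<phi>2"
    using \<phi>1 \<phi>2 unfolding GS_space_def by auto
  then have "gs_bounded d1 (s \<circ> (\<lambda>i. i)) (\<sigma> \<circ> (\<lambda>i. i)) (max h1 h2) C1 \<phi>1"
    "gs_bounded d2 (s \<circ> (\<lambda>i. d1 + i)) (\<sigma> \<circ> (\<lambda>i. d1 + i)) (max h1 h2) C2 \<phi>2"
    by (auto intro: gs_bounded_mono)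
  moreover have "max h1 h2 > 0" using h by simp
  ultimately have "\<exists>h>0. \<exists>C. gs_bounded (d1 + d2) s \<sigma> h C (tensor d1 d2 \<phi>1 \<phi>2)" using gs_bounded_tensor by blast
  then show ?thesis using True by (simp add: GS_space_def)
next
  case False
  have "\<exists>C. gs_bounded (d1 + d2) s \<sigma> h C (tensor d1 d2 \<phi>1 \<phi>2)" if h: "h > 0" for h
  proof -
    have "\<exists>C. gs_bounded d1 (s \<circ> (\<lambda>i. i)) (\<sigma> \<circ> (\<lambda>i. i)) h C \<phi>1"
      "\<exists>C. gs_bounded d2 (s \<circ> (\<lambda>i. d1 + i)) (\<sigma> \<circ> (\<lambda>i. d1 + i)) h C \<phi>2"
      using \<phi>1 \<phi>2 False h unfolding GS_space_def by simp_all
    then show ?thesis using gs_bounded_tensor[OF _ _ h] by blast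
  qed
  then show ?thesis using False by (simp add: GS_space_def)
qed

section \<open>The tensor product of two functionals\<close>

text \<open>
  The two iterated functionals agree on tensors, hence everywhere by density; so does any other functional
  with the same values on tensors.
\<close>

lemma tensor_product_functional:
  fixes m :: bool and s \<sigma> :: "nat \<Rightarrow> real"
  defines "V1 \<equiv> GS_space m d1 (s \<circ> (\<lambda>i. i)) (\<sigma> \<circ> (\<lambda>i. i))"
    and "V2 \<equiv> GS_space m d2 (s \<circ> (\<lambda>i. d1 + i)) (\<sigma> \<circ> (\<lambda>i. d1 + i))"
    and "V \<equiv> GS_space m (d1 + d2) s \<sigma>"
  assumes pos: "\<And>i. s i \<ge> 0" "\<And>i. \<sigma> i \<ge> 0"
    and f1: "GS_functional m d1 (s \<circ> (\<lambda>i. i)) (\<sigma> \<circ> (\<lambda>i. i)) f1"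
    and f2: "GS_functional m d2 (s \<circ> (\<lambda>i. d1 + i)) (\<sigma> \<circ> (\<lambda>i. d1 + i)) f2"
    and \<phi>: "\<phi> \<in> V"
    and \<psi>1: "\<psi>1 = on_Rd d1 (\<lambda>x1. f2 (slice_snd d1 d2 \<phi> x1))"
    and \<psi>2: "\<psi>2 = on_Rd d2 (\<lambda>x2. f1 (slice_fst d1 d2 \<phi> x2))"
  shows "\<psi>1 \<in> V1 \<and> \<psi>2 \<in> V2 \<and>
    (\<exists>!f. (f \<in> V \<rightarrow>\<^sub>E UNIV \<and> GS_functional m (d1 + d2) s \<sigma> f) \<and>
      (\<forall>\<phi>1\<in>V1. \<forall>\<phi>2\<in>V2. f (tensor d1 d2 \<phi>1 \<phi>2) = f1 \<phi>1 * f2 \<phi>2) \<and>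
      f \<phi> = f1 \<psi>1 \<and> f1 \<psi>1 = f2 \<psi>2)"
proof -
  have lin1: "linear_on_space V1 f1" and lin2: "linear_on_space V2 f2"
    using f1 f2 by (simp_all add: GS_functional_def V1_def V2_def)
  define F where "F g = f1 (fst_split.partial_apply f2 g)" for g
  define G where "G g = f2 (snd_split.partial_apply f1 g)" for g
  have F: "GS_functional m (d1 + d2) s \<sigma> F"
    unfolding F_def[abs_def] by (rule fst_split.GS_functional_iterated[OF f2 f1])
  have G: "GS_functional m (d1 + d2) s \<sigma> G"
    unfolding G_def[abs_def] by (rule snd_split.GS_functional_iterated[OF f1 f2])
  have p1: "fst_split.partial_apply f2 g = on_Rd d1 (\<lambda>x1. f2 (slice_snd d1 d2 g x1))" for g
    by (simp add: fst_split.partial_apply_def fst_split_slice)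
  have p2: "snd_split.partial_apply f1 g = on_Rd d2 (\<lambda>x2. f1 (slice_fst d1 d2 g x2))" for g
    by (simp add: snd_split.partial_apply_def snd_split_slice)
  have mem1: "\<psi>1 \<in> V1"
    using fst_split.partial_apply_in_GS_space[OF \<phi>[unfolded V_def] f2] unfolding p1 \<psi>1 V1_def .
  have mem2: "\<psi>2 \<in> V2"
    using snd_split.partial_apply_in_GS_space[OF \<phi>[unfolded V_def] f1] unfolding p2 \<psi>2 V2_def .
  have Ften: "F (tensor d1 d2 \<phi>1 \<phi>2) = f1 \<phi>1 * f2 \<phi>2"
    and Gten: "G (tensor d1 d2 \<phi>1 \<phi>2) = f1 \<phi>1 * f2 \<phi>2"
    if \<phi>12: "\<phi>1 \<in> V1" "\<phi>2 \<in> V2" for \<phi>1 \<phi>2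
  proof -
    note off1 = GS_space_off[OF \<phi>12(1)[unfolded V1_def]]
    note off2 = GS_space_off[OF \<phi>12(2)[unfolded V2_def]]
    have "on_Rd d1 (\<lambda>x1. f2 (slice_snd d1 d2 (tensor d1 d2 \<phi>1 \<phi>2) x1)) = (\<lambda>x. f2 \<phi>2 * \<phi>1 x)"
      by (auto simp: on_Rd_def slice_snd_tensor[OF _ off2] linear_mult[OF lin2 \<phi>12(2)] off1)
    then show "F (tensor d1 d2 \<phi>1 \<phi>2) = f1 \<phi>1 * f2 \<phi>2"
      by (simp add: F_def p1 linear_mult[OF lin1 \<phi>12(1)])
    have "on_Rd d2 (\<lambda>x2. f1 (slice_fst d1 d2 (tensor d1 d2 \<phi>1 \<phi>2) x2)) = (\<lambda>x. f1 \<phi>1 * \<phi>2 x)"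
      by (auto simp: on_Rd_def slice_fst_tensor[OF _ off1] linear_mult[OF lin1 \<phi>12(1)] off2)
    then show "G (tensor d1 d2 \<phi>1 \<phi>2) = f1 \<phi>1 * f2 \<phi>2"
      by (simp add: G_def p2 linear_mult[OF lin2 \<phi>12(2)])
  qed
  have agree: "u g = v g"
    if u: "GS_functional m (d1 + d2) s \<sigma> u" and v: "GS_functional m (d1 + d2) s \<sigma> v"
      and eq: "\<And>\<phi>1 \<phi>2. \<phi>1 \<in> V1 \<Longrightarrow> \<phi>2 \<in> V2 \<Longrightarrow> u (tensor d1 d2 \<phi>1 \<phi>2) = v (tensor d1 d2 \<phi>1 \<phi>2)"
      and g: "g \<in> V" for u v g
  proof -
    have "u g - v g = 0"
      by (rule functional_zero_if_zero_on_tensors[OF GS_functional_diff[OF u v] pos _ g[unfolded V_def]])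
         (simp add: eq[unfolded V1_def V2_def])
    then show ?thesis by simp
  qed
  have "F \<phi> = G \<phi>" by (rule agree[OF F G _ \<phi>]) (simp add: Ften Gten)
  then have fubini: "f1 \<psi>1 = f2 \<psi>2" by (simp add: F_def G_def p1 p2 \<psi>1 \<psi>2)
  have F\<phi>: "F \<phi> = f1 \<psi>1" by (simp add: F_def p1 \<psi>1)
  have tenV: "tensor d1 d2 \<phi>1 \<phi>2 \<in> V" if "\<phi>1 \<in> V1" "\<phi>2 \<in> V2" for \<phi>1 \<phi>2
    using tensor_in_GS_space that unfolding V_def V1_def V2_def by blast
  show ?thesis
  proof (intro conjI mem1 mem2 ex1I[of _ "restrict F V"])
    show "restrict F V \<in> V \<rightarrow>\<^sub>E UNIV" by simp
    show "GS_functional m (d1 + d2) s \<sigma> (restrict F V)"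
      unfolding V_def by (rule GS_functional_restrict[OF F])
    show "\<forall>\<phi>1\<in>V1. \<forall>\<phi>2\<in>V2. restrict F V (tensor d1 d2 \<phi>1 \<phi>2) = f1 \<phi>1 * f2 \<phi>2"
      using tenV Ften by simp
    show "restrict F V \<phi> = f1 \<psi>1" using \<phi> F\<phi> by simp
    show "f1 \<psi>1 = f2 \<psi>2" by (rule fubini)
  next
    fix f assume f: "(f \<in> V \<rightarrow>\<^sub>E UNIV \<and> GS_functional m (d1 + d2) s \<sigma> f) \<and>
      (\<forall>\<phi>1\<in>V1. \<forall>\<phi>2\<in>V2. f (tensor d1 d2 \<phi>1 \<phi>2) = f1 \<phi>1 * f2 \<phi>2) \<and>
      f \<phi> = f1 \<psi>1 \<and> f1 \<psi>1 = f2 \<psi>2"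
    have "f g = F g" if "g \<in> V" for g
    proof (rule agree[OF _ F _ that])
      show "GS_functional m (d1 + d2) s \<sigma> f" using f by blast
      show "f (tensor d1 d2 \<phi>1 \<phi>2) = F (tensor d1 d2 \<phi>1 \<phi>2)" if "\<phi>1 \<in> V1" "\<phi>2 \<in> V2" for \<phi>1 \<phi>2
        using f Ften[OF that] that by metis
    qed
    moreover have "f \<in> extensional V" using f by (simp add: PiE_def)
    ultimately show "f = restrict F V"
      by (intro extensionalityI[of f V]) auto
  qed
qed

end

lemma gs_weights_one_block:
  assumes "\<And>i. i < d \<Longrightarrow> s i = s0" "\<And>i. i < d \<Longrightarrow> \<sigma> i = \<sigma>0"
  shows "gs_weights [d] [s0] [\<sigma>0] d s \<sigma>"
  by standard (auto simp: fact_powr_def block_def atLeast0LessThan prod_powr_distrib assms intro!: prod.cong)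

lemma gs_weights_two_blocks:
  "gs_weights [d1, d2] [s1, s2] [\<sigma>1, \<sigma>2] (d1 + d2)
    (\<lambda>i. if i < d1 then s1 else s2) (\<lambda>i. if i < d1 then \<sigma>1 else \<sigma>2)"
proof -
  have "fact_powr [d1, d2] [r1, r2] \<alpha> = (\<Prod>i<d1 + d2. fact (\<alpha> i) powr (if i < d1 then r1 else r2))"
    for r1 r2 :: real and \<alpha>
  proof -
    have "{..<d1 + d2} = {..<d1} \<union> {d1..<d1 + d2}" by auto
    then have "(\<Prod>i<d1 + d2. fact (\<alpha> i) powr (if i < d1 then r1 else r2))
        = (\<Prod>i<d1. fact (\<alpha> i) powr r1) * (\<Prod>i\<in>{d1..<d1 + d2}. fact (\<alpha> i) powr r2)"
      by (simp add: prod.union_disjoint ivl_disj_int)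
    then show ?thesis
      by (simp add: fact_powr_def block_def numeral_2_eq_2 lessThan_Suc atLeast0LessThan prod_powr_distrib mult.commute)
  qed
  then show ?thesis by unfold_locales simp_all
qed

theorem theorem1p2:
  fixes d1 d2 :: nat and s1 s2 \<sigma>1 \<sigma>2 :: real
  assumes "s1 > 0" and "s2 > 0" and "\<sigma>1 > 0" and "\<sigma>2 > 0"
  shows "(\<forall>f1 \<in> GS_S_dual [d1] [s1] [\<sigma>1]. \<forall>f2 \<in> GS_S_dual [d2] [s2] [\<sigma>2].
          \<forall>\<phi> \<in> GS_S [d1, d2] [s1, s2] [\<sigma>1, \<sigma>2]. \<forall>\<psi>1 \<psi>2.
            \<psi>1 = on_Rd d1 (\<lambda>x1. f2 (slice_snd d1 d2 \<phi> x1)) \<longrightarrow>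
            \<psi>2 = on_Rd d2 (\<lambda>x2. f1 (slice_fst d1 d2 \<phi> x2)) \<longrightarrow>
            \<psi>1 \<in> GS_S [d1] [s1] [\<sigma>1] \<and> \<psi>2 \<in> GS_S [d2] [s2] [\<sigma>2] \<and>
            (\<exists>!f. f \<in> GS_S_dual [d1, d2] [s1, s2] [\<sigma>1, \<sigma>2] \<and>
              (\<forall>\<phi>1 \<in> GS_S [d1] [s1] [\<sigma>1]. \<forall>\<phi>2 \<in> GS_S [d2] [s2] [\<sigma>2].
                f (tensor d1 d2 \<phi>1 \<phi>2) = f1 \<phi>1 * f2 \<phi>2) \<and>
              f \<phi> = f1 \<psi>1 \<and> f1 \<psi>1 = f2 \<psi>2))
       \<and> (\<forall>f1 \<in> GS_Sigma_dual [d1] [s1] [\<sigma>1]. \<forall>f2 \<in> GS_Sigma_dual [d2] [s2] [\<sigma>2].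
          \<forall>\<phi> \<in> GS_Sigma [d1, d2] [s1, s2] [\<sigma>1, \<sigma>2]. \<forall>\<psi>1 \<psi>2.
            \<psi>1 = on_Rd d1 (\<lambda>x1. f2 (slice_snd d1 d2 \<phi> x1)) \<longrightarrow>
            \<psi>2 = on_Rd d2 (\<lambda>x2. f1 (slice_fst d1 d2 \<phi> x2)) \<longrightarrow>
            \<psi>1 \<in> GS_Sigma [d1] [s1] [\<sigma>1] \<and> \<psi>2 \<in> GS_Sigma [d2] [s2] [\<sigma>2] \<and>
            (\<exists>!f. f \<in> GS_Sigma_dual [d1, d2] [s1, s2] [\<sigma>1, \<sigma>2] \<and>
              (\<forall>\<phi>1 \<in> GS_Sigma [d1] [s1] [\<sigma>1]. \<forall>\<phi>2 \<in> GS_Sigma [d2] [s2] [\<sigma>2].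
                f (tensor d1 d2 \<phi>1 \<phi>2) = f1 \<phi>1 * f2 \<phi>2) \<and>
              f \<phi> = f1 \<psi>1 \<and> f1 \<psi>1 = f2 \<psi>2))"
proof -
  define s where "s = (\<lambda>i. if i < d1 then s1 else s2)"
  define \<sigma> where "\<sigma> = (\<lambda>i. if i < d1 then \<sigma>1 else \<sigma>2)"
  have pos: "s i \<ge> 0" "\<sigma> i \<ge> 0" for i using assms by (auto simp: s_def \<sigma>_def)
  interpret W: gs_weights "[d1, d2]" "[s1, s2]" "[\<sigma>1, \<sigma>2]" "d1 + d2" s \<sigma>
    unfolding s_def \<sigma>_def by (rule gs_weights_two_blocks)
  interpret W1: gs_weights "[d1]" "[s1]" "[\<sigma>1]" d1 "s \<circ> (\<lambda>i. i)" "\<sigma> \<circ> (\<lambda>i. i)"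
    by (rule gs_weights_one_block) (auto simp: s_def \<sigma>_def)
  interpret W2: gs_weights "[d2]" "[s2]" "[\<sigma>2]" d2 "s \<circ> (\<lambda>i. d1 + i)" "\<sigma> \<circ> (\<lambda>i. d1 + i)"
    by (rule gs_weights_one_block) (auto simp: s_def \<sigma>_def)
  show ?thesis
    unfolding W.GS_S_dual_iff W.GS_Sigma_dual_iff
      W.GS_S_eq W1.GS_S_eq W2.GS_S_eq W.GS_Sigma_eq W1.GS_Sigma_eq W2.GS_Sigma_eq
  proof ((rule conjI; intro ballI allI impI), goal_cases)
    case (1 f1 f2 \<phi> \<psi>1 \<psi>2)
    then show ?case
      by (intro two_blocks.tensor_product_functional[where s = s and \<sigma> = \<sigma>, OF pos])
         (simp_all add: W1.GS_S_dual_iff W2.GS_S_dual_iff)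
  next
    case (2 f1 f2 \<phi> \<psi>1 \<psi>2)
    then show ?case
      by (intro two_blocks.tensor_product_functional[where s = s and \<sigma> = \<sigma>, OF pos])
         (simp_all add: W1.GS_Sigma_dual_iff W2.GS_Sigma_dual_iff)
  qed
qed

end
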